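(* Let $\mu\in M_{\text{loc}}$, and let $D_\mu f=Xf*\mu$ $(f\in L^1_{\text{loc}})$ and $\overline{D}_\mu\nu=X\nu*\mu$ $(\nu\in M_{\text{loc}})$. Then the following conditions are equivalent: (a) $D_{\mu}$ is a Montel derivation on $L^1_{\text{loc}}$. (b) $D_{\mu}$ is a weakly Montel derivation on $L^1_{\text{loc}}$. (c) $\mu$ is absolutely continuous (with respect to Lebesgue measure on $\mathbb R^+$). (d) $\overline{D}_{\mu}$ is a Montel derivation on $M_{\text{loc}}$. (e) $\overline{D}_{\mu}$ is a weakly Montel derivation on $M_{\text{loc}}$.
   Context: All spaces are complex and $\mathbb R^+=[0,\infty)$. $L^1_{\text{loc}}$ is the space of (equivalence classes of) locally integrable functions on $\mathbb R^+$ and $M_{\text{loc}}$ is the space of complex Radon measures on $\mathbb R^+$, that is, locally finite complex Borel measures on $\mathbb R^+$; $L^1_{\text{loc}}\subseteq M_{\text{loc}}$ via $f\mapsto f(t)\,dt$. With the seminorms $\mu\mapsto|\mu|([0,n))$, $n\in\mathbb N$ (so $f\mapsto\int_0^n|f(t)|\,dt$ on $L^1_{\text{loc}}$), both are Fréchet algebras under convolution, $(f*g)(t)=\int_0^tf(s)g(t-s)\,ds$ for functions and $\int_{\mathbb R^+} h\,d(\nu*\mu)=\int_{\mathbb R^+}\int_{\mathbb R^+}h(t+s)\,d\mu(s)\,d\nu(t)$ (for compactly supported continuous $h$) for measures. $X$ is multiplication by the coordinate: $(Xf)(t)=tf(t)$ for functions and $d(X\nu)(t)=t\,d\nu(t)$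 for measures. It is known that $D_\mu$ and $\overline D_\mu$ are continuous derivations on $L^1_{\text{loc}}$ and $M_{\text{loc}}$ respectively. A linear operator between two Fréchet spaces is called Montel (respectively weakly Montel) if it maps bounded sets to relatively compact (respectively weakly relatively compact) sets. *)

theory Defs
  imports "HOL-Analysis.Analysis"
begin

section \<open>Spaces topologised by a sequence of seminorms\<close>

text \<open>
  A Frechet space is presented by its scalar multiplication \<open>s\<close> over the complex numbers and a
  sequence \<open>p\<close> of seminorms generating its topology.
\<close>

definition seminorm_topology :: "(nat \<Rightarrow> 'v::ab_group_add \<Rightarrow> real) \<Rightarrow> 'v topology" where
  "seminorm_topology p = topology_generated_by {{y. p n (y - x) < e} |n x e. 0 < e}"

definition continuous_functional ::
  "(complex \<Rightarrow> 'v::ab_group_add \<Rightarrow> 'v) \<Rightarrow> (nat \<Rightarrow> 'v \<Rightarrow> real) \<Rightarrow> ('v \<Rightarrow> complex) \<Rightarrow> bool" where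
  "continuous_functional s p \<phi> \<longleftrightarrow>
     Vector_Spaces.linear s (*) \<phi> \<and> continuous_map (seminorm_topology p) euclidean \<phi>"

definition weak_topology ::
  "(complex \<Rightarrow> 'v::ab_group_add \<Rightarrow> 'v) \<Rightarrow> (nat \<Rightarrow> 'v \<Rightarrow> real) \<Rightarrow> 'v topology" where
  "weak_topology s p =
     topology_generated_by {\<phi> -` U |\<phi> U. continuous_functional s p \<phi> \<and> open U}"

definition seminorm_bounded :: "(nat \<Rightarrow> 'v \<Rightarrow> real) \<Rightarrow> 'v set \<Rightarrow> bool" where
  "seminorm_bounded p B \<longleftrightarrow> (\<forall>n. bdd_above (p n ` B))"

definition relatively_compactin :: "'v topology \<Rightarrow> 'v set \<Rightarrow> bool" where
  "relatively_compactin T S \<longleftrightarrow> compactin T (T closure_of S)"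

definition montel_operator ::
  "(complex \<Rightarrow> 'v::ab_group_add \<Rightarrow> 'v) \<Rightarrow> (nat \<Rightarrow> 'v \<Rightarrow> real) \<Rightarrow>
   (complex \<Rightarrow> 'w::ab_group_add \<Rightarrow> 'w) \<Rightarrow> (nat \<Rightarrow> 'w \<Rightarrow> real) \<Rightarrow> ('v \<Rightarrow> 'w) \<Rightarrow> bool" where
  "montel_operator s p s' p' T \<longleftrightarrow>
     Vector_Spaces.linear s s' T \<and>
     (\<forall>B. seminorm_bounded p B \<longrightarrow> relatively_compactin (seminorm_topology p') (T ` B))"

definition weakly_montel_operator ::
  "(complex \<Rightarrow> 'v::ab_group_add \<Rightarrow> 'v) \<Rightarrow> (nat \<Rightarrow> 'v \<Rightarrow> real) \<Rightarrow>
   (complex \<Rightarrow> 'w::ab_group_add \<Rightarrow> 'w) \<Rightarrow> (nat \<Rightarrow> 'w \<Rightarrow> real) \<Rightarrow> ('v \<Rightarrow> 'w) \<Rightarrow> bool" where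
  "weakly_montel_operator s p s' p' T \<longleftrightarrow>
     Vector_Spaces.linear s s' T \<and>
     (\<forall>B. seminorm_bounded p B \<longrightarrow> relatively_compactin (weak_topology s' p') (T ` B))"

definition derivation ::
  "(complex \<Rightarrow> 'v::ab_group_add \<Rightarrow> 'v) \<Rightarrow> ('v \<Rightarrow> 'v \<Rightarrow> 'v) \<Rightarrow> ('v \<Rightarrow> 'v) \<Rightarrow> bool" where
  "derivation s m D \<longleftrightarrow>
     Vector_Spaces.linear s s D \<and> (\<forall>a b. D (m a b) = m (D a) b + m a (D b))"

definition montel_derivation ::
  "(complex \<Rightarrow> 'v::ab_group_add \<Rightarrow> 'v) \<Rightarrow> (nat \<Rightarrow> 'v \<Rightarrow> real) \<Rightarrow> ('v \<Rightarrow> 'v \<Rightarrow> 'v) \<Rightarrow> ('v \<Rightarrow> 'v) \<Rightarrow> bool" where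
  "montel_derivation s p m D \<longleftrightarrow> derivation s m D \<and> montel_operator s p s p D"

definition weakly_montel_derivation ::
  "(complex \<Rightarrow> 'v::ab_group_add \<Rightarrow> 'v) \<Rightarrow> (nat \<Rightarrow> 'v \<Rightarrow> real) \<Rightarrow> ('v \<Rightarrow> 'v \<Rightarrow> 'v) \<Rightarrow> ('v \<Rightarrow> 'v) \<Rightarrow> bool" where
  "weakly_montel_derivation s p m D \<longleftrightarrow> derivation s m D \<and> weakly_montel_operator s p s p D"


section \<open>Locally integrable functions on the half-line\<close>

definition locally_integrable :: "(real \<Rightarrow> complex) \<Rightarrow> bool" where
  "locally_integrable f \<longleftrightarrow> (\<forall>T. set_integrable lborel {0..T} f)"

text \<open>Values on the negative half-line are irrelevant.\<close>

definition l1loc_eq :: "(real \<Rightarrow> complex) \<Rightarrow> (real \<Rightarrow> complex) \<Rightarrow> bool" where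
  "l1loc_eq f g \<longleftrightarrow> locally_integrable f \<and> locally_integrable g \<and>
     (AE t in lborel. 0 \<le> t \<longrightarrow> f t = g t)"

quotient_type l1loc = "real \<Rightarrow> complex" / partial: l1loc_eq
proof (rule part_equivpI)
  show "\<exists>f. l1loc_eq f f"
    by (rule exI[of _ "\<lambda>_. 0"]) (simp add: l1loc_eq_def locally_integrable_def set_integrable_def)
  show "symp l1loc_eq"
    by (auto simp: symp_def l1loc_eq_def elim: eventually_mono)
  show "transp l1loc_eq"
    unfolding transp_def l1loc_eq_def by (auto elim: eventually_elim2)
qed

instantiation l1loc :: ab_group_add
begin

lift_definition zero_l1loc :: l1loc is "\<lambda>_. 0"
  by (simp add: l1loc_eq_def locally_integrable_def set_integrable_def)

lift_definition plus_l1loc :: "l1loc \<Rightarrow> l1loc \<Rightarrow> l1loc" is "\<lambda>f g t. f t + g t"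
  unfolding l1loc_eq_def locally_integrable_def by (auto elim: eventually_elim2)

lift_definition uminus_l1loc :: "l1loc \<Rightarrow> l1loc" is "\<lambda>f t. - f t"
  unfolding l1loc_eq_def locally_integrable_def
  by (auto simp: set_integrable_def elim: eventually_mono)

lift_definition minus_l1loc :: "l1loc \<Rightarrow> l1loc \<Rightarrow> l1loc" is "\<lambda>f g t. f t - g t"
  unfolding l1loc_eq_def locally_integrable_def by (auto elim: eventually_elim2)

instance
  by standard
    (transfer; auto simp: l1loc_eq_def locally_integrable_def algebra_simps
      set_integrable_def)+

end

lift_definition scale_l1loc :: "complex \<Rightarrow> l1loc \<Rightarrow> l1loc" is "\<lambda>c f t. c * f t"
  unfolding l1loc_eq_def locally_integrable_def
  by (auto elim: eventually_mono)

lemma vector_space_l1loc: "vector_space scale_l1loc"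
proof -
  have add: "locally_integrable (\<lambda>t. f t + g t)" if "locally_integrable f" "locally_integrable g" for f g
    using that by (simp add: locally_integrable_def)
  have scale: "locally_integrable (\<lambda>t. c * f t)" if "locally_integrable f" for c f
    using that by (simp add: locally_integrable_def)
  show ?thesis
    by (standard; transfer)
      (auto simp: l1loc_eq_def distrib_left distrib_right mult.assoc intro!: add scale)
qed

lemma locally_integrable_X:
  assumes "locally_integrable f"
  shows "locally_integrable (\<lambda>t. of_real t * f t)"
  unfolding locally_integrable_def
proof
  fix T :: real
  have f: "integrable lborel (\<lambda>t. indicator {0..T} t *\<^sub>R f t)"
    using assms by (auto simp: locally_integrable_def set_integrable_def)
  have m: "(\<lambda>t. indicator {0..T} t *\<^sub>R f t) \<in> borel_measurable lborel"
    using f by (rule borel_measurable_integrable)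
  have e: "(\<lambda>t. indicator {0..T} t *\<^sub>R (of_real t * f t)) =
      (\<lambda>t. of_real t * (indicator {0..T} t *\<^sub>R f t))"
    by (auto simp: fun_eq_iff indicator_def)
  have "integrable lborel (\<lambda>t. of_real t * (indicator {0..T} t *\<^sub>R f t))"
  proof (rule Bochner_Integration.integrable_bound)
    show "integrable lborel (\<lambda>t. of_real \<bar>T\<bar> * (indicator {0..T} t *\<^sub>R f t))"
      using f by (rule integrable_mult_right)
    show "(\<lambda>t. of_real t * (indicator {0..T} t *\<^sub>R f t)) \<in> borel_measurable lborel"
      using m by measurable
    show "AE t in lborel. norm (of_real t * (indicator {0..T} t *\<^sub>R f t))
        \<le> norm (of_real \<bar>T\<bar> * (indicator {0..T} t *\<^sub>R f t))"
    proof (rule AE_I2)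
      fix t
      show "norm (of_real t * (indicator {0..T} t *\<^sub>R f t)) \<le> norm (of_real \<bar>T\<bar> * (indicator {0..T} t *\<^sub>R f t))"
        by (cases "t \<in> {0..T}") (auto simp: norm_mult mult_right_mono)
    qed
  qed
  then show "set_integrable lborel {0..T} (\<lambda>t. of_real t * f t)"
    unfolding set_integrable_def e .
qed

lift_definition X_l1loc :: "l1loc \<Rightarrow> l1loc" is "\<lambda>f t. of_real t * f t"
proof -
  fix f g
  assume "l1loc_eq f g"
  then show "l1loc_eq (\<lambda>t. of_real t * f t) (\<lambda>t. of_real t * g t)"
    unfolding l1loc_eq_def using locally_integrable_X by auto
qed

definition bounded_borel :: "real set set" where
  "bounded_borel = {A \<in> sets borel. A \<subseteq> {0..} \<and> bounded A}"

lemma bounded_borel_bound: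
  assumes "A \<in> bounded_borel"
  obtains T where "A \<subseteq> {0..T}"
proof -
  obtain T where "\<And>x. x \<in> A \<Longrightarrow> norm x \<le> T"
    using assms by (auto simp: bounded_borel_def bounded_iff)
  then have "A \<subseteq> {0..T}"
    using assms by (force simp: bounded_borel_def)
  then show ?thesis ..
qed

lemma set_integrable_bounded_borel:
  assumes "locally_integrable f" "A \<in> bounded_borel"
  shows "set_integrable lborel A f"
proof -
  obtain T where "A \<subseteq> {0..T}"
    using assms(2) by (rule bounded_borel_bound)
  moreover have "set_integrable lborel {0..T} f"
    using assms(1) by (simp add: locally_integrable_def)
  ultimately show ?thesis
    using assms(2) by (auto intro: set_integrable_subset simp: bounded_borel_def)
qed

lemma l1loc_eq_set_integral:
  fixes \<psi> :: "complex \<Rightarrow> 'a::euclidean_space"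
  assumes fg: "l1loc_eq f g" and A: "A \<in> bounded_borel"
    and \<psi>: "\<psi> \<in> borel_measurable borel"
  shows "(LINT t:A|lborel. \<psi> (f t)) = (LINT t:A|lborel. \<psi> (g t))"
proof -
  have m: "(\<lambda>t. indicator A t *\<^sub>R \<psi> (h t)) \<in> borel_measurable lborel"
    if "locally_integrable h" for h
  proof -
    have h: "(\<lambda>t. indicator A t *\<^sub>R h t) \<in> borel_measurable lborel"
      using set_integrable_bounded_borel[OF that A] unfolding set_integrable_def
      by (rule borel_measurable_integrable)
    have "A \<in> sets lborel"
      using A by (simp add: bounded_borel_def)
    then have "(\<lambda>t. indicator A t *\<^sub>R \<psi> (indicator A t *\<^sub>R h t)) \<in> borel_measurable lborel"
      using h \<psi> by measurable
    also have "(\<lambda>t. indicator A t *\<^sub>R \<psi> (indicator A t *\<^sub>R h t)) = (\<lambda>t. indicator A t *\<^sub>R \<psi> (h t))"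
      by (auto simp: fun_eq_iff indicator_def)
    finally show ?thesis .
  qed
  have "AE t in lborel. indicator A t *\<^sub>R \<psi> (f t) = indicator A t *\<^sub>R \<psi> (g t)"
    using fg[unfolded l1loc_eq_def, THEN conjunct2, THEN conjunct2]
    by (rule eventually_mono) (use A in \<open>auto simp: bounded_borel_def indicator_def\<close>)
  then show ?thesis
    unfolding set_lebesgue_integral_def
    using fg by (intro integral_cong_AE m) (auto simp: l1loc_eq_def)
qed

lift_definition seminorm_l1loc :: "nat \<Rightarrow> l1loc \<Rightarrow> real" is
  "\<lambda>n f. LINT t:{0..<real n}|lborel. cmod (f t)"
  by (rule l1loc_eq_set_integral) (auto simp: bounded_borel_def)

lemma AE_lborel_reflect:
  assumes "AE s in lborel. P s"
  shows "AE s in lborel. P (t - s :: real)"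
proof -
  obtain N where N: "{s. \<not> P s} \<subseteq> N" "N \<in> null_sets lborel"
    using assms by (auto simp: eventually_ae_filter)
  have "N \<in> sets borel"
    using N(2) by (simp add: null_sets_def)
  then have "Measurable.pred borel (\<lambda>s. s \<notin> N)"
    by measurable
  moreover have "AE s in lborel. s \<notin> N"
    using N(2) by (rule AE_not_in)
  ultimately have "AE s in lborel. t + (-1) * s \<notin> N"
    by (rule AE_borel_affine[of "-1", rotated]) simp
  then show ?thesis
    by (rule eventually_mono) (use N(1) in auto)
qed

lemma conv_truncate:
  fixes f g :: "real \<Rightarrow> complex"
  assumes "t \<le> T"
  shows "indicator {0..t} s *\<^sub>R (f s * g (t - s)) =
    (indicator {0..T} s *\<^sub>R f s) * (indicator {0..T} (t - s) *\<^sub>R g (t - s))"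
  using assms by (auto simp: indicator_def)

lemma locally_integrable_conv:
  assumes "locally_integrable f" "locally_integrable g"
  shows "locally_integrable (\<lambda>t. LINT s:{0..t}|lborel. f s * g (t - s))"
  unfolding locally_integrable_def
proof
  fix T :: real
  define F where "F = (\<lambda>s. indicator {0..T} s *\<^sub>R f s)"
  define G where "G = (\<lambda>s. indicator {0..T} s *\<^sub>R g s)"
  have F: "integrable lborel F" and G: "integrable lborel G"
    using assms by (auto simp: locally_integrable_def set_integrable_def F_def G_def)
  have [measurable]: "F \<in> borel_measurable borel" "G \<in> borel_measurable borel"
    using borel_measurable_integrable[OF F] borel_measurable_integrable[OF G] by simp_all
  have m: "(\<lambda>(s, t). F s * G (t - s)) \<in> borel_measurable (lborel \<Otimes>\<^sub>M lborel)"
    by measurable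
  have GT: "integrable lborel (\<lambda>t. G (t - s))" for s
    using lborel_integrable_real_affine[OF G, of 1 "- s"] by simp
  have n: "(LINT t|lborel. norm (G (t - s))) = (LINT t|lborel. norm (G t))" for s
    using lborel_integral_real_affine[of 1 "\<lambda>t. norm (G t)" "- s"] by simp
  have "integrable (lborel \<Otimes>\<^sub>M lborel) (\<lambda>(s, t). F s * G (t - s))"
  proof (rule lborel_pair.Fubini_integrable[OF m])
    show "integrable lborel (\<lambda>s. LINT t|lborel. norm (case (s, t) of (s, t) \<Rightarrow> F s * G (t - s)))"
      using F by (simp add: norm_mult n)
    show "AE s in lborel. integrable lborel (\<lambda>t. case (s, t) of (s, t) \<Rightarrow> F s * G (t - s))"
      using GT by simp
  qed
  from lborel_pair.integrable_snd[OF this]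
  have "integrable lborel (\<lambda>t. LINT s|lborel. F s * G (t - s))"
    by simp
  then have "set_integrable lborel {0..T} (\<lambda>t. LINT s|lborel. F s * G (t - s))"
    unfolding set_integrable_def by (rule integrable_mult_indicator[rotated]) simp
  moreover have "indicator {0..T} t *\<^sub>R (LINT s:{0..t}|lborel. f s * g (t - s)) =
      indicator {0..T} t *\<^sub>R (LINT s|lborel. F s * G (t - s))" for t
  proof (cases "t \<le> T")
    case True
    have "(LINT s:{0..t}|lborel. f s * g (t - s)) = (LINT s|lborel. F s * G (t - s))"
      unfolding set_lebesgue_integral_def F_def G_def
      by (intro Bochner_Integration.integral_cong refl conv_truncate True)
    then show ?thesis
      by simp
  qed simp
  ultimately show "set_integrable lborel {0..T} (\<lambda>t. LINT s:{0..t}|lborel. f s * g (t - s))"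
    unfolding set_integrable_def by (simp only:)
qed

lemma conv_cong:
  assumes f: "locally_integrable f" "locally_integrable f'" "AE t in lborel. 0 \<le> t \<longrightarrow> f t = f' t"
    and g: "locally_integrable g" "locally_integrable g'" "AE t in lborel. 0 \<le> t \<longrightarrow> g t = g' t"
  shows "(LINT s:{0..t}|lborel. f s * g (t - s)) = (LINT s:{0..t}|lborel. f' s * g' (t - s))"
proof -
  have m: "(\<lambda>s. indicator {0..t} s *\<^sub>R (h s * k (t - s))) \<in> borel_measurable lborel"
    if "locally_integrable h" "locally_integrable k" for h k
  proof -
    have [measurable]: "(\<lambda>s. indicator {0..t} s *\<^sub>R h s) \<in> borel_measurable borel"
      "(\<lambda>s. indicator {0..t} s *\<^sub>R k s) \<in> borel_measurable borel"
      using that by (auto simp: locally_integrable_def set_integrable_def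
        dest!: spec[of _ t] borel_measurable_integrable)
    have "(\<lambda>s. (\<lambda>r. indicator {0..t} r *\<^sub>R k r) (t - s)) \<in> borel_measurable borel"
      by (rule measurable_compose[of _ borel borel]) measurable
    then have "(\<lambda>s. (indicator {0..t} s *\<^sub>R h s) * (indicator {0..t} (t - s) *\<^sub>R k (t - s)))
        \<in> borel_measurable borel"
      by measurable
    moreover have "(\<lambda>s. indicator {0..t} s *\<^sub>R (h s * k (t - s))) =
        (\<lambda>s. (indicator {0..t} s *\<^sub>R h s) * (indicator {0..t} (t - s) *\<^sub>R k (t - s)))"
      by (rule ext, rule conv_truncate) simp
    ultimately show ?thesis
      by (simp only: measurable_lborel2)
  qed
  have "AE s in lborel. indicator {0..t} s *\<^sub>R (f s * g (t - s)) =
      indicator {0..t} s *\<^sub>R (f' s * g' (t - s))"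
    using f(3) AE_lborel_reflect[OF g(3), of t]
    by (rule eventually_elim2) (auto simp: indicator_def)
  then show ?thesis
    unfolding set_lebesgue_integral_def using f g by (intro integral_cong_AE m) auto
qed

lift_definition conv_l1loc :: "l1loc \<Rightarrow> l1loc \<Rightarrow> l1loc" is
  "\<lambda>f g t. LINT s:{0..t}|lborel. f s * g (t - s)"
proof -
  fix f f' g g'
  assume "l1loc_eq f f'" "l1loc_eq g g'"
  then show "l1loc_eq (\<lambda>t. LINT s:{0..t}|lborel. f s * g (t - s))
      (\<lambda>t. LINT s:{0..t}|lborel. f' s * g' (t - s))"
    using conv_cong[of f f' g g'] locally_integrable_conv by (simp add: l1loc_eq_def)
qed


section \<open>Complex Radon measures on the half-line\<close>

lemma bounded_borel_subset: "A \<in> bounded_borel \<Longrightarrow> B \<subseteq> A \<Longrightarrow> B \<in> sets borel \<Longrightarrow> B \<in> bounded_borel"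
  unfolding bounded_borel_def by (auto intro: bounded_subset)

lemma set_integral_sums:
  fixes h :: "real \<Rightarrow> complex"
  assumes "range F \<subseteq> sets M" "disjoint_family F" and h: "set_integrable M (\<Union>(range F)) h"
  shows "(\<lambda>i::nat. LINT t:F i|M. h t) sums (LINT t:\<Union>(range F)|M. h t)"
proof -
  have F: "F i \<in> sets M" for i
    using assms(1) by auto
  have hi: "set_integrable M (F i) h" for i
    using h by (rule set_integrable_subset) (use F in auto)
  have ev: "indicator (\<Union>i<n. F i) t = (\<Sum>i<n. indicator (F i) t :: real)" for n t
    using assms(2) by (subst indicator_UN_disjoint) (auto simp: disjoint_family_on_def)
  have "(\<lambda>n. LINT t|M. indicator (\<Union>i<n. F i) t *\<^sub>R h t)
      \<longlonglongrightarrow> (LINT t|M. indicator (\<Union>(range F)) t *\<^sub>R h t)"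
  proof (rule integral_dominated_convergence)
    show hm: "(\<lambda>t. indicator (\<Union>(range F)) t *\<^sub>R h t) \<in> borel_measurable M"
      and "integrable M (\<lambda>t. norm (indicator (\<Union>(range F)) t *\<^sub>R h t))"
      using h unfolding set_integrable_def by (rule borel_measurable_integrable, rule integrable_norm)
    show "(\<lambda>t. indicator (\<Union>i<n. F i) t *\<^sub>R h t) \<in> borel_measurable M" for n
    proof -
      have "set_integrable M (\<Union>i<n. F i) h"
        using h by (rule set_integrable_subset) (use F in auto)
      then show ?thesis
        by (auto simp: set_integrable_def)
    qed
    show "AE t in M. (\<lambda>n. indicator (\<Union>i<n. F i) t *\<^sub>R h t)
        \<longlonglongrightarrow> indicator (\<Union>(range F)) t *\<^sub>R h t"
      by (intro AE_I2 tendsto_scaleR LIMSEQ_indicator_UN tendsto_const)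
    show "AE t in M. norm (indicator (\<Union>i<n. F i) t *\<^sub>R h t)
        \<le> norm (indicator (\<Union>(range F)) t *\<^sub>R h t)" for n
      by (auto simp: indicator_def)
  qed
  moreover have "(LINT t|M. indicator (\<Union>i<n. F i) t *\<^sub>R h t) = (\<Sum>i<n. LINT t:F i|M. h t)" for n
    unfolding ev scaleR_sum_left set_lebesgue_integral_def
    using hi by (intro Bochner_Integration.integral_sum) (simp add: set_integrable_def)
  ultimately show ?thesis
    by (simp add: sums_def set_lebesgue_integral_def)
qed

text \<open>
  In general a locally finite complex Borel measure has values only on the bounded Borel sets, so it
  is a countably additive set function on these; it is extended by zero to all other sets.
\<close>

definition locally_additive :: "(real set \<Rightarrow> 'a::{comm_monoid_add,t2_space}) \<Rightarrow> bool" where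
  "locally_additive \<nu> \<longleftrightarrow>
     (\<forall>F. range F \<subseteq> bounded_borel \<longrightarrow> disjoint_family F \<longrightarrow> \<Union>(range F) \<in> bounded_borel \<longrightarrow>
        (\<lambda>i::nat. \<nu> (F i)) sums \<nu> (\<Union>(range F)))"

typedef mloc = "{\<nu> :: real set \<Rightarrow> complex. locally_additive \<nu> \<and> (\<forall>A. A \<notin> bounded_borel \<longrightarrow> \<nu> A = 0)}"
  morphisms mloc_fun Abs_mloc
  by (rule exI[of _ "\<lambda>_. 0"]) (simp add: locally_additive_def)

setup_lifting type_definition_mloc

instantiation mloc :: ab_group_add
begin

lift_definition zero_mloc :: mloc is "\<lambda>_. 0"
  by (simp add: locally_additive_def)

lift_definition plus_mloc :: "mloc \<Rightarrow> mloc \<Rightarrow> mloc" is "\<lambda>\<mu> \<nu> A. \<mu> A + \<nu> A"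
  by (auto simp: locally_additive_def intro!: sums_add)

lift_definition uminus_mloc :: "mloc \<Rightarrow> mloc" is "\<lambda>\<nu> A. - \<nu> A"
  by (auto simp: locally_additive_def intro!: sums_minus)

lift_definition minus_mloc :: "mloc \<Rightarrow> mloc \<Rightarrow> mloc" is "\<lambda>\<mu> \<nu> A. \<mu> A - \<nu> A"
  by (auto simp: locally_additive_def intro!: sums_diff)

instance
  by standard (transfer; auto simp: algebra_simps)+

end

lift_definition scale_mloc :: "complex \<Rightarrow> mloc \<Rightarrow> mloc" is "\<lambda>c \<nu> A. c * \<nu> A"
  by (auto simp: locally_additive_def intro!: sums_mult)

lemma vector_space_mloc: "vector_space scale_mloc"
  by (standard; transfer) (auto simp: algebra_simps)

text \<open>The total variation is only meaningful on bounded Borel sets.\<close>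

definition total_variation :: "mloc \<Rightarrow> real set \<Rightarrow> real" where
  "total_variation \<nu> A =
     (SUP P \<in> {P. finite P \<and> P \<subseteq> bounded_borel \<and> partition_on A P}. \<Sum>B\<in>P. cmod (mloc_fun \<nu> B))"

definition seminorm_mloc :: "nat \<Rightarrow> mloc \<Rightarrow> real" where
  "seminorm_mloc n \<nu> = total_variation \<nu> {0..<real n}"

text \<open>
  The positive part of the Jordan decomposition of a real set function, as a measure on the whole
  line (carried by the half-line); note that \<^term>\<open>ennreal\<close> maps negative numbers to 0.
  The negative part of \<open>\<phi>\<close> is the positive part of \<open>- \<phi>\<close>.
\<close>

definition pos_part :: "(real set \<Rightarrow> real) \<Rightarrow> real measure" where
  "pos_part \<phi> =
     measure_of UNIV (sets borel) (\<lambda>A. SUP B \<in> {B \<in> bounded_borel. B \<subseteq> A}. ennreal (\<phi> B))"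

lemma locally_additive_empty:
  fixes \<phi> :: "real set \<Rightarrow> real"
  assumes "locally_additive \<phi>"
  shows "\<phi> {} = 0"
proof -
  have "(\<lambda>i::nat. \<phi> {}) sums \<phi> {}"
    using assms[unfolded locally_additive_def, rule_format, of "\<lambda>_. {}"]
    by (simp add: bounded_borel_def disjoint_family_on_def)
  then show ?thesis
    using summable_const_iff sums_summable by blast
qed

lemma locally_additive_Un:
  fixes \<phi> :: "real set \<Rightarrow> real"
  assumes \<phi>: "locally_additive \<phi>" and AB: "A \<in> bounded_borel" "B \<in> bounded_borel" "A \<inter> B = {}"
  shows "\<phi> (A \<union> B) = \<phi> A + \<phi> B"
proof -
  have "range (binaryset A B) \<subseteq> bounded_borel" "A \<union> B \<in> bounded_borel"
    using AB by (auto simp: range_binaryset_eq bounded_borel_def)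
  moreover have "disjoint_family (binaryset A B)"
    using AB(3) by (auto simp: disjoint_family_on_def binaryset_def)
  ultimately have "(\<lambda>i. \<phi> (binaryset A B i)) sums \<phi> (A \<union> B)"
    using \<phi>[unfolded locally_additive_def, rule_format, of "binaryset A B"]
    by (simp add: UN_binaryset_eq)
  moreover have "(\<lambda>i. \<phi> (binaryset A B i)) sums (\<phi> A + \<phi> B)"
    using locally_additive_empty[OF \<phi>] by (rule binaryset_sums)
  ultimately show ?thesis
    by (rule sums_unique2)
qed

lemma locally_additive_bounded:
  fixes \<phi> :: "real set \<Rightarrow> real"
  assumes \<phi>: "locally_additive \<phi>" and A: "A \<in> bounded_borel"
  shows "\<exists>C. \<forall>B \<in> bounded_borel. B \<subseteq> A \<longrightarrow> \<bar>\<phi> B\<bar> \<le> C"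
proof (rule ccontr)
  assume not_bounded: "\<not> ?thesis"
  define bad where "bad = (\<lambda>A. A \<in> bounded_borel \<and>
    (\<forall>C. \<exists>B \<in> bounded_borel. B \<subseteq> A \<and> C < \<bar>\<phi> B\<bar>))"
  have bad_A: "bad A"
    using not_bounded A unfolding bad_def by (auto simp: not_le)
  have diff: "E - B \<in> bounded_borel" "E \<inter> B \<in> bounded_borel"
    if "E \<in> bounded_borel" "B \<in> bounded_borel" for E B
    using that by (auto simp: bounded_borel_def intro: bounded_subset)
  have split: "\<phi> E = \<phi> (E \<inter> B) + \<phi> (E - B)" if "E \<in> bounded_borel" "B \<in> bounded_borel" for E B
    using locally_additive_Un[OF \<phi> diff(2)[OF that] diff(1)[OF that]] by (simp add: Int_Diff_Un Int_Diff_disjoint)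
  have step: "\<exists>A'. bad A' \<and> A' \<subseteq> A \<and> 1 \<le> \<bar>\<phi> (A - A')\<bar>" if "bad A" for A
  proof -
    have A: "A \<in> bounded_borel"
      using that by (simp add: bad_def)
    obtain B where B: "B \<in> bounded_borel" "B \<subseteq> A" "\<bar>\<phi> A\<bar> + 1 < \<bar>\<phi> B\<bar>"
      using \<open>bad A\<close> by (auto simp: bad_def)
    have AB: "A - B \<in> bounded_borel"
      using diff(1)[OF A B(1)] .
    have "\<phi> A = \<phi> B + \<phi> (A - B)"
      using split[OF A B(1)] B(2) by (simp add: Int_absorb1)
    then have big: "1 \<le> \<bar>\<phi> (A - B)\<bar>" "1 \<le> \<bar>\<phi> B\<bar>"
      using B(3) by linarith+
    have "bad B \<or> bad (A - B)"
    proof (rule ccontr)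
      assume "\<not> ?thesis"
      then obtain C D where CD: "\<And>E. E \<in> bounded_borel \<Longrightarrow> E \<subseteq> B \<Longrightarrow> \<bar>\<phi> E\<bar> \<le> C"
        "\<And>E. E \<in> bounded_borel \<Longrightarrow> E \<subseteq> A - B \<Longrightarrow> \<bar>\<phi> E\<bar> \<le> D"
        using B(1) AB unfolding bad_def by (meson not_less)
      obtain E where E: "E \<in> bounded_borel" "E \<subseteq> A" "C + D < \<bar>\<phi> E\<bar>"
        using \<open>bad A\<close> by (auto simp: bad_def)
      have "\<bar>\<phi> (E \<inter> B)\<bar> \<le> C" "\<bar>\<phi> (E - B)\<bar> \<le> D"
        using E(2) diff[OF E(1) B(1)] by (auto intro!: CD)
      then show False
        using split[OF E(1) B(1)] E(3) by linarith
    qed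
    moreover have "A - (A - B) = B"
      using B(2) by auto
    ultimately show ?thesis
      using big B(2) by (metis Diff_subset)
  qed
  obtain S where S: "\<And>n. bad (S n)" "\<And>n. S (Suc n) \<subseteq> S n" "\<And>n::nat. 1 \<le> \<bar>\<phi> (S n - S (Suc n))\<bar>"
    using dependent_nat_choice[of "\<lambda>_. bad" "\<lambda>_ A A'. A' \<subseteq> A \<and> 1 \<le> \<bar>\<phi> (A - A')\<bar>"] bad_A step
    by metis
  define F where "F = (\<lambda>n. S n - S (Suc n))"
  have anti: "S n \<subseteq> S m" if "m \<le> n" for m n
    using S(2) that by (rule lift_Suc_antimono_le)
  have Sb: "S n \<in> bounded_borel" for n
    using S(1) by (simp add: bad_def)
  have F: "range F \<subseteq> bounded_borel"
    using diff(1)[OF Sb Sb] by (auto simp: F_def)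
  have "disjoint_family F"
    unfolding disjoint_family_on_def
  proof (intro ballI impI)
    fix m n :: nat
    assume "m \<noteq> n"
    then show "F m \<inter> F n = {}"
      using anti[of "Suc m" n] anti[of "Suc n" m] unfolding F_def by (cases m n rule: linorder_cases) auto
  qed
  moreover have "\<Union>(range F) \<in> bounded_borel"
  proof (rule bounded_borel_subset[OF Sb[of 0]])
    show "\<Union>(range F) \<subseteq> S 0"
      using anti[of 0] by (auto simp: F_def)
    show "\<Union>(range F) \<in> sets borel"
      using F by (auto simp: bounded_borel_def)
  qed
  ultimately have "(\<lambda>n. \<phi> (F n)) sums \<phi> (\<Union>(range F))"
    using \<phi> F by (simp add: locally_additive_def)
  then have "(\<lambda>n. \<phi> (F n)) \<longlonglongrightarrow> 0"
    by (auto dest: sums_summable summable_LIMSEQ_zero)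
  then have "\<forall>\<^sub>F n in sequentially. \<bar>\<phi> (F n)\<bar> < 1"
    by (auto simp: tendsto_iff dest: spec[of _ 1])
  then obtain n where "\<bar>\<phi> (F n)\<bar> < 1"
    by (auto simp: eventually_sequentially)
  then show False
    using S(3)[of n] by (simp add: F_def)
qed

lemma sets_pos_part [simp, measurable_cong]: "sets (pos_part \<phi>) = sets borel"
  unfolding pos_part_def by (metis sets.sets_measure_of_eq space_borel)

lemma space_pos_part [simp]: "space (pos_part \<phi>) = UNIV"
  by (simp add: pos_part_def)

lemma emeasure_pos_part:
  fixes \<phi> :: "real set \<Rightarrow> real"
  assumes \<phi>: "locally_additive \<phi>" and A: "A \<in> sets borel"
  shows "emeasure (pos_part \<phi>) A = (SUP B \<in> {B \<in> bounded_borel. B \<subseteq> A}. ennreal (\<phi> B))"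
proof -
  define P where "P A = (SUP B \<in> {B \<in> bounded_borel. B \<subseteq> A}. ennreal (\<phi> B))" for A
  have \<phi>0: "\<phi> {} = 0"
    using \<phi> by (rule locally_additive_empty)
  have empty: "{} \<in> bounded_borel"
    by (simp add: bounded_borel_def)
  have upper: "ennreal (\<phi> B) \<le> P A" if "B \<in> bounded_borel" "B \<subseteq> A" for A B
    unfolding P_def using that by (intro SUP_upper) auto
  have P0: "P {} = 0"
    using empty by (auto simp: P_def \<phi>0 bot_ennreal intro!: antisym SUP_least)
  have mono: "P A \<le> P B" if "A \<subseteq> B" for A B
    using that by (auto simp: P_def intro!: SUP_least upper[unfolded P_def])
  have super: "P A + P B \<le> P (A \<union> B)" if disj: "A \<inter> B = {}" for A B
  proof -
    have le: "ennreal (\<phi> C) + ennreal (\<phi> D) \<le> P (A \<union> B)"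
      if C: "C \<in> bounded_borel" "C \<subseteq> A" and D: "D \<in> bounded_borel" "D \<subseteq> B" for C D
    proof -
      consider "\<phi> C \<le> 0" | "\<phi> D \<le> 0" | "0 \<le> \<phi> C" "0 \<le> \<phi> D"
        by linarith
      then show ?thesis
      proof cases
        case 1
        then show ?thesis
          using upper[of D "A \<union> B"] D by (auto simp: ennreal_neg)
      next
        case 2
        then show ?thesis
          using upper[of C "A \<union> B"] C by (auto simp: ennreal_neg)
      next
        case 3
        have "C \<union> D \<in> bounded_borel"
          using C D by (auto simp: bounded_borel_def)
        moreover have "\<phi> (C \<union> D) = \<phi> C + \<phi> D"
          using C D disj by (intro locally_additive_Un[OF \<phi>]) auto
        ultimately show ?thesis
          using upper[of "C \<union> D" "A \<union> B"] C D 3 by (auto simp: ennreal_plus)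
      qed
    qed
    have "P A + P B = (SUP C \<in> {C \<in> bounded_borel. C \<subseteq> A}. ennreal (\<phi> C) + P B)"
      unfolding P_def[of A] using empty by (intro ennreal_SUP_add_left[symmetric]) auto
    also have "\<dots> \<le> P (A \<union> B)"
    proof (rule SUP_least)
      fix C assume C: "C \<in> {C \<in> bounded_borel. C \<subseteq> A}"
      have "ennreal (\<phi> C) + P B = (SUP D \<in> {D \<in> bounded_borel. D \<subseteq> B}. ennreal (\<phi> C) + ennreal (\<phi> D))"
        unfolding P_def[of B] using empty by (intro ennreal_SUP_add_right) auto
      also have "\<dots> \<le> P (A \<union> B)"
        using C le by (intro SUP_least) auto
      finally show "ennreal (\<phi> C) + P B \<le> P (A \<union> B)" .
    qed
    finally show ?thesis .
  qed
  have "emeasure (pos_part \<phi>) A = P A"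
  proof (rule emeasure_measure_of)
    show "pos_part \<phi> = measure_of UNIV (sets borel) P"
      by (simp add: pos_part_def P_def[abs_def])
    show "positive (sets (pos_part \<phi>)) P"
      by (simp add: positive_def P0)
    show "countably_additive (sets (pos_part \<phi>)) P"
      unfolding countably_additive_def
    proof (intro allI impI)
      fix F :: "nat \<Rightarrow> real set"
      assume F: "range F \<subseteq> sets (pos_part \<phi>)" "disjoint_family F"
      have "(\<Sum>i<n. P (F i)) \<le> P (\<Union>i<n. F i)" for n
      proof (induction n)
        case 0
        show ?case
          by simp
      next
        case (Suc n)
        have "(\<Sum>i<Suc n. P (F i)) \<le> P (\<Union>i<n. F i) + P (F n)"
          using Suc by (simp add: add_mono)
        also have "\<dots> \<le> P ((\<Union>i<n. F i) \<union> F n)"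
        proof (rule super)
          have "F i \<inter> F n = {}" if "i < n" for i
            using F(2) that by (simp add: disjoint_family_on_def)
          then show "(\<Union>i<n. F i) \<inter> F n = {}"
            by blast
        qed
        finally show ?case
          by (simp add: lessThan_Suc Un_commute)
      qed
      also have "P (\<Union>i<n. F i) \<le> P (\<Union>(range F))" for n
        by (rule mono) auto
      finally have "(\<Sum>i. P (F i)) \<le> P (\<Union>(range F))"
        by (intro suminf_le_const) auto
      moreover have "P (\<Union>(range F)) \<le> (\<Sum>i. P (F i))"
        unfolding P_def[of "\<Union>(range F)"]
      proof (rule SUP_least)
        fix B assume B: "B \<in> {B \<in> bounded_borel. B \<subseteq> \<Union>(range F)}"
        have BF: "B \<inter> F i \<in> bounded_borel" for i
          by (rule bounded_borel_subset[of B]) (use B F(1) in \<open>auto simp: bounded_borel_def\<close>)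
        have U: "(\<Union>i. B \<inter> F i) = B"
          using B by auto
        have "range (\<lambda>i. B \<inter> F i) \<subseteq> bounded_borel" "\<Union>(range (\<lambda>i. B \<inter> F i)) \<in> bounded_borel"
          using BF B unfolding U by auto
        moreover have "disjoint_family (\<lambda>i. B \<inter> F i)"
          using F(2) by (auto simp: disjoint_family_on_def)
        ultimately have "(\<lambda>i. \<phi> (B \<inter> F i)) sums \<phi> (\<Union>(range (\<lambda>i. B \<inter> F i)))"
          using \<phi>[unfolded locally_additive_def, rule_format, of "\<lambda>i. B \<inter> F i"] by blast
        then have "(\<lambda>i. \<phi> (B \<inter> F i)) sums \<phi> B"
          unfolding U .
        then have "(\<lambda>n. ennreal (\<Sum>i<n. \<phi> (B \<inter> F i))) \<longlonglongrightarrow> ennreal (\<phi> B)"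
          by (auto simp: sums_def intro: tendsto_ennrealI)
        moreover have "ennreal (\<Sum>i<n. \<phi> (B \<inter> F i)) \<le> (\<Sum>i. P (F i))" for n
        proof -
          have "ennreal (\<Sum>i<n. \<phi> (B \<inter> F i)) \<le> ennreal (\<Sum>i<n. max 0 (\<phi> (B \<inter> F i)))"
            by (intro ennreal_leI sum_mono) auto
          also have "\<dots> = (\<Sum>i<n. ennreal (max 0 (\<phi> (B \<inter> F i))))"
            by (intro sum_ennreal[symmetric]) auto
          also have "\<dots> \<le> (\<Sum>i<n. P (F i))"
            using BF by (intro sum_mono) (auto simp: ennreal_max_0 intro!: upper)
          also have "\<dots> \<le> (\<Sum>i. P (F i))"
            by (intro sum_le_suminf) auto
          finally show ?thesis .
        qed
        ultimately show "ennreal (\<phi> B) \<le> (\<Sum>i. P (F i))"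
          by (intro LIMSEQ_le_const2) auto
      qed
      ultimately show "(\<Sum>i. P (F i)) = P (\<Union>(range F))"
        by (rule antisym)
    qed
  qed (use A in auto)
  then show ?thesis
    by (simp add: P_def)
qed

lemma emeasure_pos_part_finite:
  fixes \<phi> :: "real set \<Rightarrow> real"
  assumes "locally_additive \<phi>" "A \<in> bounded_borel"
  shows "emeasure (pos_part \<phi>) A < \<infinity>"
proof -
  obtain C where C: "\<And>B. B \<in> bounded_borel \<Longrightarrow> B \<subseteq> A \<Longrightarrow> \<bar>\<phi> B\<bar> \<le> C"
    using locally_additive_bounded[OF assms] by auto
  have "emeasure (pos_part \<phi>) A = (SUP B \<in> {B \<in> bounded_borel. B \<subseteq> A}. ennreal (\<phi> B))"
    using assms by (intro emeasure_pos_part) (auto simp: bounded_borel_def)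
  also have "\<dots> \<le> ennreal C"
    using C by (intro SUP_least ennreal_leI) (auto simp: abs_le_iff)
  also have "\<dots> < \<infinity>"
    by simp
  finally show ?thesis .
qed

definition radon_integral :: "(real set \<Rightarrow> complex) \<Rightarrow> (real \<Rightarrow> complex) \<Rightarrow> complex" where
  "radon_integral \<nu> h =
     (LINT t:{0..}|pos_part (\<lambda>A. Re (\<nu> A)). h t) - (LINT t:{0..}|pos_part (\<lambda>A. - Re (\<nu> A)). h t)
     + \<i> * ((LINT t:{0..}|pos_part (\<lambda>A. Im (\<nu> A)). h t) - (LINT t:{0..}|pos_part (\<lambda>A. - Im (\<nu> A)). h t))"

lemma pos_part_X_sums:
  fixes \<phi> :: "real set \<Rightarrow> real"
  assumes \<phi>: "locally_additive \<phi>"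
    and F: "range F \<subseteq> bounded_borel" "disjoint_family F" "\<Union>(range F) \<in> bounded_borel"
  shows "(\<lambda>i::nat. LINT t:{0..}|pos_part \<phi>. indicator (F i) t * complex_of_real t) sums
    (LINT t:{0..}|pos_part \<phi>. indicator (\<Union>(range F)) t * complex_of_real t)"
proof -
  have eq: "(LINT t:{0..}|pos_part \<phi>. indicator A t * complex_of_real t) = (LINT t:A|pos_part \<phi>. of_real t)"
    if "A \<in> bounded_borel" for A
    using that unfolding set_lebesgue_integral_def
    by (intro Bochner_Integration.integral_cong) (auto simp: bounded_borel_def indicator_def)
  let ?U = "\<Union>(range F)"
  have U: "?U \<in> sets borel"
    using F(3) by (simp add: bounded_borel_def)
  obtain T where T: "?U \<subseteq> {0..T}"
    using F(3) by (rule bounded_borel_bound)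
  have "integrable (pos_part \<phi>) (\<lambda>t. indicator ?U t *\<^sub>R complex_of_real t)"
  proof (rule Bochner_Integration.integrable_bound)
    show "integrable (pos_part \<phi>) (\<lambda>t. indicator ?U t *\<^sub>R T)"
      using emeasure_pos_part_finite[OF \<phi> F(3)] U by (intro integrable_scaleR_left integrable_real_indicator) auto
    show "(\<lambda>t. indicator ?U t *\<^sub>R complex_of_real t) \<in> borel_measurable (pos_part \<phi>)"
      using U by measurable
    show "AE t in pos_part \<phi>. norm (indicator ?U t *\<^sub>R complex_of_real t) \<le> norm (indicator ?U t *\<^sub>R T)"
      using T by (force simp: indicator_def subset_iff)
  qed
  then have "(\<lambda>i. LINT t:F i|pos_part \<phi>. complex_of_real t) sums (LINT t:?U|pos_part \<phi>. of_real t)"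
    using F by (intro set_integral_sums) (auto simp: set_integrable_def bounded_borel_def)
  then show ?thesis
    using F(1,3) by (simp add: eq range_subsetD)
qed

lemma locally_additive_parts:
  fixes \<nu> :: "real set \<Rightarrow> complex"
  assumes "locally_additive \<nu>"
  shows "locally_additive (\<lambda>A. Re (\<nu> A))" "locally_additive (\<lambda>A. - Re (\<nu> A))"
    "locally_additive (\<lambda>A. Im (\<nu> A))" "locally_additive (\<lambda>A. - Im (\<nu> A))"
  using assms unfolding locally_additive_def by (auto intro!: sums_minus sums_Re sums_Im)

lift_definition X_mloc :: "mloc \<Rightarrow> mloc" is
  "\<lambda>\<nu> A. if A \<in> bounded_borel then radon_integral \<nu> (\<lambda>t. indicator A t * of_real t) else 0"
proof -
  fix \<nu> :: "real set \<Rightarrow> complex"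
  let ?X = "\<lambda>A. if A \<in> bounded_borel then radon_integral \<nu> (\<lambda>t. indicator A t * of_real t) else 0"
  assume "locally_additive \<nu> \<and> (\<forall>A. A \<notin> bounded_borel \<longrightarrow> \<nu> A = 0)"
  then have \<nu>: "locally_additive \<nu>" ..
  have "locally_additive ?X"
    unfolding locally_additive_def
  proof (intro allI impI)
    fix F :: "nat \<Rightarrow> real set"
    assume F: "range F \<subseteq> bounded_borel" "disjoint_family F" "\<Union>(range F) \<in> bounded_borel"
    have "(\<lambda>i. radon_integral \<nu> (\<lambda>t. indicator (F i) t * of_real t)) sums
        radon_integral \<nu> (\<lambda>t. indicator (\<Union>(range F)) t * of_real t)"
      unfolding radon_integral_def
      by (intro sums_add sums_diff sums_mult pos_part_X_sums F locally_additive_parts \<nu>)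
    moreover have "F i \<in> bounded_borel" for i
      using F(1) by auto
    ultimately show "(\<lambda>i. ?X (F i)) sums ?X (\<Union>(range F))"
      using F(3) by simp
  qed
  then show "locally_additive ?X \<and> (\<forall>A. A \<notin> bounded_borel \<longrightarrow> ?X A = 0)"
    by simp
qed

text \<open>
  Continuous functions with compact support on the half-line, and the product of measures they
  determine by duality; a Radon measure is determined by its integrals of test functions.
\<close>

definition test_function :: "(real \<Rightarrow> complex) \<Rightarrow> bool" where
  "test_function h \<longleftrightarrow> continuous_on {0..} h \<and> (\<exists>K. \<forall>t>K. h t = 0)"

definition conv_mloc :: "mloc \<Rightarrow> mloc \<Rightarrow> mloc" where
  "conv_mloc \<nu> \<mu> = (THE \<kappa>. \<forall>h. test_function h \<longrightarrow>
     radon_integral (mloc_fun \<kappa>) h =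
     radon_integral (mloc_fun \<nu>) (\<lambda>t. radon_integral (mloc_fun \<mu>) (\<lambda>s. h (t + s))))"

lemma locally_additive_embed:
  assumes f: "locally_integrable f"
  shows "locally_additive (\<lambda>A. if A \<in> bounded_borel then LINT t:A|lborel. f t else 0)"
  unfolding locally_additive_def
proof (intro allI impI)
  fix F :: "nat \<Rightarrow> real set"
  assume F: "range F \<subseteq> bounded_borel" "disjoint_family F" "\<Union>(range F) \<in> bounded_borel"
  have "(\<lambda>i. LINT t:F i|lborel. f t) sums (LINT t:\<Union>(range F)|lborel. f t)"
    using F f by (intro set_integral_sums set_integrable_bounded_borel) (auto simp: bounded_borel_def)
  moreover have "F i \<in> bounded_borel" for i
    using F(1) by auto
  ultimately show "(\<lambda>i. if F i \<in> bounded_borel then LINT t:F i|lborel. f t else 0) sums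
      (if \<Union>(range F) \<in> bounded_borel then LINT t:\<Union>(range F)|lborel. f t else 0)"
    using F(3) by simp
qed

lift_definition embed :: "l1loc \<Rightarrow> mloc" is
  "\<lambda>f A. if A \<in> bounded_borel then LINT t:A|lborel. f t else 0"
  using l1loc_eq_set_integral[of _ _ _ "\<lambda>z. z"]
  by (auto simp: l1loc_eq_def fun_eq_iff intro: locally_additive_embed)

definition absolutely_continuous_mloc :: "mloc \<Rightarrow> bool" where
  "absolutely_continuous_mloc \<mu> \<longleftrightarrow>
     (\<forall>A \<in> bounded_borel. A \<in> null_sets lborel \<longrightarrow> mloc_fun \<mu> A = 0)"


section \<open>The derivations\<close>

text \<open>
  The convolution of a locally integrable function with a Radon measure is taken in the algebra of
  measures; it again has a density, \<open>embed\<close> being injective with range an ideal.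
\<close>

definition D_l1loc :: "mloc \<Rightarrow> l1loc \<Rightarrow> l1loc" where
  "D_l1loc \<mu> f = (THE g. embed g = conv_mloc (embed (X_l1loc f)) \<mu>)"

definition D_mloc :: "mloc \<Rightarrow> mloc \<Rightarrow> mloc" where
  "D_mloc \<mu> \<nu> = conv_mloc (X_mloc \<nu>) \<mu>"

end

theory Submission
  imports Defs
begin

text \<open>
  Everything is reduced to the pairing of a measure with bounded Borel functions of bounded support.
  Through it the locally integrable functions become the closed ideal of absolutely continuous
  measures (Radon--Nikodym), up to equivalent seminorms, and the derivation on functions is the restriction of
  the one on measures.

  If \<open>\<mu> = g dt\<close>, then \<open>\<nu> * \<mu>\<close> is uniformly close on \<open>[0,n)\<close> to
  \<open>\<Sum>\<^sub>j \<nu>(I\<^sub>j) g(\<cdot> - s\<^sub>j)\<close> for a fine partition of \<open>[0,n)\<close> into sets \<open>I\<^sub>j\<close> close to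
  points \<open>s\<^sub>j\<close>, because translation is continuous in \<open>L\<^sup>1\<close>; so bounded sets have totally bounded
  images, and completeness makes these relatively compact.

  Conversely, let \<open>f\<^sub>n\<close> be the normalised indicator of \<open>[1, 1 + 1/n)\<close>. The images \<open>X f\<^sub>n * \<mu>\<close> are
  absolutely continuous and converge, tested against continuous functions, to the translate of \<open>\<mu>\<close>
  by \<open>1\<close>. A weak cluster point of them is absolutely continuous, being annihilated by the functionals
  \<open>\<nu> \<mapsto> \<nu>(A)\<close> for null sets \<open>A\<close>, and equals that translate.
\<close>

section \<open>Metrizability and weak topologies\<close>

text \<open>Two kinds of test object are in tension. \<open>conv_mloc\<close> is pinned down by
  continuous test functions, whereas null sets are seen only by indicators of Borel sets; hence the
  extension of every identity to bounded Borel integrands of bounded support. Measures with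
  densities can converge against test functions to a point mass, so the convergence of the images to
  the translate of \<mu> proves nothing by itself. What the weak topology adds is the continuity of
  \<nu> \<mapsto> \<nu>(A), which carries the vanishing on null sets over to the cluster point.

  The test sequence concentrates near 1 because X multiplies by the coordinate: the factor is 1
  there, while at 0 it would destroy the spikes.

  The recurring factor 4 counts the positive and negative parts of the real and imaginary parts of a
  measure. Pairings are compared with the total variation up to this factor, which is harmless for
  topologies, boundedness and total boundedness.\<close>

lemma topspace_seminorm_topology:
  fixes p :: "nat \<Rightarrow> 'v::ab_group_add \<Rightarrow> real"
  assumes "\<And>n. p n 0 = 0"
  shows "topspace (seminorm_topology p) = UNIV"
proof -
  have "x \<in> \<Union>{{y. p n (y - x) < e} |n x e. 0 < e}" for x
  proof (rule UnionI)
    show "{y. p 0 (y - x) < 1} \<in> {{y. p n (y - x) < e} |n x e. 0 < e}"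
      using zero_less_one[where 'a = real] by blast
    show "x \<in> {y. p 0 (y - x) < 1}"
      using assms by simp
  qed
  then show ?thesis
    unfolding seminorm_topology_def topology_generated_by_topspace by blast
qed

text \<open>Increasing seminorms let a single index describe a neighbourhood, and separation turns
  the family into a metric. Both \<open>seminorm_mloc\<close> and \<open>seminorm_l1loc\<close> are
  instances, so compactness is treated once.\<close>

locale seminorm_system =
  fixes p :: "nat \<Rightarrow> 'v::ab_group_add \<Rightarrow> real"
  assumes nonneg: "0 \<le> p n x"
    and zero: "p n 0 = 0"
    and minus: "p n (- x) = p n x"
    and triangle: "p n (x + y) \<le> p n x + p n y"
    and mono: "m \<le> n \<Longrightarrow> p m x \<le> p n x"
    and separating: "(\<And>n. p n x = 0) \<Longrightarrow> x = 0"
begin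

lemma minus_commute: "p n (x - y) = p n (y - x)"
  using minus[of n "y - x"] by simp

lemma triangle3: "p n (x - z) \<le> p n (x - y) + p n (y - z)"
  using triangle[of n "x - y" "y - z"] by simp

text \<open>The cap 1/(n+1) replaces the usual weighted series: a ball of radius e constrains only
  the finitely many indices with 1/(n+1) \<ge> e, and the triangle inequality can be checked index
  by index.\<close>

definition sdist :: "'v \<Rightarrow> 'v \<Rightarrow> real" where
  "sdist x y = (SUP n. min (1 / real (Suc n)) (p n (x - y)))"

lemma bdd_sdist: "bdd_above (range (\<lambda>n. min (1 / real (Suc n)) (p n x)))"
proof (rule bdd_aboveI2)
  show "min (1 / real (Suc n)) (p n x) \<le> 1" for n
    by (rule min.coboundedI1) (simp add: field_simps)
qed

lemma sdist_upper: "min (1 / real (Suc n)) (p n (x - y)) \<le> sdist x y"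
  unfolding sdist_def by (rule cSUP_upper[OF UNIV_I bdd_sdist])

lemma sdist_least: "(\<And>n. min (1 / real (Suc n)) (p n (x - y)) \<le> c) \<Longrightarrow> sdist x y \<le> c"
  unfolding sdist_def by (rule cSUP_least) auto

lemma sdist_lessD:
  assumes "sdist x y < e" "e \<le> 1 / real (Suc n)"
  shows "p n (x - y) < e"
  using sdist_upper[of n x y] assms by linarith

text \<open>One seminorm controls the distance: the terms from index \<open>n\<close> on are capped
  by 1/(n+1), and the earlier ones are dominated by \<open>p n\<close>.\<close>

lemma sdist_leI:
  assumes "1 / real (Suc n) \<le> e" "p n (x - y) \<le> e"
  shows "sdist x y \<le> e"
proof (rule sdist_least)
  fix m
  show "min (1 / real (Suc m)) (p m (x - y)) \<le> e"
  proof (cases "n \<le> m")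
    case True
    then have "1 / real (Suc m) \<le> 1 / real (Suc n)"
      by (simp add: field_simps)
    then show ?thesis
      using assms(1) by linarith
  next
    case False
    then show ?thesis
      using mono[of m n "x - y"] assms(2) by linarith
  qed
qed

sublocale metric: Metric_space UNIV sdist
proof
  show nn: "0 \<le> sdist x y" for x y
    using sdist_upper[of 0 x y] nonneg[of 0 "x - y"] by (smt (verit) divide_nonneg_nonneg of_nat_0_le_iff)
  show "sdist x y = sdist y x" for x y
    by (simp add: sdist_def minus_commute)
  show "sdist x y = 0 \<longleftrightarrow> x = y" for x y
  proof
    assume d: "sdist x y = 0"
    have "p n (x - y) = 0" for n
    proof -
      have "min (1 / real (Suc n)) (p n (x - y)) \<le> 0"
        using sdist_upper[of n x y] d by simp
      moreover have "0 < 1 / real (Suc n)"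
        by simp
      ultimately show ?thesis
        using nonneg[of n "x - y"] by linarith
    qed
    then show "x = y"
      using separating by force
  next
    assume "x = y"
    then have "sdist x y \<le> 0"
      by (intro sdist_least) (simp add: zero)
    then show "sdist x y = 0"
      using nn[of x y] by simp
  qed
  show "sdist x z \<le> sdist x y + sdist y z" for x y z
  proof (rule sdist_least)
    fix n
    show "min (1 / real (Suc n)) (p n (x - z)) \<le> sdist x y + sdist y z"
      using sdist_upper[of n x y] sdist_upper[of n y z] triangle3[of n x z y]
        nonneg[of n "x - y"] nonneg[of n "y - z"] nn[of x y] nn[of y z]
      by linarith
  qed
qed

lemma mtopology_eq: "metric.mtopology = seminorm_topology p"
proof (rule topology_eq[THEN iffD2], intro allI iffI)
  fix U
  assume U: "openin metric.mtopology U"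
  show "openin (seminorm_topology p) U"
  proof (subst openin_subopen, intro ballI)
    fix x
    assume "x \<in> U"
    then obtain r where r: "0 < r" "metric.mball x r \<subseteq> U"
      using U unfolding metric.openin_mtopology by blast
    obtain n where n: "1 / real (Suc n) < r / 2"
      using r(1) reals_Archimedean[of "r / 2"] by (auto simp: inverse_eq_divide)
    \<comment> \<open>By \<open>sdist_leI\<close> a single subbasic set already fits into the
      ball.\<close>
    define V where "V = {y. p n (y - x) < r / 2}"
    have "openin (seminorm_topology p) V"
      unfolding seminorm_topology_def V_def
      by (rule topology_generated_by_Basis) (use half_gt_zero[OF r(1)] in blast)
    moreover have "x \<in> V"
      using r(1) by (simp add: V_def zero)
    moreover have "V \<subseteq> U"
    proof
      fix y
      assume "y \<in> V"
      then have "sdist x y \<le> r / 2"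
        using n by (intro sdist_leI[of n]) (auto simp: V_def minus_commute)
      then show "y \<in> U"
        using r by (auto simp: metric.mball_def)
    qed
    ultimately show "\<exists>T. openin (seminorm_topology p) T \<and> x \<in> T \<and> T \<subseteq> U"
      by blast
  qed
next
  fix U
  assume "openin (seminorm_topology p) U"
  then have "generate_topology_on {{y. p n (y - x) < e} |n x e. 0 < e} U"
    unfolding seminorm_topology_def openin_topology_generated_by_iff .
  then show "openin metric.mtopology U"
  proof (rule generate_topology_on_coarsest[rotated 2])
    show "istopology (openin metric.mtopology)"
      by simp
    fix V
    assume "V \<in> {{y. p n (y - x) < e} |n x e. 0 < e}"
    then obtain n x e where V: "V = {y. p n (y - x) < e}" "0 < e"
      by blast
    show "openin metric.mtopology V"
      unfolding metric.openin_mtopology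
    proof (intro conjI allI impI)
      fix z
      assume z: "z \<in> V"
      \<comment> \<open>Staying below the cap 1/(n+1) is what allows \<open>sdist_lessD\<close> to
        read off \<open>p n\<close>.\<close>
      define r where "r = min (1 / real (Suc n)) (e - p n (z - x))"
      have "0 < r"
        using z by (simp add: r_def V)
      moreover have "metric.mball z r \<subseteq> V"
      proof
        fix y
        assume "y \<in> metric.mball z r"
        then have "p n (z - y) < r"
          by (intro sdist_lessD) (auto simp: r_def)
        then show "y \<in> V"
          using triangle3[of n y x z] by (simp add: V r_def minus_commute[of n y z])
      qed
      ultimately show "\<exists>r>0. metric.mball z r \<subseteq> V"
        by blast
    qed simp
  qed
qed

text \<open>In a complete metric space total boundedness gives compact closure. Both hypotheses are
  put seminorm by seminorm, and the centres \<open>K\<close> may lie anywhere, which is the form in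
  which finite nets of measures arise later.\<close>

lemma relatively_compactin_seminorm_topology:
  assumes complete: "\<And>x. (\<And>n e. 0 < e \<Longrightarrow> \<exists>M. \<forall>k\<ge>M. \<forall>l\<ge>M. p n (x k - x l) < e) \<Longrightarrow>
      \<exists>y. \<forall>n. (\<lambda>k. p n (x k - y)) \<longlonglongrightarrow> 0"
    and totally_bounded: "\<And>n e. 0 < e \<Longrightarrow> \<exists>K. finite K \<and> (\<forall>x\<in>S. \<exists>k\<in>K. p n (x - k) < e)"
  shows "relatively_compactin (seminorm_topology p) S"
proof -
  have "metric.mcomplete"
    unfolding metric.mcomplete_def
  proof (intro allI impI)
    fix x :: "nat \<Rightarrow> 'v"
    assume C: "metric.MCauchy x"
    have "\<exists>M. \<forall>k\<ge>M. \<forall>l\<ge>M. p n (x k - x l) < e" if "0 < e" for n e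
    proof -
      have "0 < min e (1 / real (Suc n))"
        using that by simp
      then obtain M where M: "\<And>k l. M \<le> k \<Longrightarrow> M \<le> l \<Longrightarrow> sdist (x k) (x l) < min e (1 / real (Suc n))"
        using C unfolding metric.MCauchy_def by blast
      have "p n (x k - x l) < min e (1 / real (Suc n))" if "M \<le> k" "M \<le> l" for k l
        by (rule sdist_lessD[OF M[OF that]]) simp
      then show ?thesis
        by auto
    qed
    then obtain y where y: "\<And>n. (\<lambda>k. p n (x k - y)) \<longlonglongrightarrow> 0"
      using complete[of x] by blast
    have "limitin metric.mtopology x y sequentially"
      unfolding metric.limitin_metric
    proof (intro conjI allI impI)
      fix e :: real
      assume e: "0 < e"
      obtain n where n: "1 / real (Suc n) < e / 2"
        using e reals_Archimedean[of "e / 2"] by (auto simp: inverse_eq_divide)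
      have "\<forall>\<^sub>F k in sequentially. p n (x k - y) < e / 2"
        using y[of n] e by (intro order_tendstoD) auto
      then show "\<forall>\<^sub>F k in sequentially. x k \<in> UNIV \<and> sdist (x k) y < e"
      proof (rule eventually_mono)
        fix k
        assume "p n (x k - y) < e / 2"
        then have "sdist (x k) y \<le> e / 2"
          using n by (intro sdist_leI[of n]) auto
        then show "x k \<in> UNIV \<and> sdist (x k) y < e"
          using e by simp
      qed
    qed simp
    then show "\<exists>y. limitin metric.mtopology x y sequentially" ..
  qed
  moreover have "metric.mtotally_bounded S"
    unfolding metric.mtotally_bounded_def
  proof (intro allI impI)
    fix e :: real
    assume e: "0 < e"
    obtain n where n: "1 / real (Suc n) < e / 2"
      using e reals_Archimedean[of "e / 2"] by (auto simp: inverse_eq_divide)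
    obtain K where K: "finite K" "\<And>x. x \<in> S \<Longrightarrow> \<exists>k\<in>K. p n (x - k) < e / 4"
      using totally_bounded[of "e / 4" n] e by auto
    \<comment> \<open>\<open>mtotally_bounded\<close> asks for centres inside \<open>S\<close>: each
      useful centre \<open>k\<close> is replaced by a point \<open>c k\<close> of \<open>S\<close>
      near it, which doubles the radius e/4.\<close>
    define L where "L = {k \<in> K. \<exists>x\<in>S. p n (x - k) < e / 4}"
    have "\<forall>k\<in>L. \<exists>x. x \<in> S \<and> p n (x - k) < e / 4"
      by (auto simp: L_def)
    then obtain c where c: "\<And>k. k \<in> L \<Longrightarrow> c k \<in> S \<and> p n (c k - k) < e / 4"
      using bchoice[of L "\<lambda>k x. x \<in> S \<and> p n (x - k) < e / 4"] by blast
    show "\<exists>K. finite K \<and> K \<subseteq> S \<and> S \<subseteq> (\<Union>x\<in>K. metric.mball x e)"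
    proof (intro exI[of _ "c ` L"] conjI subsetI)
      show "finite (c ` L)"
        using K(1) by (simp add: L_def)
      show "x \<in> S" if "x \<in> c ` L" for x
        using that c by auto
      fix x
      assume x: "x \<in> S"
      then obtain k where k: "k \<in> K" "p n (x - k) < e / 4"
        using K(2) by blast
      then have kL: "k \<in> L"
        using x by (auto simp: L_def)
      have "p n (c k - x) \<le> e / 2"
        using triangle3[of n "c k" x k] c[OF kL] k(2) by (simp add: minus_commute[of n k x])
      then have "sdist (c k) x \<le> e / 2"
        using n by (intro sdist_leI[of n]) auto
      then have "x \<in> metric.mball (c k) e"
        using e by simp
      then show "x \<in> (\<Union>x\<in>c ` L. metric.mball x e)"
        using kL by blast
    qed
  qed
  ultimately show ?thesis
    using metric.mtotally_bounded_eq_compact_closure_of[of S]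
    by (simp add: relatively_compactin_def mtopology_eq)
qed

lemma continuous_functionalI:
  assumes lin: "Vector_Spaces.linear s (*) \<phi>" and bound: "\<And>x. cmod (\<phi> x) \<le> C * p n x"
  shows "continuous_functional s p \<phi>"
  unfolding continuous_functional_def
proof (rule conjI[OF lin])
  interpret Vector_Spaces.linear s "(*)" \<phi>
    by (rule lin)
  show "continuous_map (seminorm_topology p) euclidean \<phi>"
    unfolding continuous_map_def
  proof (intro conjI allI impI)
    fix U :: "complex set"
    assume "openin euclidean U"
    then have U: "open U"
      by simp
    have "openin metric.mtopology {x. \<phi> x \<in> U}"
      unfolding metric.openin_mtopology
    proof (intro conjI allI impI)
      fix x
      assume "x \<in> {x. \<phi> x \<in> U}"
      then obtain e where e: "0 < e" "ball (\<phi> x) e \<subseteq> U"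
        using U open_contains_ball by blast
      \<comment> \<open>A positive divisor, whatever the sign of \<open>C\<close>.\<close>
      define D where "D = \<bar>C\<bar> + 1"
      have D: "0 < D" "C \<le> D"
        by (auto simp: D_def)
      define r where "r = min (1 / real (Suc n)) (e / D)"
      have "0 < r"
        using e D by (simp add: r_def)
      moreover have "metric.mball x r \<subseteq> {x. \<phi> x \<in> U}"
      proof
        fix y
        assume "y \<in> metric.mball x r"
        then have "p n (x - y) < r"
          by (intro sdist_lessD) (auto simp: r_def)
        then have "p n (x - y) < e / D"
          by (simp add: r_def)
        have "cmod (\<phi> x - \<phi> y) \<le> C * p n (x - y)"
          using bound[of "x - y"] by (simp add: diff)
        also have "\<dots> \<le> D * p n (x - y)"
          using D nonneg by (intro mult_right_mono) auto
        also have "\<dots> < e"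
          using \<open>p n (x - y) < e / D\<close> D by (simp add: field_simps)
        finally show "y \<in> {x. \<phi> x \<in> U}"
          using e by (auto simp: dist_norm)
      qed
      ultimately show "\<exists>r>0. metric.mball x r \<subseteq> {x. \<phi> x \<in> U}"
        by blast
    qed simp
    then show "openin (seminorm_topology p) {x \<in> topspace (seminorm_topology p). \<phi> x \<in> U}"
      using metric.topspace_mtopology by (simp add: mtopology_eq)
  qed simp
qed

end

section \<open>Weak topologies and their cluster points\<close>

lemma openin_weak_topology_vimage:
  "continuous_functional s p \<phi> \<Longrightarrow> open U \<Longrightarrow> openin (weak_topology s p) (\<phi> -` U)"
  unfolding weak_topology_def by (rule topology_generated_by_Basis) auto

lemma openin_weak_topology_imp:
  assumes "openin (weak_topology s p) U" and p0: "\<And>n. p n 0 = 0"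
  shows "openin (seminorm_topology p) U"
proof -
  have "generate_topology_on {\<phi> -` U |\<phi> U. continuous_functional s p \<phi> \<and> open U} U"
    using assms(1) unfolding weak_topology_def openin_topology_generated_by_iff .
  then show ?thesis
  proof (rule generate_topology_on_coarsest[rotated 2])
    show "istopology (openin (seminorm_topology p))"
      by simp
    fix V
    assume "V \<in> {\<phi> -` U |\<phi> U. continuous_functional s p \<phi> \<and> open U}"
    then obtain \<phi> W where V: "V = \<phi> -` W" "continuous_functional s p \<phi>" "open W"
      by blast
    then have "openin (seminorm_topology p) {x \<in> topspace (seminorm_topology p). \<phi> x \<in> W}"
      unfolding continuous_functional_def by (intro openin_continuous_map_preimage) auto
    then show "openin (seminorm_topology p) V"
      using topspace_seminorm_topology[of p, OF p0] by (simp add: V vimage_def)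
  qed
qed

lemma linear_functionalI:
  assumes vs: "vector_space s" and "\<And>x y. \<phi> (x + y) = \<phi> x + \<phi> y" "\<And>c x. \<phi> (s c x) = c * \<phi> x"
  shows "Vector_Spaces.linear s (*) (\<phi> :: 'v::ab_group_add \<Rightarrow> complex)"
proof -
  interpret vector_space s by (rule vs)
  interpret c: vector_space "(*) :: complex \<Rightarrow> complex \<Rightarrow> complex"
    by standard (auto simp: algebra_simps)
  show ?thesis
    by unfold_locales (use assms in auto)
qed

lemma topspace_weak_topology:
  assumes "vector_space s"
  shows "topspace (weak_topology s p) = UNIV"
proof -
  have "continuous_functional s p (\<lambda>_. 0)"
    unfolding continuous_functional_def by (intro conjI linear_functionalI assms) auto
  then have "openin (weak_topology s p) ((\<lambda>_. 0::complex) -` UNIV)"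
    by (rule openin_weak_topology_vimage) simp
  then show ?thesis
    using openin_subset by fastforce
qed

text \<open>A compact set stays compact in the coarser weak topology; the issue is the closure.
  Functionals that separate points make the weak topology Hausdorff, so the compact seminorm closure
  is weakly closed and contains the weak closure of the image as a closed subset.\<close>

lemma montel_imp_weakly_montel:
  assumes T: "montel_operator s p s' p' T" and p0: "\<And>n. p' n 0 = 0"
    and sep: "\<And>y. y \<noteq> 0 \<Longrightarrow> \<exists>\<phi>. continuous_functional s' p' \<phi> \<and> \<phi> y \<noteq> 0"
  shows "weakly_montel_operator s p s' p' T"
  unfolding weakly_montel_operator_def
proof (intro conjI allI impI)
  show lin: "Vector_Spaces.linear s s' T"
    using T by (simp add: montel_operator_def)
  then have vs: "vector_space s'"
    by (simp add: Vector_Spaces.linear_def)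
  fix B
  assume "seminorm_bounded p B"
  then have comp: "compactin (seminorm_topology p') (seminorm_topology p' closure_of (T ` B))"
      (is "compactin _ ?C")
    using T by (simp add: montel_operator_def relatively_compactin_def)
  have tops: "topspace (weak_topology s' p') = UNIV" "topspace (seminorm_topology p') = UNIV"
    using topspace_weak_topology[OF vs] topspace_seminorm_topology[of p', OF p0] by auto
  have C: "compactin (weak_topology s' p') ?C"
    using image_compactin[OF comp, of "weak_topology s' p'" "\<lambda>x. x"] openin_weak_topology_imp[of s' p', OF _ p0]
    by (auto simp: continuous_map_def tops)
  have "Hausdorff_space (weak_topology s' p')"
    unfolding Hausdorff_space_def
  proof (intro allI impI)
    fix x y :: 'b
    assume "x \<in> topspace (weak_topology s' p') \<and> y \<in> topspace (weak_topology s' p') \<and> x \<noteq> y"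
    then obtain \<phi> where \<phi>: "continuous_functional s' p' \<phi>" "\<phi> (x - y) \<noteq> 0"
      using sep[of "x - y"] by auto
    interpret Vector_Spaces.linear s' "(*)" \<phi>
      using \<phi>(1) by (simp add: continuous_functional_def)
    have "\<phi> x \<noteq> \<phi> y"
      using \<phi>(2) by (simp add: diff)
    then obtain U V where UV: "open U" "open V" "\<phi> x \<in> U" "\<phi> y \<in> V" "U \<inter> V = {}"
      using hausdorff by meson
    show "\<exists>U V. openin (weak_topology s' p') U \<and> openin (weak_topology s' p') V \<and> x \<in> U \<and> y \<in> V \<and> disjnt U V"
      using UV openin_weak_topology_vimage[OF \<phi>(1)]
      by (intro exI[of _ "\<phi> -` U"] exI[of _ "\<phi> -` V"]) (auto simp: disjnt_def)
  qed
  then have "closedin (weak_topology s' p') ?C"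
    using C by (rule compactin_imp_closedin)
  moreover have "T ` B \<subseteq> ?C"
    by (rule closure_of_subset) (simp add: tops)
  ultimately have "weak_topology s' p' closure_of (T ` B) \<subseteq> ?C"
    by (simp add: closure_of_minimal)
  then show "relatively_compactin (weak_topology s' p') (T ` B)"
    unfolding relatively_compactin_def using C
    by (meson closed_compactin closedin_closure_of)
qed

text \<open>Compactness enters through the finite intersection property: some point lies in the
  closure of every tail, and there each functional that converges along the sequence must take its
  limit.\<close>

lemma weak_cluster_point:
  assumes vs: "vector_space s" and S: "relatively_compactin (weak_topology s p) S"
    and x: "\<And>n::nat. x n \<in> S"
  obtains y where "\<And>\<phi> c. continuous_functional s p \<phi> \<Longrightarrow> (\<lambda>n. \<phi> (x n)) \<longlonglongrightarrow> c \<Longrightarrow> \<phi> y = c"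
proof -
  let ?W = "weak_topology s p"
  define C where "C n = ?W closure_of (x ` {n..})" for n :: nat
  have tops: "topspace ?W = UNIV"
    by (rule topspace_weak_topology[OF vs])
  have comp: "compactin ?W (?W closure_of S)"
    using S by (simp add: relatively_compactin_def)
  have anti: "C m \<subseteq> C n" if "n \<le> m" for m n
    unfolding C_def using that by (intro closure_of_mono image_mono) auto
  have "?W closure_of S \<inter> \<Inter>(range C) \<noteq> {}"
  proof (rule compactin_fip[THEN iffD1, OF comp, THEN conjunct2, rule_format, of "range C"], intro conjI allI impI)
    show "\<forall>D\<in>range C. closedin ?W D"
      by (auto simp: C_def)
    fix F
    assume F: "finite F \<and> F \<subseteq> range C"
    then obtain I where I: "finite I" "F = C ` I"
      using finite_subset_image[of F C UNIV] by blast
    obtain N where N: "\<And>i. i \<in> I \<Longrightarrow> i \<le> N"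
      using I(1) unfolding finite_nat_set_iff_bounded_le by auto
    have "x N \<in> C N"
      unfolding C_def by (rule closure_of_subset[THEN subsetD]) (auto simp: tops)
    then have "x N \<in> \<Inter>F"
      using N anti I by blast
    moreover have "x N \<in> ?W closure_of S"
      by (rule closure_of_subset[THEN subsetD]) (auto simp: tops x)
    ultimately show "?W closure_of S \<inter> \<Inter>F \<noteq> {}"
      by blast
  qed
  then obtain y where y: "\<And>n. y \<in> C n"
    by blast
  show ?thesis
  proof (rule that, rule ccontr)
    fix \<phi> c
    assume \<phi>: "continuous_functional s p \<phi>" "(\<lambda>n. \<phi> (x n)) \<longlonglongrightarrow> c" and "\<phi> y \<noteq> c"
    then obtain U V where UV: "open U" "open V" "\<phi> y \<in> U" "c \<in> V" "U \<inter> V = {}"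
      using hausdorff by meson
    obtain N where N: "\<And>n. N \<le> n \<Longrightarrow> \<phi> (x n) \<in> V"
      using topological_tendstoD[OF \<phi>(2) UV(2,4)] by (auto simp: eventually_sequentially)
    have "openin ?W (\<phi> -` U)" "y \<in> \<phi> -` U"
      using openin_weak_topology_vimage[OF \<phi>(1) UV(1)] UV by auto
    then obtain n where "N \<le> n" "\<phi> (x n) \<in> U"
      using y[of N] unfolding C_def in_closure_of by blast
    then show False
      using N UV by blast
  qed
qed

section \<open>Integration against a Radon measure\<close>

lemma emeasure_pos_part_upper:
  fixes \<phi> :: "real set \<Rightarrow> real"
  assumes "locally_additive \<phi>" "A \<in> sets borel" "B \<in> bounded_borel" "B \<subseteq> A"
  shows "ennreal (\<phi> B) \<le> emeasure (pos_part \<phi>) A"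
  unfolding emeasure_pos_part[OF assms(1,2)] using assms(3,4) by (intro SUP_upper) auto

lemma emeasure_pos_part_least:
  fixes \<phi> :: "real set \<Rightarrow> real"
  assumes "locally_additive \<phi>" "A \<in> sets borel"
    and "\<And>B. B \<in> bounded_borel \<Longrightarrow> B \<subseteq> A \<Longrightarrow> ennreal (\<phi> B) \<le> c"
  shows "emeasure (pos_part \<phi>) A \<le> c"
  unfolding emeasure_pos_part[OF assms(1,2)] using assms(3) by (intro SUP_least) auto

lemma measure_pos_part:
  fixes \<phi> :: "real set \<Rightarrow> real"
  assumes \<phi>: "locally_additive \<phi>" and A: "A \<in> bounded_borel"
  shows "B \<in> bounded_borel \<Longrightarrow> B \<subseteq> A \<Longrightarrow> \<phi> B \<le> measure (pos_part \<phi>) A"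
    and "(\<And>B. B \<in> bounded_borel \<Longrightarrow> B \<subseteq> A \<Longrightarrow> \<phi> B \<le> c) \<Longrightarrow> measure (pos_part \<phi>) A \<le> c"
proof -
  have A': "A \<in> sets borel"
    using A by (simp add: bounded_borel_def)
  have em: "emeasure (pos_part \<phi>) A = ennreal (measure (pos_part \<phi>) A)"
    using emeasure_pos_part_finite[OF \<phi> A] by (intro emeasure_eq_ennreal_measure) auto
  show "\<phi> B \<le> measure (pos_part \<phi>) A" if "B \<in> bounded_borel" "B \<subseteq> A"
    using emeasure_pos_part_upper[OF \<phi> A' that] unfolding em by (simp add: ennreal_le_iff)
  assume c: "\<And>B. B \<in> bounded_borel \<Longrightarrow> B \<subseteq> A \<Longrightarrow> \<phi> B \<le> c"
  have "0 \<le> c"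
    using c[of "{}"] locally_additive_empty[OF \<phi>] by (simp add: bounded_borel_def)
  moreover have "emeasure (pos_part \<phi>) A \<le> ennreal c"
    using c by (intro emeasure_pos_part_least[OF \<phi> A'] ennreal_leI) auto
  ultimately show "measure (pos_part \<phi>) A \<le> c"
    unfolding em by (simp add: ennreal_le_iff)
qed

text \<open>For \<open>B\<close> inside \<open>A\<close>, \<phi>(B) = \<phi>(A) - \<phi>(A - B) is
  at most \<phi>(A) plus the negative part of \<open>A\<close>. The supremum over \<open>B\<close>
  gives one inequality, and the same argument for -\<phi> gives the other.\<close>

lemma jordan_decomposition:
  fixes \<phi> :: "real set \<Rightarrow> real"
  assumes \<phi>: "locally_additive \<phi>" and A: "A \<in> bounded_borel"
  shows "\<phi> A = measure (pos_part \<phi>) A - measure (pos_part (\<lambda>B. - \<phi> B)) A"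
proof -
  have upper: "measure (pos_part \<phi>) A \<le> \<phi> A + measure (pos_part (\<lambda>B. - \<phi> B)) A"
    if \<phi>: "locally_additive \<phi>" "locally_additive (\<lambda>B. - \<phi> B)" for \<phi> :: "real set \<Rightarrow> real"
  proof (rule measure_pos_part(2)[OF \<phi>(1) A])
    fix B
    assume B: "B \<in> bounded_borel" "B \<subseteq> A"
    then have AB: "A - B \<in> bounded_borel"
      using A by (intro bounded_borel_subset[OF A]) (auto simp: bounded_borel_def)
    have "\<phi> A = \<phi> B + \<phi> (A - B)"
      using locally_additive_Un[OF \<phi>(1) B(1) AB] B(2) by (simp add: Un_absorb1)
    then show "\<phi> B \<le> \<phi> A + measure (pos_part (\<lambda>B. - \<phi> B)) A"
      using measure_pos_part(1)[OF \<phi>(2) A AB] by auto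
  qed
  have neg: "locally_additive (\<lambda>B. - \<phi> B)"
    using \<phi> unfolding locally_additive_def by (auto intro!: sums_minus)
  show ?thesis
    using upper[OF \<phi> neg] upper[OF neg] \<phi> by force
qed

lemma locally_additive_mloc_fun: "locally_additive (mloc_fun \<nu>)"
  and mloc_fun_eq_0: "A \<notin> bounded_borel \<Longrightarrow> mloc_fun \<nu> A = 0"
  using mloc_fun[of \<nu>] by auto

text \<open>Indexed so that \<open>\<nu>\<close> is the sum of \<open>\<i>\<^sup>k\<close> times its \<open>k\<close>-th part over \<open>k < 4\<close>.\<close>

definition jordan_part :: "mloc \<Rightarrow> nat \<Rightarrow> real measure" where
  "jordan_part \<nu> k = pos_part (\<lambda>A. Re (cnj (\<i> ^ k) * mloc_fun \<nu> A))"

lemma locally_additive_jordan: "locally_additive (\<lambda>A. Re (z * mloc_fun \<nu> A))"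
  unfolding locally_additive_def
proof (intro allI impI)
  fix F :: "nat \<Rightarrow> real set"
  assume "range F \<subseteq> bounded_borel" "disjoint_family F" "\<Union>(range F) \<in> bounded_borel"
  then have "(\<lambda>i. mloc_fun \<nu> (F i)) sums mloc_fun \<nu> (\<Union>(range F))"
    using locally_additive_mloc_fun[of \<nu>] by (simp add: locally_additive_def)
  then show "(\<lambda>i. Re (z * mloc_fun \<nu> (F i))) sums Re (z * mloc_fun \<nu> (\<Union>(range F)))"
    by (intro sums_Re sums_mult)
qed

lemma sets_jordan_part [simp, measurable_cong]: "sets (jordan_part \<nu> k) = sets borel"
  by (simp add: jordan_part_def)

lemma space_jordan_part [simp]: "space (jordan_part \<nu> k) = UNIV"
  by (simp add: jordan_part_def)

lemma emeasure_jordan_part_finite: "A \<in> bounded_borel \<Longrightarrow> emeasure (jordan_part \<nu> k) A < \<infinity>"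
  unfolding jordan_part_def by (rule emeasure_pos_part_finite[OF locally_additive_jordan])

lemma emeasure_jordan_part_negative: "emeasure (jordan_part \<nu> k) {..<0} = 0"
proof -
  have "emeasure (jordan_part \<nu> k) {..<0} \<le> 0"
    unfolding jordan_part_def
  proof (rule emeasure_pos_part_least[OF locally_additive_jordan])
    fix B :: "real set"
    assume "B \<in> bounded_borel" "B \<subseteq> {..<0}"
    then have "B \<subseteq> {..<0} \<inter> {0..}"
      by (simp add: bounded_borel_def)
    also have "{..<0} \<inter> {0..} = ({} :: real set)"
      by auto
    finally have "B = {}"
      by simp
    then show "ennreal (Re (cnj (\<i> ^ k) * mloc_fun \<nu> B)) \<le> 0"
      using locally_additive_empty[OF locally_additive_jordan] by simp
  qed simp
  then show ?thesis
    by simp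
qed

lemma bounded_borel_Icc [simp]: "{0..T} \<in> bounded_borel" and bounded_borel_Ico [simp]: "{0..<T} \<in> bounded_borel"
  and bounded_borel_empty [simp]: "{} \<in> bounded_borel"
  by (auto simp: bounded_borel_def)

text \<open>A prerequisite of Fubini. The negative half-line joins the exhaustion as one null set
  because the measures live on the whole line.\<close>

lemma sigma_finite_jordan_part: "sigma_finite_measure (jordan_part \<nu> k)"
proof
  let ?F = "insert {..<0} (range (\<lambda>n::nat. {0..real n}))"
  have F: "\<Union>?F = UNIV"
  proof (intro UNIV_eq_I[symmetric])
    fix x :: real
    show "x \<in> \<Union>?F"
  proof -
    obtain n where "x \<le> real n"
      using real_arch_simple by blast
    then show ?thesis
      by (cases "x < 0") auto
  qed
  qed
  then have "{..<0} \<union> (\<Union>n. {0..real n}) = UNIV"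
    by simp
  moreover have "range (\<lambda>n. {0..real n}) \<subseteq> sets borel"
    by auto
  ultimately show "\<exists>A. countable A \<and> A \<subseteq> sets (jordan_part \<nu> k) \<and> \<Union>A = space (jordan_part \<nu> k) \<and>
      (\<forall>a\<in>A. emeasure (jordan_part \<nu> k) a \<noteq> \<infinity>)"
    using emeasure_jordan_part_finite[of _ \<nu> k]
    by (intro exI[of _ ?F] conjI) (simp_all add: emeasure_jordan_part_negative less_top)
qed

lemma sum_lessThan_4: "sum f {..<4::nat} = f 0 + f 1 + f 2 + f 3"
  by (simp add: eval_nat_numeral)

text \<open>Values on the negative half-line are ignored, as they are by \<^const>\<open>radon_integral\<close>.\<close>

definition integrand :: "(real \<Rightarrow> complex) \<Rightarrow> bool" where
  "integrand h \<longleftrightarrow> (\<lambda>t. indicator {0..} t *\<^sub>R h t) \<in> borel_measurable borel \<and>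
     (\<exists>K T. \<forall>t\<ge>0. cmod (h t) \<le> K \<and> (T < t \<longrightarrow> h t = 0))"

lemma integrandE:
  assumes "integrand h"
  obtains K T where "0 \<le> K" "0 \<le> T" "\<And>t. 0 \<le> t \<Longrightarrow> cmod (h t) \<le> K" "\<And>t. 0 \<le> t \<Longrightarrow> T < t \<Longrightarrow> h t = 0"
proof -
  obtain K T where KT: "\<And>t. 0 \<le> t \<Longrightarrow> cmod (h t) \<le> K \<and> (T < t \<longrightarrow> h t = 0)"
    using assms by (auto simp: integrand_def)
  show ?thesis
    by (rule that[of "max 0 K" "max 0 T"]) (use KT in \<open>auto simp: le_max_iff_disj\<close>)
qed

lemma integrandI:
  assumes "(\<lambda>t. indicator {0..} t *\<^sub>R h t) \<in> borel_measurable borel"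
    "\<And>t. 0 \<le> t \<Longrightarrow> cmod (h t) \<le> K" "\<And>t. 0 \<le> t \<Longrightarrow> T < t \<Longrightarrow> h t = 0"
  shows "integrand h"
  using assms unfolding integrand_def by blast

lemma integrand_measurable:
  "integrand h \<Longrightarrow> (\<lambda>t. indicator {0..} t *\<^sub>R h t) \<in> borel_measurable borel"
  by (simp add: integrand_def)

lemma integrand_lin:
  assumes "integrand f" "integrand g"
  shows "integrand (\<lambda>t. c * f t + g t)"
proof -
  obtain K T where f: "\<And>t. 0 \<le> t \<Longrightarrow> cmod (f t) \<le> K" "\<And>t. 0 \<le> t \<Longrightarrow> T < t \<Longrightarrow> f t = 0"
    using assms(1) by (rule integrandE) blast
  obtain L S where g: "\<And>t. 0 \<le> t \<Longrightarrow> cmod (g t) \<le> L" "\<And>t. 0 \<le> t \<Longrightarrow> S < t \<Longrightarrow> g t = 0"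
    using assms(2) by (rule integrandE) blast
  show ?thesis
  proof (rule integrandI[of _ "cmod c * K + L" "max T S"])
    have "(\<lambda>t. c * (indicator {0..} t *\<^sub>R f t) + indicator {0..} t *\<^sub>R g t) \<in> borel_measurable borel"
      using assms[THEN integrand_measurable] by measurable
    also have "(\<lambda>t. c * (indicator {0..} t *\<^sub>R f t) + indicator {0..} t *\<^sub>R g t) =
        (\<lambda>t. indicator {0..} t *\<^sub>R (c * f t + g t))"
      by (auto simp: algebra_simps)
    finally show "(\<lambda>t. indicator {0..} t *\<^sub>R (c * f t + g t)) \<in> borel_measurable borel" .
    show "cmod (c * f t + g t) \<le> cmod c * K + L" if "0 \<le> t" for t
      using f(1)[OF that] g(1)[OF that]
      by (intro norm_triangle_le add_mono) (auto simp: norm_mult intro: mult_left_mono)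
  qed (use f g in auto)
qed

lemma integrand_indicator [simp]: "A \<in> bounded_borel \<Longrightarrow> integrand (indicator A)"
proof -
  assume A: "A \<in> bounded_borel"
  then obtain T where T: "A \<subseteq> {0..T}"
    by (rule bounded_borel_bound)
  show ?thesis
  proof (rule integrandI[of _ 1 T])
    have "(\<lambda>t. indicator {0..} t *\<^sub>R indicator A t) = (indicator A :: real \<Rightarrow> complex)"
      using T by (auto simp: fun_eq_iff indicator_def)
    then show "(\<lambda>t. indicator {0..} t *\<^sub>R (indicator A t :: complex)) \<in> borel_measurable borel"
      using A borel_measurable_indicator[of A borel] by (simp add: bounded_borel_def)
  qed (use T in \<open>auto simp: indicator_def\<close>)
qed

lemma integrand_zero [simp]: "integrand (\<lambda>_. 0)"
  by (rule integrandI[of _ 0 0]) auto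

lemma integrand_scale: "integrand f \<Longrightarrow> integrand (\<lambda>t. c * f t)"
  using integrand_lin[of f "\<lambda>_. 0" c] by simp

lemma integrand_add: "integrand f \<Longrightarrow> integrand g \<Longrightarrow> integrand (\<lambda>t. f t + g t)"
  using integrand_lin[of f g 1] by simp

lemma integrand_diff: "integrand f \<Longrightarrow> integrand g \<Longrightarrow> integrand (\<lambda>t. f t - g t)"
  using integrand_lin[of g f "-1"] by simp

lemma integrand_sum: "finite I \<Longrightarrow> (\<And>i. i \<in> I \<Longrightarrow> integrand (f i)) \<Longrightarrow> integrand (\<lambda>t. \<Sum>i\<in>I. f i t)"
  by (induction I rule: finite_induct) (auto intro: integrand_add)

text \<open>The common bound and the common support make dominated convergence available for every
  Radon measure at once, as these are finite on bounded sets.\<close>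

definition bounded_limit :: "(nat \<Rightarrow> real \<Rightarrow> complex) \<Rightarrow> (real \<Rightarrow> complex) \<Rightarrow> bool" where
  "bounded_limit F f \<longleftrightarrow> (\<forall>i. integrand (F i)) \<and>
     (\<exists>K T. \<forall>i. \<forall>t\<ge>0. cmod (F i t) \<le> K \<and> (T < t \<longrightarrow> F i t = 0)) \<and>
     (\<forall>t\<ge>0. (\<lambda>i. F i t) \<longlonglongrightarrow> f t)"

lemma bounded_limitI:
  assumes "\<And>i. integrand (F i)" "\<And>i t. 0 \<le> t \<Longrightarrow> cmod (F i t) \<le> K"
    "\<And>i t. 0 \<le> t \<Longrightarrow> T < t \<Longrightarrow> F i t = 0" "\<And>t. 0 \<le> t \<Longrightarrow> (\<lambda>i. F i t) \<longlonglongrightarrow> f t"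
  shows "bounded_limit F f"
  using assms unfolding bounded_limit_def by blast

lemma bounded_limitE:
  assumes "bounded_limit F f"
  obtains K T where "0 \<le> K" "0 \<le> T" "\<And>i t. 0 \<le> t \<Longrightarrow> cmod (F i t) \<le> K"
    "\<And>i t. 0 \<le> t \<Longrightarrow> T < t \<Longrightarrow> F i t = 0"
    "\<And>t. 0 \<le> t \<Longrightarrow> cmod (f t) \<le> K" "\<And>t. 0 \<le> t \<Longrightarrow> T < t \<Longrightarrow> f t = 0"
proof -
  obtain K T where KT: "\<And>i t. 0 \<le> t \<Longrightarrow> cmod (F i t) \<le> K \<and> (T < t \<longrightarrow> F i t = 0)"
    using assms unfolding bounded_limit_def by blast
  have lim: "(\<lambda>i. F i t) \<longlonglongrightarrow> f t" if "0 \<le> t" for t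
    using assms that by (auto simp: bounded_limit_def)
  show ?thesis
  proof (rule that[of "max 0 K" "max 0 T"])
    show "cmod (f t) \<le> max 0 K" if "0 \<le> t" for t
      by (rule LIMSEQ_le_const2[OF tendsto_norm[OF lim[OF that]]]) (use KT that in \<open>auto simp: le_max_iff_disj\<close>)
    show "f t = 0" if "0 \<le> t" "max 0 T < t" for t
    proof -
      have "(\<lambda>i. F i t) = (\<lambda>i. 0)"
        using KT that by auto
      then show ?thesis
        using lim[OF that(1)] LIMSEQ_unique tendsto_const by metis
    qed
  qed (use KT in \<open>auto simp: le_max_iff_disj\<close>)
qed

lemma integrand_bounded_limit:
  assumes "bounded_limit F f"
  shows "integrand f"
proof -
  obtain K T where KT: "\<And>t. 0 \<le> t \<Longrightarrow> cmod (f t) \<le> K" "\<And>t. 0 \<le> t \<Longrightarrow> T < t \<Longrightarrow> f t = 0"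
    using assms by (rule bounded_limitE) blast
  show ?thesis
  proof (rule integrandI[OF _ KT])
    show "(\<lambda>t. indicator {0..} t *\<^sub>R f t) \<in> borel_measurable borel"
    proof (rule borel_measurable_LIMSEQ_metric)
      show "(\<lambda>t. indicator {0..} t *\<^sub>R F i t) \<in> borel_measurable borel" for i
        using assms by (simp add: bounded_limit_def integrand_measurable)
      show "(\<lambda>i. indicator {0..} t *\<^sub>R F i t) \<longlonglongrightarrow> indicator {0..} t *\<^sub>R f t" for t
        using assms by (cases "0 \<le> t") (auto simp: bounded_limit_def)
    qed
  qed auto
qed

text \<open>Seen as a constant sequence, \<open>f\<close> tends to \<open>g\<close> on the
  half-line, which is all that \<open>bounded_limit\<close> looks at.\<close>

lemma integrand_cong:
  assumes "integrand f" "\<And>t. 0 \<le> t \<Longrightarrow> f t = g t"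
  shows "integrand g" "bounded_limit (\<lambda>_. f) g"
proof -
  show "bounded_limit (\<lambda>_. f) g"
    using assms by (auto simp: bounded_limit_def integrand_def)
  then show "integrand g"
    by (rule integrand_bounded_limit)
qed

text \<open>Simple functions approximate a Borel function pointwise with a uniform bound, so
  linearity and bounded limits reach every integrand from indicators.\<close>

lemma integrand_induct [consumes 1, case_names indicator lin lim]:
  assumes h: "integrand h"
    and ind: "\<And>A. A \<in> bounded_borel \<Longrightarrow> P (indicator A)"
    and lin: "\<And>c f g. integrand f \<Longrightarrow> integrand g \<Longrightarrow> P f \<Longrightarrow> P g \<Longrightarrow> P (\<lambda>t. c * f t + g t)"
    and lim: "\<And>F f. bounded_limit F f \<Longrightarrow> (\<And>i. P (F i)) \<Longrightarrow> P f"
  shows "P h"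
proof -
  define g where "g = (\<lambda>t. indicator {0..} t *\<^sub>R h t)"
  have g: "g \<in> borel_measurable borel"
    using h by (simp add: integrand_def g_def)
  obtain K T where K: "0 \<le> K" "\<And>t. 0 \<le> t \<Longrightarrow> cmod (h t) \<le> K"
    and T: "\<And>t. 0 \<le> t \<Longrightarrow> T < t \<Longrightarrow> h t = 0"
    using h by (rule integrandE) blast
  have gK: "cmod (g t) \<le> K" for t
    using K by (auto simp: g_def indicator_def)
  \<comment> \<open>Taking 0 as base point bounds each approximant by twice |g|: this gives the
    common bound \<open>2 * K\<close> and makes the approximants vanish wherever \<open>g\<close>
    does.\<close>
  obtain F where F: "\<And>i. simple_function borel (F i)" "\<And>t. (\<lambda>i. F i t) \<longlonglongrightarrow> g t"
    and F0: "\<And>i t. dist (F i t) 0 \<le> 2 * dist (g t) 0"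
    using borel_measurable_implies_sequence_metric[OF g, of 0] by auto
  have FK: "cmod (F i t) \<le> 2 * K" for i t
    using F0[of i t] gK[of t] by simp
  have Fz: "F i t = 0" if "t < 0 \<or> T < t" for i t
    using F0[of i t] T[of t] that by (cases "t < 0") (auto simp: g_def)
  have P0: "P (\<lambda>_. 0)"
    using ind[of "{}"] by (simp add: fun_eq_iff[symmetric] indicator_def[abs_def])
  have sum: "P (\<lambda>t. \<Sum>y\<in>Y. y * indicator (B y) t) \<and> integrand (\<lambda>t. \<Sum>y\<in>Y. y * indicator (B y) t)"
    if "finite Y" "\<And>y. y \<in> Y \<Longrightarrow> B y \<in> bounded_borel" for Y and B :: "complex \<Rightarrow> real set"
    using that
  proof (induction Y rule: finite_induct)
    case (insert y Y)
    then have "P (\<lambda>t. y * indicator (B y) t + (\<Sum>y\<in>Y. y * indicator (B y) t)) \<and>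
        integrand (\<lambda>t. y * indicator (B y) t + (\<Sum>y\<in>Y. y * indicator (B y) t))"
      by (intro conjI lin ind integrand_lin integrand_indicator) blast+
    then show ?case
      using insert(1,2) by (simp only: sum.insert[OF insert(1,2)])
  qed (simp add: P0)
  have PF: "P (F i) \<and> integrand (F i)" for i
  proof -
    \<comment> \<open>The value 0 is left out: its level set is unbounded and hence no member of
      \<open>bounded_borel\<close>.\<close>
    let ?Y = "range (F i) - {0}"
    have "finite (range (F i))"
      using F(1)[of i] by (simp add: simple_function_def)
    then have fin: "finite ?Y"
      by simp
    have "F i t = (\<Sum>y\<in>?Y. y * indicator (F i -` {y}) t)" for t
    proof -
      have "F i t = (\<Sum>y\<in>range (F i). indicator (F i -` {y}) t *\<^sub>R y)"
        by (rule simple_function_indicator_representation_banach[OF F(1)[of i], of t,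
              unfolded space_borel Int_UNIV_right, OF UNIV_I])
      also have "\<dots> = (\<Sum>y\<in>?Y. indicator (F i -` {y}) t *\<^sub>R y)"
        using \<open>finite (range (F i))\<close> by (intro sum.mono_neutral_right) auto
      also have "\<dots> = (\<Sum>y\<in>?Y. y * indicator (F i -` {y}) t)"
        by (intro sum.cong) (auto simp: indicator_def)
      finally show ?thesis .
    qed
    then have eq: "F i = (\<lambda>t. \<Sum>y\<in>?Y. y * indicator (F i -` {y}) t)"
      by (rule ext)
    have "F i -` {y} \<in> bounded_borel" if "y \<in> ?Y" for y
    proof (rule bounded_borel_subset[of "{0..T}"])
      show "F i -` {y} \<subseteq> {0..T}"
      proof
        fix t
        assume "t \<in> F i -` {y}"
        then show "t \<in> {0..T}"
          using that Fz[of t i] by (cases "t < 0 \<or> T < t") auto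
      qed
      show "F i -` {y} \<in> sets borel"
        using simple_functionD(2)[OF F(1)[of i], of "{y}"] by simp
    qed simp
    then show ?thesis
      using sum[OF fin, of "\<lambda>y. F i -` {y}"] eq by simp
  qed
  show ?thesis
  proof (rule lim[of F])
    show "bounded_limit F h"
    proof (rule bounded_limitI[of _ "2 * K" T])
      show "(\<lambda>i. F i t) \<longlonglongrightarrow> h t" if "0 \<le> t" for t
        using F(2)[of t] that by (simp add: g_def)
    qed (use PF FK Fz in auto)
  qed (use PF in auto)
qed

lemma integrable_jordan_part:
  assumes "integrand h"
  shows "integrable (jordan_part \<nu> k) (\<lambda>t. indicator {0..} t *\<^sub>R h t)"
proof -
  obtain K T where K: "0 \<le> K" "\<And>t. 0 \<le> t \<Longrightarrow> cmod (h t) \<le> K"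
    and T: "\<And>t. 0 \<le> t \<Longrightarrow> T < t \<Longrightarrow> h t = 0"
    using assms by (rule integrandE) blast
  show ?thesis
  proof (rule integrableI_bounded_set[of "{0..T}" _ _ K])
    show "emeasure (jordan_part \<nu> k) {0..T} < \<infinity>"
      by (rule emeasure_jordan_part_finite) simp
    show "AE t in jordan_part \<nu> k. t \<in> {0..T} \<longrightarrow> norm (indicator {0..} t *\<^sub>R h t) \<le> K"
      using K by auto
    show "AE t in jordan_part \<nu> k. t \<notin> {0..T} \<longrightarrow> indicator {0..} t *\<^sub>R h t = 0"
    proof (rule AE_I2)
      show "t \<notin> {0..T} \<longrightarrow> indicator {0..} t *\<^sub>R h t = 0" for t
        using T[of t] by (cases "0 \<le> t") auto
    qed
    show "(\<lambda>t. indicator {0..} t *\<^sub>R h t) \<in> borel_measurable (jordan_part \<nu> k)"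
      using integrand_measurable[OF assms] by simp
  qed simp
qed

section \<open>The pairing of a measure with an integrand\<close>

definition rint :: "mloc \<Rightarrow> (real \<Rightarrow> complex) \<Rightarrow> complex" where
  "rint \<nu> h = radon_integral (mloc_fun \<nu>) h"

lemma rint_altdef:
  "rint \<nu> h = (\<Sum>k<4. \<i> ^ k * (LINT t:{0..}|jordan_part \<nu> k. h t))"
  by (simp add: rint_def radon_integral_def jordan_part_def sum_lessThan_4 power3_eq_cube algebra_simps)

text \<open>A stand-in for |\<nu>| that is additive by construction. On [0,n) it lies between the
  total variation and four times the total variation.\<close>

definition mass :: "mloc \<Rightarrow> real set \<Rightarrow> real" where
  "mass \<nu> A = (\<Sum>k<4. measure (jordan_part \<nu> k) A)"

lemma mass_nonneg: "0 \<le> mass \<nu> A"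
  by (simp add: mass_def sum_nonneg)

lemma rint_bound:
  assumes h: "integrand h" and K: "0 \<le> K" "\<And>t. 0 \<le> t \<Longrightarrow> cmod (h t) \<le> K"
    and A: "A \<in> bounded_borel" "\<And>t. 0 \<le> t \<Longrightarrow> t \<notin> A \<Longrightarrow> h t = 0"
  shows "cmod (rint \<nu> h) \<le> K * mass \<nu> A"
proof -
  have A': "A \<in> sets borel"
    using A(1) by (simp add: bounded_borel_def)
  have "cmod (LINT t:{0..}|jordan_part \<nu> k. h t) \<le> K * measure (jordan_part \<nu> k) A" for k
  proof -
    have "cmod (LINT t:{0..}|jordan_part \<nu> k. h t) \<le> (LINT t|jordan_part \<nu> k. cmod (indicator {0..} t *\<^sub>R h t))"
      unfolding set_lebesgue_integral_def by (rule integral_norm_bound)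
    also have "\<dots> \<le> (LINT t|jordan_part \<nu> k. K * indicator A t)"
    proof (rule integral_mono)
      show "integrable (jordan_part \<nu> k) (\<lambda>t. cmod (indicator {0..} t *\<^sub>R h t))"
        by (intro integrable_norm integrable_jordan_part h)
      show "integrable (jordan_part \<nu> k) (\<lambda>t. K * indicator A t)"
        using emeasure_jordan_part_finite[OF A(1), of \<nu> k] A'
        by (intro integrable_mult_right integrable_real_indicator) auto
      show "cmod (indicator {0..} t *\<^sub>R h t) \<le> K * indicator A t" for t
        using K(1) K(2)[of t] A(2)[of t] by (auto simp: indicator_def)
    qed
    also have "\<dots> = K * measure (jordan_part \<nu> k) A"
      using A' by simp
    finally show ?thesis .
  qed
  then have "cmod (rint \<nu> h) \<le> (\<Sum>k<4. K * measure (jordan_part \<nu> k) A)"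
    unfolding rint_altdef
    by (intro order.trans[OF norm_sum] sum_mono) (simp add: norm_mult norm_power)
  then show ?thesis
    by (simp add: mass_def sum_distrib_left)
qed

lemma rint_cong: "(\<And>t. 0 \<le> t \<Longrightarrow> f t = g t) \<Longrightarrow> rint \<nu> f = rint \<nu> g"
  unfolding rint_altdef set_lebesgue_integral_def
  by (intro sum.cong arg_cong2[where f = "(*)"] Bochner_Integration.integral_cong refl)
    (auto simp: indicator_def)

lemma rint_lin:
  assumes "integrand f" "integrand g"
  shows "rint \<nu> (\<lambda>t. c * f t + g t) = c * rint \<nu> f + rint \<nu> g"
proof -
  have "(LINT t:{0..}|jordan_part \<nu> k. c * f t + g t) =
      c * (LINT t:{0..}|jordan_part \<nu> k. f t) + (LINT t:{0..}|jordan_part \<nu> k. g t)" for k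
  proof -
    have "(LINT t:{0..}|jordan_part \<nu> k. c * f t + g t) =
      (LINT t|jordan_part \<nu> k. c * (indicator {0..} t *\<^sub>R f t) + indicator {0..} t *\<^sub>R g t)"
      unfolding set_lebesgue_integral_def by (simp add: algebra_simps)
    also have "\<dots> = c * (LINT t|jordan_part \<nu> k. indicator {0..} t *\<^sub>R f t) +
        (LINT t|jordan_part \<nu> k. indicator {0..} t *\<^sub>R g t)"
      unfolding integral_mult_right_zero[symmetric]
      by (intro Bochner_Integration.integral_add integrable_mult_right integrable_jordan_part assms)
    finally show ?thesis
      by (simp only: set_lebesgue_integral_def)
  qed
  then show ?thesis
    by (simp add: rint_altdef algebra_simps sum.distrib sum_distrib_left)
qed

lemma rint_zero [simp]: "rint \<nu> (\<lambda>_. 0) = 0"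
  by (simp add: rint_altdef)

lemma rint_scale: "integrand f \<Longrightarrow> rint \<nu> (\<lambda>t. c * f t) = c * rint \<nu> f"
  using rint_lin[of f "\<lambda>_. 0" \<nu> c] by simp

lemma rint_add: "integrand f \<Longrightarrow> integrand g \<Longrightarrow> rint \<nu> (\<lambda>t. f t + g t) = rint \<nu> f + rint \<nu> g"
  using rint_lin[of f g \<nu> 1] by simp

lemma rint_diff: "integrand f \<Longrightarrow> integrand g \<Longrightarrow> rint \<nu> (\<lambda>t. f t - g t) = rint \<nu> f - rint \<nu> g"
  using rint_lin[of g f \<nu> "-1"] by simp

lemma rint_sum:
  "finite I \<Longrightarrow> (\<And>i. i \<in> I \<Longrightarrow> integrand (f i)) \<Longrightarrow> rint \<nu> (\<lambda>t. \<Sum>i\<in>I. f i t) = (\<Sum>i\<in>I. rint \<nu> (f i))"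
  by (induction I rule: finite_induct) (auto simp: rint_add integrand_sum)

lemma rint_tendsto:
  assumes "bounded_limit F f"
  shows "(\<lambda>i. rint \<nu> (F i)) \<longlonglongrightarrow> rint \<nu> f"
proof -
  obtain K T where K: "0 \<le> K" "\<And>i t. 0 \<le> t \<Longrightarrow> cmod (F i t) \<le> K"
    and T: "0 \<le> T" "\<And>i t. 0 \<le> t \<Longrightarrow> T < t \<Longrightarrow> F i t = 0"
    using assms by (rule bounded_limitE) blast
  have F: "integrand (F i)" for i
    using assms by (simp add: bounded_limit_def)
  have "(\<lambda>i. LINT t|jordan_part \<nu> k. indicator {0..} t *\<^sub>R F i t)
      \<longlonglongrightarrow> (LINT t|jordan_part \<nu> k. indicator {0..} t *\<^sub>R f t)" for k
  proof (rule integral_dominated_convergence)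
    show "integrable (jordan_part \<nu> k) (\<lambda>t. K * indicator {0..T} t)"
      using emeasure_jordan_part_finite[of "{0..T}" \<nu> k]
      by (intro integrable_mult_right integrable_real_indicator) auto
    show "(\<lambda>t. indicator {0..} t *\<^sub>R f t) \<in> borel_measurable (jordan_part \<nu> k)"
      using integrand_bounded_limit[OF assms, THEN integrand_measurable] by simp
    show "(\<lambda>t. indicator {0..} t *\<^sub>R F i t) \<in> borel_measurable (jordan_part \<nu> k)" for i
      using integrand_measurable[OF F] by simp
    show "AE t in jordan_part \<nu> k. (\<lambda>i. indicator {0..} t *\<^sub>R F i t) \<longlonglongrightarrow> indicator {0..} t *\<^sub>R f t"
      using assms by (auto simp: bounded_limit_def indicator_def)
    show "AE t in jordan_part \<nu> k. norm (indicator {0..} t *\<^sub>R F i t) \<le> K * indicator {0..T} t" for i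
      using K T by (intro AE_I2) (auto simp: indicator_def not_le)
  qed
  then show ?thesis
    unfolding rint_altdef set_lebesgue_integral_def
    by (intro tendsto_sum tendsto_mult_left)
qed

lemma mloc_fun_jordan:
  assumes A: "A \<in> bounded_borel"
  shows "mloc_fun \<nu> A = (\<Sum>k<4. \<i> ^ k * complex_of_real (measure (jordan_part \<nu> k) A))"
proof -
  have "Re (z * mloc_fun \<nu> A) = measure (pos_part (\<lambda>B. Re (z * mloc_fun \<nu> B))) A -
      measure (pos_part (\<lambda>B. - Re (z * mloc_fun \<nu> B))) A" for z
    by (rule jordan_decomposition[OF locally_additive_jordan A])
  \<comment> \<open>\<open>z = 1\<close> and \<open>z = -\<i>\<close> extract real and imaginary
    part; their positive and negative parts are the Jordan parts with indices 0, 2 and 1, 3.\<close>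
  from this[of 1] this[of "-\<i>"] show ?thesis
    unfolding sum_lessThan_4
    by (simp add: complex_eq_iff jordan_part_def power3_eq_cube)
qed

lemma rint_indicator:
  assumes A: "A \<in> bounded_borel"
  shows "rint \<nu> (indicator A) = mloc_fun \<nu> A"
proof -
  have J: "(LINT t:{0..}|jordan_part \<nu> k. indicator A t) = complex_of_real (measure (jordan_part \<nu> k) A)" for k
  proof -
    have "(LINT t:{0..}|jordan_part \<nu> k. indicator A t) = (LINT t|jordan_part \<nu> k. complex_of_real (indicator A t))"
      unfolding set_lebesgue_integral_def using A
      by (intro Bochner_Integration.integral_cong) (auto simp: bounded_borel_def indicator_def)
    also have "\<dots> = complex_of_real (measure (jordan_part \<nu> k) A)"
      using A by (subst integral_complex_of_real) (simp add: bounded_borel_def)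
    finally show ?thesis .
  qed
  show ?thesis
    by (simp only: rint_altdef J mloc_fun_jordan[OF A])
qed

lemma mloc_fun_eqI:
  assumes "\<And>A. A \<in> bounded_borel \<Longrightarrow> mloc_fun \<kappa> A = mloc_fun \<nu> A"
  shows "\<kappa> = \<nu>"
proof -
  have "mloc_fun \<kappa> A = mloc_fun \<nu> A" for A
    using assms[of A] by (cases "A \<in> bounded_borel") (simp_all add: mloc_fun_eq_0)
  then show ?thesis
    by (simp add: mloc_fun_inject[symmetric] fun_eq_iff)
qed

lemma mloc_eqI:
  assumes "\<And>h. integrand h \<Longrightarrow> rint \<kappa> h = rint \<nu> h"
  shows "\<kappa> = \<nu>"
  using assms by (intro mloc_fun_eqI) (simp flip: rint_indicator)

section \<open>Functionals that come from measures\<close>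

definition sigma_functional :: "((real \<Rightarrow> complex) \<Rightarrow> complex) \<Rightarrow> bool" where
  "sigma_functional L \<longleftrightarrow>
     (\<forall>c f g. integrand f \<longrightarrow> integrand g \<longrightarrow> L (\<lambda>t. c * f t + g t) = c * L f + L g) \<and>
     (\<forall>F f. bounded_limit F f \<longrightarrow> (\<lambda>i. L (F i)) \<longlonglongrightarrow> L f)"

lemma sigma_functional_rint: "sigma_functional (rint \<nu>)"
  by (simp add: sigma_functional_def rint_lin rint_tendsto)

lemma sigma_functional_unique:
  assumes L: "sigma_functional L" and M: "sigma_functional M"
    and eq: "\<And>A. A \<in> bounded_borel \<Longrightarrow> L (indicator A) = M (indicator A)" and h: "integrand h"
  shows "L h = M h"
  using h
proof (induction h rule: integrand_induct)
  case (lim F f)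
  have "(\<lambda>i. L (F i)) \<longlonglongrightarrow> L f" "(\<lambda>i. M (F i)) \<longlonglongrightarrow> M f"
    using L M lim(1) by (auto simp: sigma_functional_def)
  then show ?case
    using lim(2) LIMSEQ_unique by simp
qed (use L M eq in \<open>auto simp: sigma_functional_def\<close>)

text \<open>A representation of Daniell type: the measure of \<open>A\<close> is the value at its
  indicator, and continuity under bounded limits, applied to partial sums of indicators of disjoint
  sets, is countable additivity. Convolutions and translates are obtained this way.\<close>

lemma sigma_functional_represented:
  assumes L: "sigma_functional L"
  obtains \<kappa> where "\<And>h. integrand h \<Longrightarrow> rint \<kappa> h = L h"
proof -
  define \<phi> where "\<phi> A = (if A \<in> bounded_borel then L (indicator A) else 0)" for A
  have L_lin: "L (\<lambda>t. c * f t + g t) = c * L f + L g" if "integrand f" "integrand g" for c f g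
    using L that by (simp add: sigma_functional_def)
  have L0: "L (\<lambda>_. 0) = 0"
    using L_lin[of "\<lambda>_. 0" "\<lambda>_. 0" "-1"] by simp
  have L_sum: "L (\<lambda>t. \<Sum>i\<in>I. f i t) = (\<Sum>i\<in>I. L (f i))"
    if "finite I" "\<And>i. i \<in> I \<Longrightarrow> integrand (f i)" for I :: "nat set" and f
    using that L_lin[where c = 1] by (induction I rule: finite_induct) (auto simp: L0 integrand_sum)
  have "locally_additive \<phi>"
    unfolding locally_additive_def
  proof (intro allI impI)
    fix F :: "nat \<Rightarrow> real set"
    assume F: "range F \<subseteq> bounded_borel" "disjoint_family F" "\<Union>(range F) \<in> bounded_borel"
    have Fi: "F i \<in> bounded_borel" for i
      using F(1) by auto
    obtain T where T: "\<Union>(range F) \<subseteq> {0..T}"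
      using F(3) by (rule bounded_borel_bound)
    have ev: "(\<Sum>i<n. indicator (F i) t) = (indicator (\<Union>i<n. F i) t :: complex)" for n t
      using F(2) by (subst indicator_UN_disjoint) (auto simp: disjoint_family_on_def)
    have "bounded_limit (\<lambda>n t. \<Sum>i<n. indicator (F i) t) (indicator (\<Union>(range F)))"
    proof (rule bounded_limitI[of _ 1 T])
      show "integrand (\<lambda>t. \<Sum>i<n. indicator (F i) t)" for n
        using Fi by (intro integrand_sum) auto
      show "cmod (\<Sum>i<n. indicator (F i) t) \<le> 1" for n t
        unfolding ev by (simp add: indicator_def)
      show "(\<Sum>i<n. indicator (F i) t) = (0::complex)" if "T < t" for n t
        unfolding ev using T that by (force simp: indicator_def)
      show "(\<lambda>n. \<Sum>i<n. indicator (F i) t) \<longlonglongrightarrow> (indicator (\<Union>(range F)) t :: complex)" for t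
        unfolding ev by (rule LIMSEQ_indicator_UN)
    qed
    then have "(\<lambda>n. L (\<lambda>t. \<Sum>i<n. indicator (F i) t)) \<longlonglongrightarrow> L (indicator (\<Union>(range F)))"
      using L by (simp add: sigma_functional_def)
    moreover have "L (\<lambda>t. \<Sum>i<n. indicator (F i) t) = (\<Sum>i<n. \<phi> (F i))" for n
      using Fi by (subst L_sum) (auto simp: \<phi>_def)
    ultimately show "(\<lambda>i. \<phi> (F i)) sums \<phi> (\<Union>(range F))"
      using F(3) by (simp add: sums_def \<phi>_def)
  qed
  then have \<kappa>: "mloc_fun (Abs_mloc \<phi>) = \<phi>"
    by (intro Abs_mloc_inverse) (simp add: \<phi>_def)
  show ?thesis
  proof (rule that[of "Abs_mloc \<phi>"])
    fix h
    assume h: "integrand h"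
    show "rint (Abs_mloc \<phi>) h = L h"
    proof (rule sigma_functional_unique[OF sigma_functional_rint L _ h])
      fix A
      assume "A \<in> bounded_borel"
      then show "rint (Abs_mloc \<phi>) (indicator A) = L (indicator A)"
        by (simp add: rint_indicator \<kappa> \<phi>_def)
    qed
  qed
qed

lemma sigma_functional_lin:
  assumes "sigma_functional L" "sigma_functional M"
  shows "sigma_functional (\<lambda>h. c * L h + M h)"
  using assms unfolding sigma_functional_def by (auto simp: algebra_simps intro!: tendsto_intros)

text \<open>The Jordan parts of a sum are in general not the sums of the Jordan parts, so additivity
  in the measure comes from uniqueness: both sides agree on indicators.\<close>

lemma rint_plus: "integrand h \<Longrightarrow> rint (\<mu> + \<nu>) h = rint \<mu> h + rint \<nu> h"
  using sigma_functional_unique[OF sigma_functional_rint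
      sigma_functional_lin[OF sigma_functional_rint sigma_functional_rint], of "\<mu> + \<nu>" 1 \<mu> \<nu> h]
  by (simp add: rint_indicator plus_mloc.rep_eq)

lemma rint_minus: "integrand h \<Longrightarrow> rint (\<mu> - \<nu>) h = rint \<mu> h - rint \<nu> h"
  using rint_plus[of h "\<mu> - \<nu>" \<nu>] by simp

lemma rint_0_mloc: "integrand h \<Longrightarrow> rint 0 h = 0"
  using rint_minus[of h 0 0] by simp

lemma rint_scale_mloc: "integrand h \<Longrightarrow> rint (scale_mloc c \<mu>) h = c * rint \<mu> h"
  using sigma_functional_unique[OF sigma_functional_rint
      sigma_functional_lin[OF sigma_functional_rint sigma_functional_rint], of "scale_mloc c \<mu>" c \<mu> 0 h]
  by (simp add: rint_indicator scale_mloc.rep_eq zero_mloc.rep_eq rint_0_mloc)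

lemma rint_sum_mloc: "integrand h \<Longrightarrow> rint (\<Sum>i\<in>I. \<nu> i) h = (\<Sum>i\<in>I. rint (\<nu> i) h)"
  by (induction I rule: infinite_finite_induct) (auto simp: rint_0_mloc rint_plus)

section \<open>Continuous test functions determine a Radon measure\<close>

lemma test_function_integrand:
  assumes "test_function h"
  shows "integrand h"
proof -
  have cont: "continuous_on {0..} h"
    using assms by (simp add: test_function_def)
  obtain T where T: "\<And>t. T < t \<Longrightarrow> h t = 0"
    using assms by (auto simp: test_function_def)
  have "compact (h ` {0..T})"
    using cont by (intro compact_continuous_image) (auto intro: continuous_on_subset)
  then obtain K where K: "\<And>t. t \<in> {0..T} \<Longrightarrow> cmod (h t) \<le> K"
    by (meson bounded_iff compact_imp_bounded imageI)
  show ?thesis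
  proof (rule integrandI[of _ "max K 0" T])
    show "(\<lambda>t. indicator {0..} t *\<^sub>R h t) \<in> borel_measurable borel"
      using cont by (intro borel_measurable_continuous_on_indicator) auto
    show "cmod (h t) \<le> max K 0" if "0 \<le> t" for t
      using K[of t] T[of t] that by (cases "t \<le> T") auto
  qed (use T in auto)
qed

text \<open>Continuous ramps decrease to the indicator of [0,b] on the half-line, so the measures
  agree on these intervals. A Dynkin argument over the generator \<open>range atMost\<close> extends
  this to Borel sets, cut at \<open>T\<close> because the measures are only locally finite.\<close>

lemma mloc_eqI_test:
  assumes eq: "\<And>h. test_function h \<Longrightarrow> rint \<kappa> h = rint \<nu> h"
  shows "\<kappa> = \<nu>"
proof -
  have Icc: "mloc_fun \<kappa> {0..b} = mloc_fun \<nu> {0..b}" for b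
  proof -
    \<comment> \<open>A ramp equal to 1 up to \<open>b\<close>, then falling with slope
      \<open>n\<close> to 0 at b + 1/n.\<close>
    define F where "F n t = complex_of_real (max 0 (min 1 (1 - real n * (t - b))))" for n t
    have cont: "continuous_on X (F n)" for X n
      unfolding F_def by (intro continuous_intros)
    have one: "F n t = 1" if "t \<le> b" for n t
      using mult_nonneg_nonpos[of "real n" "t - b"] that by (simp add: F_def min_def)
    have F0: "F n t = 0" if "b + 1 < t" "0 < n" for n t
    proof -
      have "1 * 1 \<le> real n * (t - b)"
        using that by (intro mult_mono) auto
      then show ?thesis
        by (simp add: F_def max_def)
    qed
    \<comment> \<open>\<open>F 0\<close> is constantly 1 and has no bounded support, hence the index
      \<open>Suc n\<close>.\<close>
    have test: "test_function (F (Suc n))" for n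
      using cont F0[of _ "Suc n"] unfolding test_function_def by blast
    have "bounded_limit (\<lambda>n. F (Suc n)) (indicator {0..b})"
    proof (rule bounded_limitI[of _ 1 "b + 1"])
      show "(\<lambda>n. F (Suc n) t) \<longlonglongrightarrow> indicator {0..b} t" if "0 \<le> t" for t
      proof (cases "t \<le> b")
        case True
        then show ?thesis
          using one that by simp
      next
        case False
        then obtain N where N: "1 < real N * (t - b)"
          using reals_Archimedean3[of "t - b"] by auto
        have "F (Suc n) t = 0" if "N \<le> n" for n
        proof -
          have "real N * (t - b) \<le> real (Suc n) * (t - b)"
            using that False by (intro mult_right_mono) auto
          then have "1 - real (Suc n) * (t - b) \<le> 0"
            using N by linarith
          then show ?thesis
            unfolding F_def by (simp only: max_def min_def) simp
        qed
        then have "\<forall>\<^sub>F n in sequentially. F (Suc n) t = indicator {0..b} t"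
          using False by (auto simp: eventually_sequentially)
        then show ?thesis
          by (rule tendsto_eventually)
      qed
      show "cmod (F (Suc n) t) \<le> 1" for n t
        by (simp add: F_def)
    qed (use test F0 in \<open>auto intro: test_function_integrand\<close>)
    then have "(\<lambda>n. rint \<kappa> (F (Suc n))) \<longlonglongrightarrow> rint \<kappa> (indicator {0..b})"
      "(\<lambda>n. rint \<nu> (F (Suc n))) \<longlonglongrightarrow> rint \<nu> (indicator {0..b})"
      by (rule rint_tendsto)+
    then show ?thesis
      using eq[OF test] LIMSEQ_unique by (simp add: rint_indicator)
  qed
  have bb: "A \<inter> {0..T} \<in> bounded_borel" if "A \<in> sets borel" for A and T :: real
    by (rule bounded_borel_subset[of "{0..T}"]) (use that in auto)
  have main: "mloc_fun \<kappa> (A \<inter> {0..T}) = mloc_fun \<nu> (A \<inter> {0..T})" if "A \<in> sets borel" for A T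
  proof -
    have "Int_stable (range atMost :: real set set)"
      by (auto simp: Int_stable_def)
    moreover have "(range atMost :: real set set) \<subseteq> Pow UNIV"
      by simp
    moreover have "A \<in> sigma_sets UNIV (range atMost :: real set set)"
      using that by (simp add: borel_eq_atMost)
    ultimately show ?thesis
    proof (induction A rule: sigma_sets_induct_disjoint)
      case (basic A)
      then obtain a where "A = {..a}"
        by auto
      then have "A \<inter> {0..T} = {0..min a T}"
        by auto
      then show ?case
        using Icc by simp
    next
      case empty
      show ?case
        using Icc[of "-1"] by simp
    next
      case (compl A)
      have A: "A \<in> sets borel"
        using compl(1) by (simp add: borel_eq_atMost)
      have "mloc_fun \<xi> ((UNIV - A) \<inter> {0..T}) = mloc_fun \<xi> {0..T} - mloc_fun \<xi> (A \<inter> {0..T})" for \<xi>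
      proof -
        have "rint \<xi> (indicator ((UNIV - A) \<inter> {0..T})) = rint \<xi> (\<lambda>t. indicator {0..T} t - indicator (A \<inter> {0..T}) t)"
          by (rule rint_cong) (auto simp: indicator_def)
        then show ?thesis
          using bb[of A T] bb[of "UNIV - A" T] A by (simp add: rint_diff rint_indicator)
      qed
      then show ?case
        using Icc compl by simp
    next
      case (union A)
      have A: "A i \<in> sets borel" for i
        using union(2) by (auto simp: borel_eq_atMost)
      have eqU: "(\<Union>(range A)) \<inter> {0..T} = (\<Union>i. A i \<inter> {0..T})"
        by auto
      have sums: "(\<lambda>i. mloc_fun \<xi> (A i \<inter> {0..T})) sums mloc_fun \<xi> (\<Union>i. A i \<inter> {0..T})" for \<xi>
      proof (rule locally_additive_mloc_fun[unfolded locally_additive_def, rule_format])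
        show "range (\<lambda>i. A i \<inter> {0..T}) \<subseteq> bounded_borel"
          using bb[OF A] by auto
        show "disjoint_family (\<lambda>i. A i \<inter> {0..T})"
          using union(1) by (auto simp: disjoint_family_on_def)
        have "(\<Union>(range A)) \<inter> {0..T} \<in> bounded_borel"
          using A by (intro bb) auto
        then show "(\<Union>i. A i \<inter> {0..T}) \<in> bounded_borel"
          unfolding eqU .
      qed
      then show ?case
        unfolding eqU using sums[of \<kappa>] sums[of \<nu>] by (simp only: union(3) sums_unique2)
    qed
  qed
  show ?thesis
  proof (rule mloc_fun_eqI)
    fix A
    assume A: "A \<in> bounded_borel"
    then obtain T where "A \<subseteq> {0..T}"
      by (rule bounded_borel_bound)
    then have "A \<inter> {0..T} = A"
      by auto
    then show "mloc_fun \<kappa> A = mloc_fun \<nu> A"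
      using main[of A T] A by (simp add: bounded_borel_def)
  qed
qed

section \<open>Convolution and multiplication by the coordinate\<close>

text \<open>Joint measurability refers to the Borel product and not to particular measures, so one
  condition serves all pairs of Jordan parts.\<close>

definition integrand2 :: "(real \<Rightarrow> real \<Rightarrow> complex) \<Rightarrow> bool" where
  "integrand2 H \<longleftrightarrow>
     (\<lambda>x. indicator ({0..} \<times> {0..}) x *\<^sub>R H (fst x) (snd x)) \<in> borel_measurable (borel \<Otimes>\<^sub>M borel) \<and>
     (\<exists>K T. \<forall>t\<ge>0. \<forall>s\<ge>0. cmod (H t s) \<le> K \<and> (T < t \<or> T < s \<longrightarrow> H t s = 0))"

lemma integrand2E:
  assumes "integrand2 H"
  obtains K T where "0 \<le> K" "0 \<le> T" "\<And>t s. 0 \<le> t \<Longrightarrow> 0 \<le> s \<Longrightarrow> cmod (H t s) \<le> K"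
    "\<And>t s. 0 \<le> t \<Longrightarrow> 0 \<le> s \<Longrightarrow> T < t \<or> T < s \<Longrightarrow> H t s = 0"
proof -
  obtain K T where KT: "\<And>t s. 0 \<le> t \<Longrightarrow> 0 \<le> s \<Longrightarrow> cmod (H t s) \<le> K \<and> (T < t \<or> T < s \<longrightarrow> H t s = 0)"
    using assms unfolding integrand2_def by blast
  show ?thesis
    by (rule that[of "max 0 K" "max 0 T"]) (use KT in \<open>auto simp: le_max_iff_disj\<close>)
qed

lemma integrand2_section:
  assumes "integrand2 H" "0 \<le> t"
  shows "integrand (H t)"
proof -
  obtain K T where KT: "\<And>t s. 0 \<le> t \<Longrightarrow> 0 \<le> s \<Longrightarrow> cmod (H t s) \<le> K"
    "\<And>t s. 0 \<le> t \<Longrightarrow> 0 \<le> s \<Longrightarrow> T < t \<or> T < s \<Longrightarrow> H t s = 0"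
    using assms(1) by (rule integrand2E) blast
  show ?thesis
  proof (rule integrandI)
    have "(\<lambda>x. indicator ({0..} \<times> {0..}) x *\<^sub>R H (fst x) (snd x)) \<in> borel_measurable (borel \<Otimes>\<^sub>M borel)"
      using assms(1) by (simp add: integrand2_def)
    then have "(\<lambda>s. indicator ({0..} \<times> {0..}) (t, s) *\<^sub>R H (fst (t, s)) (snd (t, s))) \<in> borel_measurable borel"
      by (rule measurable_Pair2) simp
    also have "(\<lambda>s. indicator ({0..} \<times> {0..}) (t, s) *\<^sub>R H (fst (t, s)) (snd (t, s))) =
        (\<lambda>s. indicator {0..} s *\<^sub>R H t s)"
      using assms(2) by (auto simp: fun_eq_iff indicator_def)
    finally show "(\<lambda>s. indicator {0..} s *\<^sub>R H t s) \<in> borel_measurable borel" .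
  qed (use KT assms(2) in auto)
qed

lemma integrand_rint:
  assumes H: "integrand2 H"
  shows "integrand (\<lambda>t. rint \<mu> (H t))"
proof -
  obtain K T where K: "0 \<le> K" "\<And>t s. 0 \<le> t \<Longrightarrow> 0 \<le> s \<Longrightarrow> cmod (H t s) \<le> K"
    and T: "0 \<le> T" "\<And>t s. 0 \<le> t \<Longrightarrow> 0 \<le> s \<Longrightarrow> T < t \<or> T < s \<Longrightarrow> H t s = 0"
    using H by (rule integrand2E) blast
  show ?thesis
  proof (rule integrandI[of _ "K * mass \<mu> {0..T}" T])
    have [measurable]: "(\<lambda>x. indicator ({0..} \<times> {0..}) x *\<^sub>R H (fst x) (snd x)) \<in> borel_measurable (borel \<Otimes>\<^sub>M borel)"
      using H by (simp add: integrand2_def)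
    have "(\<lambda>t. LINT s|jordan_part \<mu> k. indicator ({0..} \<times> {0..}) (t, s) *\<^sub>R H t s) \<in> borel_measurable borel" for k
    proof (rule sigma_finite_measure.borel_measurable_lebesgue_integral[OF sigma_finite_jordan_part])
      have eq: "sets (borel \<Otimes>\<^sub>M jordan_part \<mu> k) = sets (borel \<Otimes>\<^sub>M (borel :: real measure))"
        by (intro sets_pair_measure_cong) auto
      show "(\<lambda>(t, s). indicator ({0..} \<times> {0..}) (t, s) *\<^sub>R H t s) \<in> borel_measurable (borel \<Otimes>\<^sub>M jordan_part \<mu> k)"
        unfolding measurable_cong_sets[OF eq refl] by (simp add: case_prod_beta')
    qed
    then have "(\<lambda>t. \<Sum>k<4. \<i> ^ k * (LINT s|jordan_part \<mu> k. indicator ({0..} \<times> {0..}) (t, s) *\<^sub>R H t s)) \<in> borel_measurable borel"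
      by measurable
    also have "(\<lambda>t. \<Sum>k<4. \<i> ^ k * (LINT s|jordan_part \<mu> k. indicator ({0..} \<times> {0..}) (t, s) *\<^sub>R H t s)) =
        (\<lambda>t. indicator {0..} t *\<^sub>R rint \<mu> (H t))"
    proof
      fix t
      show "(\<Sum>k<4. \<i> ^ k * (LINT s|jordan_part \<mu> k. indicator ({0..} \<times> {0..}) (t, s) *\<^sub>R H t s)) =
        indicator {0..} t *\<^sub>R rint \<mu> (H t)"
        unfolding rint_altdef set_lebesgue_integral_def
        by (cases "0 \<le> t") (auto simp: indicator_def intro!: sum.cong Bochner_Integration.integral_cong)
    qed
    finally show "(\<lambda>t. indicator {0..} t *\<^sub>R rint \<mu> (H t)) \<in> borel_measurable borel" .
    show "cmod (rint \<mu> (H t)) \<le> K * mass \<mu> {0..T}" if "0 \<le> t" for t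
      by (rule rint_bound[OF integrand2_section[OF H that]]) (use K T that in auto)
    show "rint \<mu> (H t) = 0" if "0 \<le> t" "T < t" for t
      using rint_cong[of "H t" "\<lambda>_. 0" \<mu>] T that by simp
  qed
qed

text \<open>Fubini for each of the sixteen pairs of Jordan parts: the integrand is bounded and lives
  on the square [0,T]^2, which has finite product measure. Commutativity of convolution rests on
  this.\<close>

lemma rint_swap:
  assumes H: "integrand2 H"
  shows "rint \<nu> (\<lambda>t. rint \<mu> (H t)) = rint \<mu> (\<lambda>s. rint \<nu> (\<lambda>t. H t s))"
proof -
  define G where "G = (\<lambda>t s. indicator ({0..} \<times> {0..}) (t, s) *\<^sub>R H t s)"
  obtain K T where K: "0 \<le> K" "\<And>t s. 0 \<le> t \<Longrightarrow> 0 \<le> s \<Longrightarrow> cmod (H t s) \<le> K"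
    and T: "0 \<le> T" "\<And>t s. 0 \<le> t \<Longrightarrow> 0 \<le> s \<Longrightarrow> T < t \<or> T < s \<Longrightarrow> H t s = 0"
    using H by (rule integrand2E) blast
  have GK: "cmod (G t s) \<le> K" for t s
    using K by (auto simp: G_def indicator_def)
  have GT: "G t s = 0" if "(t, s) \<notin> {0..T} \<times> {0..T}" for t s
    using T(2)[of t s] that by (cases "0 \<le> t \<and> 0 \<le> s") (auto simp: G_def not_le)
  have m: "(\<lambda>(t, s). G t s) \<in> borel_measurable (borel \<Otimes>\<^sub>M borel)"
    using H by (simp add: integrand2_def G_def case_prod_beta')
  have pair: "integrable (jordan_part \<nu> j \<Otimes>\<^sub>M jordan_part \<mu> k) (\<lambda>(t, s). G t s)"
    and pair_sigma: "pair_sigma_finite (jordan_part \<nu> j) (jordan_part \<mu> k)" for j k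
  proof -
    show "pair_sigma_finite (jordan_part \<nu> j) (jordan_part \<mu> k)"
      by (simp add: pair_sigma_finite_def sigma_finite_jordan_part)
    then interpret pair_sigma_finite "jordan_part \<nu> j" "jordan_part \<mu> k" .
    have eq: "sets (jordan_part \<nu> j \<Otimes>\<^sub>M jordan_part \<mu> k) = sets (borel \<Otimes>\<^sub>M borel)"
      by (intro sets_pair_measure_cong) auto
    show "integrable (jordan_part \<nu> j \<Otimes>\<^sub>M jordan_part \<mu> k) (\<lambda>(t, s). G t s)"
    proof (rule integrableI_bounded_set[of "{0..T} \<times> {0..T}" _ _ K])
      show "(\<lambda>(t, s). G t s) \<in> borel_measurable (jordan_part \<nu> j \<Otimes>\<^sub>M jordan_part \<mu> k)"
        unfolding measurable_cong_sets[OF eq refl] by (rule m)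
      have "emeasure (jordan_part \<nu> j \<Otimes>\<^sub>M jordan_part \<mu> k) ({0..T} \<times> {0..T}) =
          emeasure (jordan_part \<nu> j) {0..T} * emeasure (jordan_part \<mu> k) {0..T}"
        by (intro M2.emeasure_pair_measure_Times) auto
      also have "\<dots> < \<infinity>"
        using emeasure_jordan_part_finite[of "{0..T}" \<nu> j] emeasure_jordan_part_finite[of "{0..T}" \<mu> k]
        by (simp add: ennreal_mult_less_top)
      finally show "emeasure (jordan_part \<nu> j \<Otimes>\<^sub>M jordan_part \<mu> k) ({0..T} \<times> {0..T}) < \<infinity>" .
      show "{0..T} \<times> {0..T} \<in> sets (jordan_part \<nu> j \<Otimes>\<^sub>M jordan_part \<mu> k)"
        by (intro pair_measureI) auto
      show "AE x in jordan_part \<nu> j \<Otimes>\<^sub>M jordan_part \<mu> k. x \<in> {0..T} \<times> {0..T} \<longrightarrow>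
          norm (case x of (t, s) \<Rightarrow> G t s) \<le> K"
        using GK by (intro AE_I2) auto
      show "AE x in jordan_part \<nu> j \<Otimes>\<^sub>M jordan_part \<mu> k. x \<notin> {0..T} \<times> {0..T} \<longrightarrow>
          (case x of (t, s) \<Rightarrow> G t s) = 0"
      proof (intro AE_I2 impI)
        show "(case x of (t, s) \<Rightarrow> G t s) = 0" if "x \<notin> {0..T} \<times> {0..T}" for x
          using GT[of "fst x" "snd x"] that by (cases x) simp
      qed
    qed
  qed
  note int1 = pair_sigma_finite.integrable_fst[OF pair_sigma pair]
  note int2 = pair_sigma_finite.integrable_snd[OF pair_sigma pair]
  note swap = pair_sigma_finite.Fubini_integral[OF pair_sigma pair]
  have "rint \<nu> (\<lambda>t. rint \<mu> (H t)) = (\<Sum>j<4. \<i> ^ j * (LINT t|jordan_part \<nu> j. (\<Sum>k<4. \<i> ^ k * (LINT s|jordan_part \<mu> k. G t s))))"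
    unfolding rint_altdef set_lebesgue_integral_def
    by (intro sum.cong arg_cong2[where f = "(*)"] Bochner_Integration.integral_cong refl)
      (auto simp: G_def indicator_def intro!: sum.cong Bochner_Integration.integral_cong)
  also have "\<dots> = (\<Sum>j<4. \<Sum>k<4. \<i> ^ j * \<i> ^ k * (LINT t|jordan_part \<nu> j. LINT s|jordan_part \<mu> k. G t s))"
    by (simp add: int1 sum_distrib_left mult.assoc)
  also have "\<dots> = (\<Sum>k<4. \<Sum>j<4. \<i> ^ k * \<i> ^ j * (LINT s|jordan_part \<mu> k. LINT t|jordan_part \<nu> j. G t s))"
    by (subst sum.swap) (simp add: swap mult.commute)
  also have "\<dots> = (\<Sum>k<4. \<i> ^ k * (LINT s|jordan_part \<mu> k. (\<Sum>j<4. \<i> ^ j * (LINT t|jordan_part \<nu> j. G t s))))"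
    by (simp add: int2 sum_distrib_left mult.assoc)
  also have "\<dots> = rint \<mu> (\<lambda>s. rint \<nu> (\<lambda>t. H t s))"
    unfolding rint_altdef set_lebesgue_integral_def
    by (intro sum.cong arg_cong2[where f = "(*)"] Bochner_Integration.integral_cong refl)
      (auto simp: G_def indicator_def intro!: sum.cong Bochner_Integration.integral_cong)
  finally show ?thesis .
qed

text \<open>On the half-line t + s \<le> T bounds both summands, so bounded support survives in two
  variables. This is why arbitrary locally finite measures can be convolved.\<close>

lemma integrand2_shift:
  assumes "integrand h"
  shows "integrand2 (\<lambda>t s. h (t + s))"
proof -
  obtain K T where KT: "\<And>t. 0 \<le> t \<Longrightarrow> cmod (h t) \<le> K" "\<And>t. 0 \<le> t \<Longrightarrow> T < t \<Longrightarrow> h t = 0"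
    using assms by (rule integrandE) blast
  define g where "g = (\<lambda>t. indicator {0..} t *\<^sub>R h t)"
  have [measurable]: "g \<in> borel_measurable borel"
    using assms by (simp add: g_def integrand_def)
  have "(\<lambda>x::real \<times> real. indicator {0..} (fst x) *\<^sub>R indicator {0..} (snd x) *\<^sub>R g (fst x + snd x))
      \<in> borel_measurable (borel \<Otimes>\<^sub>M borel)"
    by measurable
  also have "(\<lambda>x::real \<times> real. indicator {0..} (fst x) *\<^sub>R indicator {0..} (snd x) *\<^sub>R g (fst x + snd x)) =
      (\<lambda>x. indicator ({0..} \<times> {0..}) x *\<^sub>R h (fst x + snd x))"
    by (auto simp: fun_eq_iff indicator_def g_def)
  finally show ?thesis
    unfolding integrand2_def using KT
    by (intro conjI exI[of _ K] exI[of _ T] allI impI) (auto simp: add_increasing add_increasing2)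
qed

lemma integrand_shift: "integrand h \<Longrightarrow> 0 \<le> t \<Longrightarrow> integrand (\<lambda>s. h (t + s))"
  by (rule integrand2_section[OF integrand2_shift])

lemma bounded_limit_shift:
  assumes "bounded_limit F f" "0 \<le> t"
  shows "bounded_limit (\<lambda>i s. F i (t + s)) (\<lambda>s. f (t + s))"
proof -
  obtain K T where "\<And>i t. 0 \<le> t \<Longrightarrow> cmod (F i t) \<le> K" "\<And>i t. 0 \<le> t \<Longrightarrow> T < t \<Longrightarrow> F i t = 0"
    using assms(1) by (rule bounded_limitE) blast
  then show ?thesis
    using assms by (intro bounded_limitI[of _ K T]) (auto simp: bounded_limit_def integrand_shift)
qed

lemma sigma_functional_conv: "sigma_functional (\<lambda>h. rint \<nu> (\<lambda>t. rint \<mu> (\<lambda>s. h (t + s))))"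
  unfolding sigma_functional_def
proof (intro conjI allI impI)
  fix c f g
  assume f: "integrand f" and g: "integrand g"
  have "rint \<nu> (\<lambda>t. rint \<mu> (\<lambda>s. c * f (t + s) + g (t + s))) =
      rint \<nu> (\<lambda>t. c * rint \<mu> (\<lambda>s. f (t + s)) + rint \<mu> (\<lambda>s. g (t + s)))"
    by (rule rint_cong) (simp add: rint_lin integrand_shift f g)
  then show "rint \<nu> (\<lambda>t. rint \<mu> (\<lambda>s. c * f (t + s) + g (t + s))) =
      c * rint \<nu> (\<lambda>t. rint \<mu> (\<lambda>s. f (t + s))) + rint \<nu> (\<lambda>t. rint \<mu> (\<lambda>s. g (t + s)))"
    by (simp add: rint_lin integrand_rint integrand2_shift f g)
next
  fix F f
  assume lim: "bounded_limit F f"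
  obtain K T where K: "0 \<le> K" "\<And>i t. 0 \<le> t \<Longrightarrow> cmod (F i t) \<le> K"
    and T: "0 \<le> T" "\<And>i t. 0 \<le> t \<Longrightarrow> T < t \<Longrightarrow> F i t = 0"
    using lim by (rule bounded_limitE) blast
  have F: "integrand (F i)" for i
    using lim by (simp add: bounded_limit_def)
  have "bounded_limit (\<lambda>i t. rint \<mu> (\<lambda>s. F i (t + s))) (\<lambda>t. rint \<mu> (\<lambda>s. f (t + s)))"
  proof (rule bounded_limitI[of _ "K * mass \<mu> {0..T}" T])
    show "integrand (\<lambda>t. rint \<mu> (\<lambda>s. F i (t + s)))" for i
      by (intro integrand_rint integrand2_shift F)
    show "cmod (rint \<mu> (\<lambda>s. F i (t + s))) \<le> K * mass \<mu> {0..T}" if "0 \<le> t" for i t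
      by (rule rint_bound) (use K T that in \<open>auto intro: integrand_shift F\<close>)
    show "rint \<mu> (\<lambda>s. F i (t + s)) = 0" if "0 \<le> t" "T < t" for i t
      using rint_cong[of "\<lambda>s. F i (t + s)" "\<lambda>_. 0" \<mu>] T that by simp
    show "(\<lambda>i. rint \<mu> (\<lambda>s. F i (t + s))) \<longlonglongrightarrow> rint \<mu> (\<lambda>s. f (t + s))" if "0 \<le> t" for t
      by (intro rint_tendsto bounded_limit_shift lim that)
  qed
  then show "(\<lambda>i. rint \<nu> (\<lambda>t. rint \<mu> (\<lambda>s. F i (t + s)))) \<longlonglongrightarrow> rint \<nu> (\<lambda>t. rint \<mu> (\<lambda>s. f (t + s)))"
    by (rule rint_tendsto)
qed

text \<open>The definite description in \<open>conv_mloc\<close> mentions only test functions. A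
  representing measure exists by \<open>sigma_functional_represented\<close>, is unique by
  \<open>mloc_eqI_test\<close>, and satisfies the formula for Borel integrands as well, so
  indicators of null sets may be inserted.\<close>

lemma rint_conv:
  assumes h: "integrand h"
  shows "rint (conv_mloc \<nu> \<mu>) h = rint \<nu> (\<lambda>t. rint \<mu> (\<lambda>s. h (t + s)))"
proof -
  obtain \<kappa> where \<kappa>: "\<And>h. integrand h \<Longrightarrow> rint \<kappa> h = rint \<nu> (\<lambda>t. rint \<mu> (\<lambda>s. h (t + s)))"
    using sigma_functional_represented[OF sigma_functional_conv] by blast
  have "conv_mloc \<nu> \<mu> = \<kappa>"
    unfolding conv_mloc_def rint_def[symmetric]
  proof (rule the_equality)
    show "\<forall>h. test_function h \<longrightarrow> rint \<kappa> h = rint \<nu> (\<lambda>t. rint \<mu> (\<lambda>s. h (t + s)))"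
      using \<kappa> test_function_integrand by blast
    show "\<xi> = \<kappa>" if "\<forall>h. test_function h \<longrightarrow> rint \<xi> h = rint \<nu> (\<lambda>t. rint \<mu> (\<lambda>s. h (t + s)))" for \<xi>
      using that by (intro mloc_eqI_test) (simp add: \<kappa> test_function_integrand)
  qed
  then show ?thesis
    using \<kappa>[OF h] by simp
qed

lemma conv_mloc_commute: "conv_mloc \<nu> \<mu> = conv_mloc \<mu> \<nu>"
proof (rule mloc_eqI)
  fix h
  assume h: "integrand h"
  then show "rint (conv_mloc \<nu> \<mu>) h = rint (conv_mloc \<mu> \<nu>) h"
    using rint_swap[OF integrand2_shift[OF h], of \<nu> \<mu>] by (simp add: rint_conv add.commute)
qed

lemma conv_mloc_assoc: "conv_mloc (conv_mloc \<kappa> \<nu>) \<mu> = conv_mloc \<kappa> (conv_mloc \<nu> \<mu>)"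
proof (rule mloc_eqI)
  fix h
  assume h: "integrand h"
  have "rint (conv_mloc \<kappa> (conv_mloc \<nu> \<mu>)) h = rint \<kappa> (\<lambda>t. rint \<nu> (\<lambda>s. rint \<mu> (\<lambda>u. h (t + (s + u)))))"
    by (subst rint_conv[OF h], rule rint_cong, subst rint_conv) (auto intro: integrand_shift h)
  then show "rint (conv_mloc (conv_mloc \<kappa> \<nu>) \<mu>) h = rint (conv_mloc \<kappa> (conv_mloc \<nu> \<mu>)) h"
    by (simp add: rint_conv integrand_rint integrand2_shift h add.assoc)
qed

lemma conv_mloc_add_left: "conv_mloc (\<kappa> + \<nu>) \<mu> = conv_mloc \<kappa> \<mu> + conv_mloc \<nu> \<mu>"
  by (rule mloc_eqI) (simp add: rint_conv rint_plus integrand_rint integrand2_shift)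

lemma conv_mloc_scale_left: "conv_mloc (scale_mloc c \<nu>) \<mu> = scale_mloc c (conv_mloc \<nu> \<mu>)"
  by (rule mloc_eqI) (simp add: rint_conv rint_scale_mloc integrand_rint integrand2_shift)

lemma integrand_X:
  assumes "integrand h"
  shows "integrand (\<lambda>t. of_real t * h t)"
proof -
  obtain K T where KT: "0 \<le> K" "0 \<le> T" "\<And>t. 0 \<le> t \<Longrightarrow> cmod (h t) \<le> K" "\<And>t. 0 \<le> t \<Longrightarrow> T < t \<Longrightarrow> h t = 0"
    using assms by (rule integrandE) blast
  show ?thesis
  proof (rule integrandI[of _ "T * K" T])
    have "(\<lambda>t. of_real t * (indicator {0..} t *\<^sub>R h t)) \<in> borel_measurable borel"
      using integrand_measurable[OF assms] by measurable
    then show "(\<lambda>t. indicator {0..} t *\<^sub>R (of_real t * h t)) \<in> borel_measurable borel"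
      by (simp add: algebra_simps)
    show "cmod (of_real t * h t) \<le> T * K" if "0 \<le> t" for t
      using KT that by (cases "t \<le> T") (auto simp: norm_mult intro!: mult_mono)
  qed (use KT in auto)
qed

text \<open>\<open>X_mloc\<close> is specified by its values on sets; agreement on indicators
  propagates to all integrands.\<close>

lemma rint_X:
  assumes h: "integrand h"
  shows "rint (X_mloc \<nu>) h = rint \<nu> (\<lambda>t. of_real t * h t)"
proof (rule sigma_functional_unique[OF sigma_functional_rint _ _ h])
  show "sigma_functional (\<lambda>h. rint \<nu> (\<lambda>t. of_real t * h t))"
    unfolding sigma_functional_def
  proof (intro conjI allI impI)
    fix c f g
    assume "integrand f" "integrand g"
    then show "rint \<nu> (\<lambda>t. of_real t * (c * f t + g t)) =
        c * rint \<nu> (\<lambda>t. of_real t * f t) + rint \<nu> (\<lambda>t. of_real t * g t)"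
      using rint_lin[of "\<lambda>t. of_real t * f t" "\<lambda>t. of_real t * g t" \<nu> c]
      by (simp add: integrand_X algebra_simps)
  next
    fix F f
    assume lim: "bounded_limit F f"
    obtain K T where KT: "0 \<le> K" "0 \<le> T" "\<And>i t. 0 \<le> t \<Longrightarrow> cmod (F i t) \<le> K"
      "\<And>i t. 0 \<le> t \<Longrightarrow> T < t \<Longrightarrow> F i t = 0"
      using lim by (rule bounded_limitE) blast
    have "bounded_limit (\<lambda>i t. of_real t * F i t) (\<lambda>t. of_real t * f t)"
    proof (rule bounded_limitI[of _ "T * K" T])
      show "cmod (of_real t * F i t) \<le> T * K" if "0 \<le> t" for i t
        using KT that by (cases "t \<le> T") (auto simp: norm_mult intro!: mult_mono)
    qed (use KT lim in \<open>auto simp: bounded_limit_def integrand_X intro: tendsto_mult_left\<close>)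
    then show "(\<lambda>i. rint \<nu> (\<lambda>t. of_real t * F i t)) \<longlonglongrightarrow> rint \<nu> (\<lambda>t. of_real t * f t)"
      by (rule rint_tendsto)
  qed
  show "rint (X_mloc \<nu>) (indicator A) = rint \<nu> (\<lambda>t. of_real t * indicator A t)" if "A \<in> bounded_borel" for A
    unfolding rint_indicator[OF that] using that by (simp add: X_mloc.rep_eq rint_def mult.commute)
qed

lemma X_mloc_add: "X_mloc (\<kappa> + \<nu>) = X_mloc \<kappa> + X_mloc \<nu>"
  by (rule mloc_eqI) (simp add: rint_X rint_plus integrand_X)

lemma X_mloc_scale: "X_mloc (scale_mloc c \<nu>) = scale_mloc c (X_mloc \<nu>)"
  by (rule mloc_eqI) (simp add: rint_X rint_scale_mloc integrand_X)

text \<open>The product rule is the identity s h(t+s) = (t+s) h(t+s) - t h(t+s) under the double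
  pairing.\<close>

lemma X_mloc_conv: "X_mloc (conv_mloc \<kappa> \<nu>) = conv_mloc (X_mloc \<kappa>) \<nu> + conv_mloc \<kappa> (X_mloc \<nu>)"
proof (rule mloc_eqI)
  fix h
  assume h: "integrand h"
  let ?J = "\<lambda>h t. rint \<nu> (\<lambda>s. h (t + s))"
  have J: "integrand (?J h)" if "integrand h" for h
    by (intro integrand_rint integrand2_shift that)
  have "rint (conv_mloc \<kappa> (X_mloc \<nu>)) h = rint \<kappa> (\<lambda>t. rint \<nu> (\<lambda>s. of_real s * h (t + s)))"
    by (subst rint_conv[OF h], rule rint_cong, subst rint_X) (auto intro: integrand_shift h)
  also have "\<dots> = rint \<kappa> (\<lambda>t. ?J (\<lambda>t. of_real t * h t) t - of_real t * ?J h t)"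
  proof (rule rint_cong)
    fix t :: real
    assume t: "0 \<le> t"
    have "?J (\<lambda>t. of_real t * h t) t - of_real t * ?J h t =
        rint \<nu> (\<lambda>s. of_real (t + s) * h (t + s) - of_real t * h (t + s))"
      using t h integrand_shift[OF integrand_X[OF h] t]
      by (subst rint_diff) (auto intro!: integrand_scale integrand_shift simp: rint_scale[OF integrand_shift])
    then show "rint \<nu> (\<lambda>s. of_real s * h (t + s)) = ?J (\<lambda>t. of_real t * h t) t - of_real t * ?J h t"
      by (simp add: algebra_simps)
  qed
  also have "\<dots> = rint (X_mloc (conv_mloc \<kappa> \<nu>)) h - rint (conv_mloc (X_mloc \<kappa>) \<nu>) h"
    using h J[OF integrand_X[OF h]] by (subst rint_diff) (auto simp: rint_X rint_conv J integrand_X)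
  finally show "rint (X_mloc (conv_mloc \<kappa> \<nu>)) h = rint (conv_mloc (X_mloc \<kappa>) \<nu> + conv_mloc \<kappa> (X_mloc \<nu>)) h"
    using h by (simp add: rint_plus)
qed

lemma linear_mlocI:
  assumes "\<And>a b. T (a + b) = T a + T b" "\<And>c a. T (scale_mloc c a) = scale_mloc c (T a)"
  shows "Vector_Spaces.linear scale_mloc scale_mloc T"
proof -
  interpret vector_space scale_mloc
    by (rule vector_space_mloc)
  show ?thesis
    by unfold_locales (use assms in auto)
qed

lemma derivation_D_mloc: "derivation scale_mloc conv_mloc (D_mloc \<mu>)"
  unfolding derivation_def
proof (intro conjI allI)
  show "Vector_Spaces.linear scale_mloc scale_mloc (D_mloc \<mu>)"
    by (rule linear_mlocI)
      (simp_all add: D_mloc_def X_mloc_add X_mloc_scale conv_mloc_add_left conv_mloc_scale_left)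
  fix a b
  \<comment> \<open>In the first term of the product rule \<mu> has to move past \<open>b\<close> to
    reach \<open>X_mloc a\<close>; commutativity allows it.\<close>
  have "conv_mloc (conv_mloc (X_mloc a) b) \<mu> = conv_mloc (conv_mloc (X_mloc a) \<mu>) b"
    by (simp add: conv_mloc_assoc conv_mloc_commute[of b])
  then show "D_mloc \<mu> (conv_mloc a b) = conv_mloc (D_mloc \<mu> a) b + conv_mloc a (D_mloc \<mu> b)"
    by (simp add: D_mloc_def X_mloc_conv conv_mloc_add_left conv_mloc_assoc)
qed

section \<open>Absolutely continuous measures\<close>

lemma l1loc_cases:
  obtains f where "locally_integrable f" "F = abs_l1loc f"
proof -
  have "l1loc_eq (rep_l1loc F) (rep_l1loc F)" "abs_l1loc (rep_l1loc F) = F"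
    using Quotient3_rep_reflp[OF Quotient3_l1loc] Quotient3_abs_rep[OF Quotient3_l1loc] by auto
  then show ?thesis
    by (intro that[of "rep_l1loc F"]) (auto simp: l1loc_eq_def)
qed

lemma l1loc_eq_refl: "locally_integrable f \<Longrightarrow> l1loc_eq f f"
  by (simp add: l1loc_eq_def)

lemma mloc_fun_embed:
  assumes "locally_integrable f"
  shows "mloc_fun (embed (abs_l1loc f)) A = (if A \<in> bounded_borel then LINT t:A|lborel. f t else 0)"
  unfolding embed.abs_eq[OF l1loc_eq_refl[OF assms]]
  by (subst Abs_mloc_inverse) (auto intro: locally_additive_embed assms)

lemma integrable_embed:
  assumes f: "locally_integrable f" and h: "integrand h"
  shows "integrable lborel (\<lambda>t. indicator {0..} t *\<^sub>R (f t * h t))"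
proof -
  obtain K T where K: "0 \<le> K" "\<And>t. 0 \<le> t \<Longrightarrow> cmod (h t) \<le> K"
    and T: "0 \<le> T" "\<And>t. 0 \<le> t \<Longrightarrow> T < t \<Longrightarrow> h t = 0"
    using h by (rule integrandE) blast
  have F: "integrable lborel (\<lambda>t. indicator {0..T} t *\<^sub>R f t)"
    using f by (simp add: locally_integrable_def set_integrable_def)
  have eq: "indicator {0..} t *\<^sub>R (f t * h t) =
      (indicator {0..T} t *\<^sub>R f t) * (indicator {0..} t *\<^sub>R h t)" for t
    using T by (auto simp: indicator_def)
  show ?thesis
  proof (rule Bochner_Integration.integrable_bound)
    show "integrable lborel (\<lambda>t. K *\<^sub>R (indicator {0..T} t *\<^sub>R f t))"
      using F by (rule integrable_scaleR_right)
    show "(\<lambda>t. indicator {0..} t *\<^sub>R (f t * h t)) \<in> borel_measurable lborel"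
      unfolding eq using borel_measurable_integrable[OF F] integrand_measurable[OF h]
      by (intro borel_measurable_times) auto
    show "AE t in lborel. norm (indicator {0..} t *\<^sub>R (f t * h t)) \<le> norm (K *\<^sub>R (indicator {0..T} t *\<^sub>R f t))"
    proof (rule AE_I2)
      fix t :: real
      have "cmod (f t) * cmod (h t) \<le> cmod (f t) * K" if "0 \<le> t"
        using K(2)[OF that] by (intro mult_left_mono) auto
      then show "norm (indicator {0..} t *\<^sub>R (f t * h t)) \<le> norm (K *\<^sub>R (indicator {0..T} t *\<^sub>R f t))"
        unfolding eq using K(1) by (auto simp: norm_mult indicator_def mult.commute[of K])
    qed
  qed
qed

lemma sigma_functional_density:
  assumes f: "locally_integrable f"
  shows "sigma_functional (\<lambda>h. LINT t:{0..}|lborel. f t * h t)"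
  unfolding sigma_functional_def set_lebesgue_integral_def
proof (intro conjI allI impI)
  fix c g h
  assume "integrand g" "integrand h"
  note int = this[THEN integrable_embed[OF f]]
  have "(LINT t|lborel. indicator {0..} t *\<^sub>R (f t * (c * g t + h t))) =
      (LINT t|lborel. c * (indicator {0..} t *\<^sub>R (f t * g t)) + indicator {0..} t *\<^sub>R (f t * h t))"
    by (simp add: algebra_simps)
  then show "(LINT t|lborel. indicator {0..} t *\<^sub>R (f t * (c * g t + h t))) =
      c * (LINT t|lborel. indicator {0..} t *\<^sub>R (f t * g t)) + (LINT t|lborel. indicator {0..} t *\<^sub>R (f t * h t))"
    using Bochner_Integration.integral_add[OF integrable_mult_right[OF int(1), of c] int(2)]
    by (simp only: integral_mult_right_zero)
next
  fix H h
  assume lim: "bounded_limit H h"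
  obtain K T where K: "0 \<le> K" "\<And>i t. 0 \<le> t \<Longrightarrow> cmod (H i t) \<le> K"
    and T: "0 \<le> T" "\<And>i t. 0 \<le> t \<Longrightarrow> T < t \<Longrightarrow> H i t = 0"
    using lim by (rule bounded_limitE) blast
  have F: "integrable lborel (\<lambda>t. indicator {0..T} t *\<^sub>R f t)"
    using f by (simp add: locally_integrable_def set_integrable_def)
  show "(\<lambda>i. LINT t|lborel. indicator {0..} t *\<^sub>R (f t * H i t))
      \<longlonglongrightarrow> (LINT t|lborel. indicator {0..} t *\<^sub>R (f t * h t))"
  proof (rule integral_dominated_convergence)
    show "integrable lborel (\<lambda>t. K * norm (indicator {0..T} t *\<^sub>R f t))"
      using F by (intro integrable_mult_right integrable_norm)
    show "(\<lambda>t. indicator {0..} t *\<^sub>R (f t * h t)) \<in> borel_measurable lborel"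
      by (intro borel_measurable_integrable integrable_embed f integrand_bounded_limit[OF lim])
    show "(\<lambda>t. indicator {0..} t *\<^sub>R (f t * H i t)) \<in> borel_measurable lborel" for i
      using lim by (intro borel_measurable_integrable integrable_embed f) (simp add: bounded_limit_def)
    show "AE t in lborel. (\<lambda>i. indicator {0..} t *\<^sub>R (f t * H i t)) \<longlonglongrightarrow> indicator {0..} t *\<^sub>R (f t * h t)"
      using lim by (intro AE_I2) (auto simp: bounded_limit_def indicator_def intro: tendsto_mult_left)
    show "AE t in lborel. norm (indicator {0..} t *\<^sub>R (f t * H i t)) \<le> K * norm (indicator {0..T} t *\<^sub>R f t)" for i
    proof (rule AE_I2)
      fix t :: real
      show "norm (indicator {0..} t *\<^sub>R (f t * H i t)) \<le> K * norm (indicator {0..T} t *\<^sub>R f t)"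
        using K T(2)[of t i] by (cases "0 \<le> t"; cases "t \<le> T") (auto simp: norm_mult mult.commute[of K] intro!: mult_left_mono)
    qed
  qed
qed

lemma rint_embed:
  assumes f: "locally_integrable f" and h: "integrand h"
  shows "rint (embed (abs_l1loc f)) h = (LINT t:{0..}|lborel. f t * h t)"
proof (rule sigma_functional_unique[OF sigma_functional_rint sigma_functional_density[OF f] _ h])
  fix A
  assume A: "A \<in> bounded_borel"
  then have "(LINT t:A|lborel. f t) = (LINT t:{0..}|lborel. f t * indicator A t)"
    unfolding set_lebesgue_integral_def
    by (intro Bochner_Integration.integral_cong) (auto simp: bounded_borel_def indicator_def)
  then show "rint (embed (abs_l1loc f)) (indicator A) = (LINT t:{0..}|lborel. f t * indicator A t)"
    using A by (simp add: rint_indicator mloc_fun_embed[OF f])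
qed

lemma locally_integrable_lin:
  "locally_integrable f \<Longrightarrow> locally_integrable g \<Longrightarrow> locally_integrable (\<lambda>t. c * f t + g t)"
  by (simp add: locally_integrable_def)

lemma embed_add: "embed (F + G) = embed F + embed G"
proof -
  obtain f g where f: "locally_integrable f" "F = abs_l1loc f" and g: "locally_integrable g" "G = abs_l1loc g"
    using l1loc_cases[of F] l1loc_cases[of G] by metis
  show ?thesis
    using locally_integrable_lin[OF f(1) g(1), of 1] set_integrable_bounded_borel f g
    by (intro mloc_fun_eqI) (simp add: plus_l1loc.abs_eq l1loc_eq_refl mloc_fun_embed plus_mloc.rep_eq)
qed

lemma embed_scale: "embed (scale_l1loc c F) = scale_mloc c (embed F)"
proof -
  obtain f where f: "locally_integrable f" "F = abs_l1loc f"
    by (rule l1loc_cases)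
  show ?thesis
    using f locally_integrable_lin[OF f(1), of "\<lambda>_. 0" c]
    by (intro mloc_fun_eqI) (simp add: scale_l1loc.abs_eq l1loc_eq_refl mloc_fun_embed scale_mloc.rep_eq
        locally_integrable_def set_integrable_def set_integral_mult_right)
qed

lemma embed_diff: "embed (F - G) = embed F - embed G"
  using embed_add[of "F - G" G] by simp

lemma embed_0 [simp]: "embed 0 = 0"
  using embed_diff[of 0 0] by simp

lemma embed_X: "embed (X_l1loc F) = X_mloc (embed F)"
proof (rule mloc_eqI)
  fix h
  assume h: "integrand h"
  obtain f where f: "locally_integrable f" "F = abs_l1loc f"
    by (rule l1loc_cases)
  then show "rint (embed (X_l1loc F)) h = rint (X_mloc (embed F)) h"
    using h locally_integrable_X[OF f(1)]
    by (simp add: X_l1loc.abs_eq l1loc_eq_refl rint_embed rint_X integrand_X mult.assoc mult.left_commute)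
qed

text \<open>Both convolutions become the same double integral after the substitution u = t + s and
  Fubini. Cutting \<open>f\<close> and \<open>g\<close> at a bound \<open>T\<close> for the support
  of \<open>h\<close> makes them integrable on the whole line without changing the pairing.\<close>

lemma embed_conv: "embed (conv_l1loc F G) = conv_mloc (embed F) (embed G)"
proof (rule mloc_eqI)
  fix h
  assume h: "integrand h"
  obtain f g where f: "locally_integrable f" "F = abs_l1loc f" and g: "locally_integrable g" "G = abs_l1loc g"
    using l1loc_cases[of F] l1loc_cases[of G] by metis
  let ?c = "\<lambda>t. LINT s:{0..t}|lborel. f s * g (t - s)"
  have c: "locally_integrable ?c"
    by (rule locally_integrable_conv[OF f(1) g(1)])
  have FG: "conv_l1loc F G = abs_l1loc ?c"
    using f g by (simp add: conv_l1loc.abs_eq l1loc_eq_refl)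
  obtain K T where K: "0 \<le> K" "\<And>t. 0 \<le> t \<Longrightarrow> cmod (h t) \<le> K"
    and T: "0 \<le> T" "\<And>t. 0 \<le> t \<Longrightarrow> T < t \<Longrightarrow> h t = 0"
    using h by (rule integrandE) blast
  define f' where "f' = (\<lambda>s. indicator {0..T} s *\<^sub>R f s)"
  define g' where "g' = (\<lambda>s. indicator {0..T} s *\<^sub>R g s)"
  define h' where "h' = (\<lambda>s. indicator {0..} s *\<^sub>R h s)"
  have f': "integrable lborel f'" and g': "integrable lborel g'"
    using f g by (auto simp: locally_integrable_def set_integrable_def f'_def g'_def)
  have [measurable]: "f' \<in> borel_measurable borel" "g' \<in> borel_measurable borel" "h' \<in> borel_measurable borel"
    using borel_measurable_integrable[OF f'] borel_measurable_integrable[OF g'] integrand_measurable[OF h]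
    by (simp_all add: h'_def)
  have g'T: "integrable lborel (\<lambda>t. g' (t - s))" for s
    using lborel_integrable_real_affine[OF g', of 1 "- s"] by simp
  have n: "(LINT t|lborel. norm (g' (t - s))) = (LINT t|lborel. norm (g' t))" for s
    using lborel_integral_real_affine[of 1 "\<lambda>t. norm (g' t)" "- s"] by simp
  have "integrable (lborel \<Otimes>\<^sub>M lborel) (\<lambda>(s, t). f' s * g' (t - s))"
  proof (rule lborel_pair.Fubini_integrable)
    show "(\<lambda>(s, t). f' s * g' (t - s)) \<in> borel_measurable (lborel \<Otimes>\<^sub>M lborel)"
      by measurable
    show "integrable lborel (\<lambda>s. LINT t|lborel. norm (case (s, t) of (s, t) \<Rightarrow> f' s * g' (t - s)))"
      using f' by (simp add: norm_mult n)
    show "AE s in lborel. integrable lborel (\<lambda>t. case (s, t) of (s, t) \<Rightarrow> f' s * g' (t - s))"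
      using g'T by simp
  qed
  then have "integrable (lborel \<Otimes>\<^sub>M lborel) (\<lambda>x. K *\<^sub>R (case x of (s, t) \<Rightarrow> f' s * g' (t - s)))"
    by (rule integrable_scaleR_right)
  then have pair: "integrable (lborel \<Otimes>\<^sub>M lborel) (\<lambda>(s, t). f' s * g' (t - s) * h' t)"
  proof (rule Bochner_Integration.integrable_bound)
    show "(\<lambda>(s, t). f' s * g' (t - s) * h' t) \<in> borel_measurable (lborel \<Otimes>\<^sub>M lborel)"
      by measurable
    show "AE x in lborel \<Otimes>\<^sub>M lborel. norm (case x of (s, t) \<Rightarrow> f' s * g' (t - s) * h' t)
        \<le> norm (K *\<^sub>R (case x of (s, t) \<Rightarrow> f' s * g' (t - s)))"
      using K by (intro AE_I2)
        (auto simp: norm_mult h'_def indicator_def mult.commute[of K] intro!: mult_left_mono)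
  qed
  have "rint (conv_mloc (embed F) (embed G)) h = rint (embed F) (\<lambda>t. LINT s:{0..}|lborel. g s * h (t + s))"
    using h f g by (subst rint_conv[OF h], intro rint_cong) (simp add: rint_embed integrand_shift)
  also have "\<dots> = (LINT t:{0..}|lborel. f t * (LINT s:{0..}|lborel. g s * h (t + s)))"
  proof -
    have "integrand (\<lambda>t. rint (embed G) (\<lambda>s. h (t + s)))"
      by (intro integrand_rint integrand2_shift h)
    then have "integrand (\<lambda>t. LINT s:{0..}|lborel. g s * h (t + s))"
      by (rule integrand_cong) (simp add: g rint_embed integrand_shift h)
    then show ?thesis
      using f by (simp add: rint_embed)
  qed
  also have "\<dots> = (LINT t|lborel. f' t * (LINT s|lborel. g' s * h' (t + s)))"
    unfolding set_lebesgue_integral_def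
  proof (intro Bochner_Integration.integral_cong refl)
    fix t :: real
    have z: "h (t + s) = 0" if "0 \<le> t" "0 \<le> s" "T < t \<or> T < s" for s
      using T that by auto
    have "(LINT s|lborel. indicator {0..} s *\<^sub>R (g s * h (t + s))) = (LINT s|lborel. g' s * h' (t + s))" if "0 \<le> t"
      using that z by (intro Bochner_Integration.integral_cong) (auto simp: g'_def h'_def indicator_def)
    moreover have "(LINT s|lborel. indicator {0..} s *\<^sub>R (g s * h (t + s))) = 0" if "T < t" "0 \<le> t"
      using that z by (intro integral_eq_zero_AE AE_I2) (auto simp: indicator_def)
    ultimately show "indicator {0..} t *\<^sub>R (f t * (LINT s|lborel. indicator {0..} s *\<^sub>R (g s * h (t + s)))) =
        f' t * (LINT s|lborel. g' s * h' (t + s))"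
      by (cases "0 \<le> t"; cases "t \<le> T") (auto simp: f'_def indicator_def)
  qed
  also have "\<dots> = (LINT t|lborel. LINT u|lborel. f' t * g' (u - t) * h' u)"
  proof (intro Bochner_Integration.integral_cong refl)
    fix t :: real
    show "f' t * (LINT s|lborel. g' s * h' (t + s)) = (LINT u|lborel. f' t * g' (u - t) * h' u)"
      using lborel_integral_real_affine[of 1 "\<lambda>u. g' (u - t) * h' u" t] by (simp add: mult.assoc)
  qed
  also have "\<dots> = (LINT u|lborel. LINT t|lborel. f' t * g' (u - t) * h' u)"
    using lborel_pair.Fubini_integral[OF pair] by simp
  also have "\<dots> = (LINT u:{0..}|lborel. ?c u * h u)"
    unfolding set_lebesgue_integral_def
  proof (intro Bochner_Integration.integral_cong refl)
    fix u :: real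
    show "(LINT t|lborel. f' t * g' (u - t) * h' u) =
        indicator {0..} u *\<^sub>R ((LINT s|lborel. indicator {0..u} s *\<^sub>R (f s * g (u - s))) * h u)"
    proof (cases "0 \<le> u \<and> u \<le> T")
      case True
      \<comment> \<open>\<open>f'\<close> and \<open>g'\<close> vanish at negative arguments, which
        restores the limits 0 and \<open>u\<close> of the convolution integral.\<close>
      then have "(LINT s|lborel. indicator {0..u} s *\<^sub>R (f s * g (u - s))) = (LINT t|lborel. f' t * g' (u - t))"
        by (intro Bochner_Integration.integral_cong refl) (simp add: f'_def g'_def conv_truncate[of u T])
      then show ?thesis
        using True by (simp add: h'_def)
    qed (use T in \<open>auto simp: h'_def\<close>)
  qed
  also have "\<dots> = rint (embed (conv_l1loc F G)) h"
    by (simp add: FG rint_embed[OF c h])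
  finally show "rint (embed (conv_l1loc F G)) h = rint (conv_mloc (embed F) (embed G)) h"
    by simp
qed

section \<open>Translates and the ideal of absolutely continuous measures\<close>

lemma bounded_borel_shift:
  assumes "A \<in> bounded_borel"
  shows "{s. 0 \<le> s \<and> t + s \<in> A} \<in> bounded_borel"
proof -
  obtain T where T: "A \<subseteq> {0..T}"
    using assms by (rule bounded_borel_bound)
  have "A \<in> sets borel"
    using assms by (simp add: bounded_borel_def)
  then have "(\<lambda>s. t + s) -` A \<inter> {0..} \<in> sets borel"
    by measurable
  moreover have "(\<lambda>s. t + s) -` A \<inter> {0..} = {s. 0 \<le> s \<and> t + s \<in> A}"
    by auto
  ultimately have "{s. 0 \<le> s \<and> t + s \<in> A} \<in> sets borel"
    by simp
  moreover have "{s. 0 \<le> s \<and> t + s \<in> A} \<subseteq> {0..T - t}"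
    using T by auto
  ultimately show ?thesis
    by (intro bounded_borel_subset[OF bounded_borel_Icc])
qed

lemma null_sets_lborel_shift:
  fixes A :: "real set"
  assumes "A \<in> null_sets lborel"
  shows "(\<lambda>s. t + s) -` A \<in> null_sets lborel"
proof -
  have A: "A \<in> sets borel" "emeasure lborel A = 0"
    using assms by (auto simp: null_sets_def)
  then have "emeasure lborel ((\<lambda>s. t + s) -` A) = emeasure (distr lborel borel ((+) t)) A"
    by (subst emeasure_distr) auto
  then have "emeasure lborel ((\<lambda>s. t + s) -` A) = 0"
    using A by (simp add: lborel_distr_plus)
  moreover have "(\<lambda>s. t + s) -` A \<in> sets borel"
    using A(1) measurable_sets[of "\<lambda>s. t + s" borel borel A] by simp
  ultimately show ?thesis
    by (simp add: null_sets_def)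
qed

text \<open>Commutativity puts \<nu> into the inner pairing, where it meets the part of a translate
  of \<open>A\<close> lying in the half-line. That is again a null set, so the inner pairing
  vanishes for every t.\<close>

lemma absolutely_continuous_conv:
  assumes \<nu>: "absolutely_continuous_mloc \<nu>"
  shows "absolutely_continuous_mloc (conv_mloc \<nu> \<mu>)"
  unfolding absolutely_continuous_mloc_def
proof (intro ballI impI)
  fix A
  assume A: "A \<in> bounded_borel" "A \<in> null_sets lborel"
  have "rint \<nu> (\<lambda>s. indicator A (t + s)) = 0" for t
  proof -
    let ?B = "{s. 0 \<le> s \<and> t + s \<in> A}"
    have B: "?B \<in> bounded_borel"
      by (rule bounded_borel_shift[OF A(1)])
    have "?B \<in> null_sets lborel"
      by (rule null_sets_subset[OF null_sets_lborel_shift[OF A(2), of t]]) (use B in \<open>auto simp: bounded_borel_def\<close>)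
    then have "rint \<nu> (indicator ?B) = 0"
      using \<nu> B by (simp add: absolutely_continuous_mloc_def rint_indicator)
    moreover have "rint \<nu> (\<lambda>s. indicator A (t + s)) = rint \<nu> (indicator ?B)"
      by (rule rint_cong) (simp add: indicator_def)
    ultimately show ?thesis
      by simp
  qed
  then have "rint (conv_mloc \<mu> \<nu>) (indicator A) = 0"
    using A(1) by (simp add: rint_conv)
  then show "mloc_fun (conv_mloc \<nu> \<mu>) A = 0"
    using A(1) by (simp add: rint_indicator conv_mloc_commute[of \<nu>])
qed

lemma absolutely_continuous_embed: "absolutely_continuous_mloc (embed F)"
  unfolding absolutely_continuous_mloc_def
proof (intro ballI impI)
  fix A
  assume A: "A \<in> bounded_borel" "A \<in> null_sets lborel"
  obtain f where f: "locally_integrable f" "F = abs_l1loc f"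
    by (rule l1loc_cases)
  have "(LINT t:A|lborel. f t) = 0"
    unfolding set_lebesgue_integral_def
    by (intro integral_eq_zero_AE eventually_mono[OF AE_not_in[OF A(2)]]) auto
  then show "mloc_fun (embed F) A = 0"
    using f A(1) by (simp add: mloc_fun_embed)
qed

text \<open>A Jordan part is a supremum of values on subsets, and Borel subsets of null sets are
  null; hence each of the four positive measures is absolutely continuous and has a density. This
  density is finite almost everywhere on bounded sets, where \<open>enn2real\<close> therefore loses
  nothing.\<close>

lemma Radon_Nikodym_mloc:
  assumes \<mu>: "absolutely_continuous_mloc \<mu>"
  obtains F where "embed F = \<mu>"
proof -
  have "\<exists>f. (\<forall>A\<in>bounded_borel. set_integrable lborel A f \<and>
      (LINT t:A|lborel. f t) = measure (jordan_part \<mu> k) A)" for k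
  proof -
    let ?J = "jordan_part \<mu> k"
    have "absolutely_continuous lborel ?J"
      unfolding absolutely_continuous_def
    proof
      fix A :: "real set"
      assume A: "A \<in> null_sets lborel"
      then have A': "A \<in> sets borel"
        by (simp add: null_sets_def)
      have "emeasure ?J A \<le> 0"
        unfolding jordan_part_def
      proof (rule emeasure_pos_part_least[OF locally_additive_jordan A'])
        fix B
        assume B: "B \<in> bounded_borel" "B \<subseteq> A"
        then have "B \<in> null_sets lborel"
          using A by (intro null_sets_subset[OF A]) (auto simp: bounded_borel_def)
        then show "ennreal (Re (cnj (\<i> ^ k) * mloc_fun \<mu> B)) \<le> 0"
          using \<mu> B(1) by (simp add: absolutely_continuous_mloc_def)
      qed
      then show "A \<in> null_sets ?J"
        using A' by (simp add: null_sets_def)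
    qed
    then obtain g where g: "g \<in> borel_measurable lborel" "density lborel g = ?J"
      using sigma_finite_measure.Radon_Nikodym[OF sigma_finite_lborel, of ?J] by auto
    have [measurable]: "g \<in> borel_measurable borel"
      using g(1) by simp
    have "set_integrable lborel A (\<lambda>t. enn2real (g t)) \<and> (LINT t:A|lborel. enn2real (g t)) = measure ?J A"
      if A: "A \<in> bounded_borel" for A
    proof -
      have [measurable]: "A \<in> sets borel"
        using A by (simp add: bounded_borel_def)
      have em: "(\<integral>\<^sup>+t. g t * indicator A t \<partial>lborel) = emeasure ?J A"
        unfolding g(2)[symmetric] by (rule emeasure_density[symmetric]) auto
      then have fin: "(\<integral>\<^sup>+t. g t * indicator A t \<partial>lborel) \<noteq> \<infinity>"
        using emeasure_jordan_part_finite[OF A, of \<mu> k] by simp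
      have "AE t in lborel. g t * indicator A t \<noteq> \<infinity>"
        by (rule nn_integral_PInf_AE[OF _ fin]) measurable
      then have "AE t in lborel. ennreal (indicator A t *\<^sub>R enn2real (g t)) = g t * indicator A t"
        by (rule eventually_mono) (auto simp: indicator_def less_top)
      then have nn: "(\<integral>\<^sup>+t. ennreal (indicator A t *\<^sub>R enn2real (g t)) \<partial>lborel) = emeasure ?J A"
        unfolding em[symmetric] by (rule nn_integral_cong_AE)
      have m: "(\<lambda>t. indicator A t *\<^sub>R enn2real (g t)) \<in> borel_measurable lborel"
        by measurable
      have "integrable lborel (\<lambda>t. indicator A t *\<^sub>R enn2real (g t))"
        by (rule integrableI_nonneg[OF m]) (use emeasure_jordan_part_finite[OF A, of \<mu> k] in \<open>simp_all only: nn, simp\<close>)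
      moreover have "(LINT t|lborel. indicator A t *\<^sub>R enn2real (g t)) = measure ?J A"
        using integral_eq_nn_integral[OF m] unfolding nn by (simp add: measure_def)
      ultimately show ?thesis
        by (simp add: set_integrable_def set_lebesgue_integral_def)
    qed
    then show ?thesis
      by blast
  qed
  then obtain f where f: "\<And>k A. A \<in> bounded_borel \<Longrightarrow> set_integrable lborel A (f k)"
    "\<And>k A. A \<in> bounded_borel \<Longrightarrow> (LINT t:A|lborel. f k t) = measure (jordan_part \<mu> k) A"
    by metis
  define F where "F t = (\<Sum>k<4. \<i> ^ k * complex_of_real (f k t))" for t
  have int: "integrable lborel (\<lambda>t. \<i> ^ k * complex_of_real (indicator A t *\<^sub>R f k t))" if "A \<in> bounded_borel" for A k
    using f(1)[OF that] unfolding set_integrable_def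
    by (intro integrable_mult_right integrable_of_real)
  have eq: "indicator A t *\<^sub>R F t = (\<Sum>k<4. \<i> ^ k * complex_of_real (indicator A t *\<^sub>R f k t))" for A t
    by (simp add: F_def indicator_def)
  have F: "locally_integrable F"
    unfolding locally_integrable_def set_integrable_def eq by (intro allI Bochner_Integration.integrable_sum int) simp
  have "embed (abs_l1loc F) = \<mu>"
  proof (rule mloc_fun_eqI)
    fix A
    assume A: "A \<in> bounded_borel"
    have "(LINT t:A|lborel. F t) = (\<Sum>k<4. \<i> ^ k * complex_of_real (LINT t:A|lborel. f k t))"
      unfolding set_lebesgue_integral_def eq
      by (subst Bochner_Integration.integral_sum[OF int[OF A]])
        (simp only: integral_mult_right_zero integral_complex_of_real)
    then show "mloc_fun (embed (abs_l1loc F)) A = mloc_fun \<mu> A"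
      using A by (simp add: mloc_fun_embed[OF F] f(2) mloc_fun_jordan)
  qed
  then show ?thesis
    by (rule that)
qed

section \<open>Seminorms\<close>

lemma bounded_borel_bound_nat:
  assumes "A \<in> bounded_borel"
  obtains n where "A \<subseteq> {0..<real n}"
proof -
  obtain T where T: "A \<subseteq> {0..T}"
    using assms by (rule bounded_borel_bound)
  obtain n where "T < real n"
    using reals_Archimedean2 by blast
  then have "A \<subseteq> {0..<real n}"
    using T by auto
  then show ?thesis
    by (rule that)
qed

lemma mass_subset:
  assumes "A \<in> bounded_borel" "B \<in> sets borel" "B \<subseteq> A"
  shows "mass \<nu> B \<le> mass \<nu> A"
  unfolding mass_def
proof (intro sum_mono measure_mono_fmeasurable)
  show "A \<in> fmeasurable (jordan_part \<nu> k)" for k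
    using assms(1) emeasure_jordan_part_finite[OF assms(1)] by (simp add: fmeasurable_def bounded_borel_def)
qed (use assms in auto)

lemma cmod_mloc_fun_le_mass: "cmod (mloc_fun \<nu> A) \<le> mass \<nu> A"
proof (cases "A \<in> bounded_borel")
  case True
  then show ?thesis
    unfolding mass_def mloc_fun_jordan[OF True]
    by (intro order.trans[OF norm_sum] sum_mono) (simp add: norm_mult norm_power)
qed (simp add: mloc_fun_eq_0 mass_nonneg)

text \<open>This bound makes the supremum in \<open>total_variation\<close> a genuine one: an
  unbounded supremum of reals would carry no information.\<close>

lemma sum_cmod_mloc_fun_le_mass:
  assumes P: "finite P" "P \<subseteq> bounded_borel" "disjoint P" and A: "\<Union>P \<subseteq> A" "A \<in> bounded_borel"
  shows "(\<Sum>B\<in>P. cmod (mloc_fun \<nu> B)) \<le> mass \<nu> A"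
proof -
  have "(\<Sum>B\<in>P. mass \<nu> B) = (\<Sum>k<4. \<Sum>B\<in>P. measure (jordan_part \<nu> k) B)"
    unfolding mass_def by (rule sum.swap)
  also have "\<dots> = (\<Sum>k<4. measure (jordan_part \<nu> k) (\<Union>P))"
  proof (intro sum.cong refl)
    fix k
    have "measure (jordan_part \<nu> k) (\<Union>B\<in>P. B) = (\<Sum>B\<in>P. measure (jordan_part \<nu> k) B)"
    proof (rule measure_finite_Union)
      show "(\<lambda>B. B) ` P \<subseteq> sets (jordan_part \<nu> k)"
        using P(2) by (auto simp: bounded_borel_def)
      show "disjoint_family_on (\<lambda>B. B) P"
        using P(3) by (auto simp: disjoint_family_on_def disjoint_def)
      show "emeasure (jordan_part \<nu> k) B \<noteq> \<infinity>" if "B \<in> P" for B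
        using emeasure_jordan_part_finite[of B \<nu> k] P(2) that by auto
    qed (rule P)
    then show "(\<Sum>B\<in>P. measure (jordan_part \<nu> k) B) = measure (jordan_part \<nu> k) (\<Union>P)"
      by simp
  qed
  also have "\<dots> = mass \<nu> (\<Union>P)"
    by (simp add: mass_def)
  also have "\<dots> \<le> mass \<nu> A"
    using P A by (intro mass_subset) (auto simp: bounded_borel_def)
  finally show ?thesis
    using sum_mono[of P "\<lambda>B. cmod (mloc_fun \<nu> B)" "mass \<nu>"] cmod_mloc_fun_le_mass by fastforce
qed

abbreviation partitions :: "real set \<Rightarrow> real set set set" where
  "partitions A \<equiv> {P. finite P \<and> P \<subseteq> bounded_borel \<and> partition_on A P}"

text \<open>\<open>partition_on\<close> excludes empty blocks, so they are stripped after the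
  insertion; this covers an empty \<open>B\<close> without a case distinction.\<close>

lemma insert_partitions:
  assumes P: "P \<in> partitions A" and B: "B \<in> bounded_borel" "A \<inter> B = {}"
  shows "insert B P - {{}} \<in> partitions (A \<union> B)"
proof -
  have "\<Union>P = A" "disjoint P"
    using P by (auto simp: partition_on_def)
  then have "disjoint (insert B P)" "\<Union>(insert B P) = A \<union> B"
    using B(2) by (auto simp: disjoint_def)
  then have "disjoint (insert B P - {{}})" "\<Union>(insert B P - {{}}) = A \<union> B"
    by (auto intro: pairwise_subset)
  then show ?thesis
    using P B(1) by (auto simp: partition_on_def)
qed

lemma empty_partitions: "{} \<in> partitions {}"
  by (simp add: partition_on_def disjoint_def)

lemma cnj_sgn_mult: "cnj (sgn z) * z = complex_of_real (cmod z)"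
proof -
  have "cnj (sgn z) * z = (z * cnj z) / complex_of_real (cmod z)"
    by (simp add: sgn_eq mult.commute)
  also have "\<dots> = complex_of_real (cmod z)"
    by (simp only: complex_norm_square[symmetric]) (simp add: power2_eq_square)
  finally show ?thesis .
qed

lemma seminorm_mloc_upper:
  assumes "P \<in> partitions {0..<real n}"
  shows "(\<Sum>B\<in>P. cmod (mloc_fun \<nu> B)) \<le> seminorm_mloc n \<nu>"
  unfolding seminorm_mloc_def total_variation_def
proof (rule cSUP_upper[OF assms], rule bdd_aboveI2)
  show "(\<Sum>B\<in>P. cmod (mloc_fun \<nu> B)) \<le> mass \<nu> {0..<real n}" if "P \<in> partitions {0..<real n}" for P
    using that by (intro sum_cmod_mloc_fun_le_mass) (auto simp: partition_on_def)
qed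

lemma seminorm_mloc_least:
  assumes "\<And>P. P \<in> partitions {0..<real n} \<Longrightarrow> (\<Sum>B\<in>P. cmod (mloc_fun \<nu> B)) \<le> c"
  shows "seminorm_mloc n \<nu> \<le> c"
  unfolding seminorm_mloc_def total_variation_def
proof (rule cSUP_least[OF _ assms])
  \<comment> \<open>For \<open>n = 0\<close> the interval is empty and the result is the empty
    partition.\<close>
  have "insert {0..<real n} {} - {{}} \<in> partitions ({} \<union> {0..<real n})"
    by (intro insert_partitions empty_partitions) auto
  then have "{{0..<real n}} - {{}} \<in> partitions {0..<real n}"
    by (simp only: Un_empty_left)
  then show "partitions {0..<real n} \<noteq> {}"
    unfolding ex_in_conv[symmetric] by (rule exI)
qed

lemma cmod_mloc_fun_le_seminorm:
  assumes B: "B \<in> bounded_borel" "B \<subseteq> {0..<real n}"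
  shows "cmod (mloc_fun \<nu> B) \<le> seminorm_mloc n \<nu>"
proof -
  \<comment> \<open>The set and its complement in the interval: a partition into at most two blocks,
    empty ones removed.\<close>
  let ?P = "insert B (insert ({0..<real n} - B) {} - {{}}) - {{}}"
  have C: "{0..<real n} - B \<in> bounded_borel"
    using B by (intro bounded_borel_subset[OF bounded_borel_Ico]) (auto simp: bounded_borel_def)
  have "mloc_fun \<nu> {} = 0"
    using rint_indicator[of "{}" \<nu>] rint_cong[of "indicator {}" "\<lambda>_. 0" \<nu>] by simp
  then have "cmod (mloc_fun \<nu> B) \<le> (\<Sum>B\<in>?P. cmod (mloc_fun \<nu> B))"
    by (cases "B = {}") (auto intro!: member_le_sum sum_nonneg)
  also have "\<dots> \<le> seminorm_mloc n \<nu>"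
  proof (rule seminorm_mloc_upper)
    have "?P \<in> partitions (({} \<union> ({0..<real n} - B)) \<union> B)"
      using B(1) C by (intro insert_partitions empty_partitions) auto
    also have "({} \<union> ({0..<real n} - B)) \<union> B = {0..<real n}"
      using B(2) by auto
    finally show "?P \<in> partitions {0..<real n}" .
  qed
  finally show ?thesis .
qed

text \<open>Each Jordan part is a supremum of numbers Re(c \<nu>(B)) with |c| = 1, so it is at most
  the total variation; there are four of them.\<close>

lemma mass_le_seminorm: "mass \<nu> {0..<real n} \<le> 4 * seminorm_mloc n \<nu>"
proof -
  have "measure (jordan_part \<nu> k) {0..<real n} \<le> seminorm_mloc n \<nu>" for k
    unfolding jordan_part_def
  proof (rule measure_pos_part(2)[OF locally_additive_jordan bounded_borel_Ico])
    fix B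
    assume B: "B \<in> bounded_borel" "B \<subseteq> {0..<real n}"
    have "Re (cnj (\<i> ^ k) * mloc_fun \<nu> B) \<le> cmod (cnj (\<i> ^ k) * mloc_fun \<nu> B)"
      by (rule complex_Re_le_cmod)
    also have "\<dots> = cmod (mloc_fun \<nu> B)"
      by (simp add: norm_mult norm_power)
    also have "\<dots> \<le> seminorm_mloc n \<nu>"
      by (rule cmod_mloc_fun_le_seminorm[OF B])
    finally show "Re (cnj (\<i> ^ k) * mloc_fun \<nu> B) \<le> seminorm_mloc n \<nu>" .
  qed
  from sum_mono[of "{..<4}" "\<lambda>k. measure (jordan_part \<nu> k) {0..<real n}", OF this] show ?thesis
    by (simp add: mass_def)
qed

lemma rint_le_seminorm:
  assumes "integrand h" "0 \<le> K" "\<And>t. 0 \<le> t \<Longrightarrow> cmod (h t) \<le> K" "\<And>t. real n \<le> t \<Longrightarrow> h t = 0"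
  shows "cmod (rint \<nu> h) \<le> 4 * K * seminorm_mloc n \<nu>"
proof -
  have "cmod (rint \<nu> h) \<le> K * mass \<nu> {0..<real n}"
    using assms by (intro rint_bound) auto
  also have "\<dots> \<le> K * (4 * seminorm_mloc n \<nu>)"
    using assms by (intro mult_left_mono mass_le_seminorm)
  finally show ?thesis
    by simp
qed

text \<open>A partition sum is itself a pairing: the step function that takes on each block the
  conjugate phase of its measure has modulus at most 1. Estimates of seminorms thereby become
  estimates of pairings, uniform over such functions.\<close>

lemma seminorm_mloc_dual:
  assumes le: "\<And>h. integrand h \<Longrightarrow> (\<And>t. 0 \<le> t \<Longrightarrow> cmod (h t) \<le> 1) \<Longrightarrow>
    (\<And>t. real n \<le> t \<Longrightarrow> h t = 0) \<Longrightarrow> cmod (rint \<nu> h) \<le> c"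
  shows "seminorm_mloc n \<nu> \<le> c"
proof (rule seminorm_mloc_least)
  fix P
  assume P: "P \<in> partitions {0..<real n}"
  then have fin: "finite P" and bb: "\<And>B. B \<in> P \<Longrightarrow> B \<in> bounded_borel" and U: "\<Union>P = {0..<real n}"
    and disj: "disjoint P"
    by (auto simp: partition_on_def)
  define h where "h t = (\<Sum>B\<in>P. cnj (sgn (mloc_fun \<nu> B)) * indicator B t)" for t
  have "rint \<nu> h = (\<Sum>B\<in>P. rint \<nu> (\<lambda>t. cnj (sgn (mloc_fun \<nu> B)) * indicator B t))"
    unfolding h_def using fin bb by (intro rint_sum integrand_scale) auto
  also have "\<dots> = (\<Sum>B\<in>P. complex_of_real (cmod (mloc_fun \<nu> B)))"
  proof (intro sum.cong refl)
    fix B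
    assume "B \<in> P"
    show "rint \<nu> (\<lambda>t. cnj (sgn (mloc_fun \<nu> B)) * indicator B t) = complex_of_real (cmod (mloc_fun \<nu> B))"
      using bb[OF \<open>B \<in> P\<close>] by (simp add: rint_scale rint_indicator cnj_sgn_mult)
  qed
  finally have "rint \<nu> h = complex_of_real (\<Sum>B\<in>P. cmod (mloc_fun \<nu> B))"
    by simp
  moreover have "cmod (rint \<nu> h) \<le> c"
  proof (rule le)
    show "integrand h"
      unfolding h_def[abs_def] using fin bb by (intro integrand_sum integrand_scale) auto
    show "h t = 0" if "real n \<le> t" for t
      unfolding h_def
    proof (intro sum.neutral ballI)
      fix B
      assume "B \<in> P"
      then have "B \<subseteq> {0..<real n}"
        unfolding U[symmetric] by (rule Union_upper)
      then have "t \<notin> B"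
        using that by auto
      then show "cnj (sgn (mloc_fun \<nu> B)) * indicator B t = 0"
        by simp
    qed
    show "cmod (h t) \<le> 1" for t
    proof (cases "\<exists>B\<in>P. t \<in> B")
      case True
      then obtain B where B: "B \<in> P" "t \<in> B"
        by blast
      have "h t = (\<Sum>C\<in>{B}. cnj (sgn (mloc_fun \<nu> C)) * indicator C t)"
        unfolding h_def using B fin disj
        by (intro sum.mono_neutral_right) (auto simp: disjoint_def indicator_def)
      then show ?thesis
        using B by (simp add: norm_sgn)
    next
      case False
      then have "h t = 0"
        unfolding h_def by (intro sum.neutral) auto
      then show ?thesis
        by simp
    qed
  qed
  ultimately show "(\<Sum>B\<in>P. cmod (mloc_fun \<nu> B)) \<le> c"
    by (simp add: abs_le_iff del: of_real_sum)
qed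

lemma seminorm_mloc_nonneg: "0 \<le> seminorm_mloc n \<nu>"
  using order.trans[OF norm_ge_zero cmod_mloc_fun_le_seminorm[of "{}" n \<nu>]] by simp

lemma seminorm_mloc_mono:
  assumes "m \<le> n"
  shows "seminorm_mloc m \<nu> \<le> seminorm_mloc n \<nu>"
proof (rule seminorm_mloc_least)
  fix P
  assume P: "P \<in> partitions {0..<real m}"
  let ?Q = "insert {real m..<real n} P - {{}}"
  have "{real m..<real n} \<in> bounded_borel"
    by (rule bounded_borel_subset[OF bounded_borel_Ico[of "real n"]]) auto
  then have "?Q \<in> partitions ({0..<real m} \<union> {real m..<real n})"
    using P by (intro insert_partitions) auto
  also have "{0..<real m} \<union> {real m..<real n} = {0..<real n}"
    using assms by auto
  finally have "(\<Sum>B\<in>?Q. cmod (mloc_fun \<nu> B)) \<le> seminorm_mloc n \<nu>"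
    by (rule seminorm_mloc_upper)
  moreover have "(\<Sum>B\<in>P. cmod (mloc_fun \<nu> B)) \<le> (\<Sum>B\<in>?Q. cmod (mloc_fun \<nu> B))"
    using P by (intro sum_mono2) (auto simp: partition_on_def)
  ultimately show "(\<Sum>B\<in>P. cmod (mloc_fun \<nu> B)) \<le> seminorm_mloc n \<nu>"
    by linarith
qed

interpretation mloc: seminorm_system seminorm_mloc
proof
  fix n m :: nat and \<nu> \<kappa> :: mloc
  show "0 \<le> seminorm_mloc n \<nu>"
    by (rule seminorm_mloc_nonneg)
  show "seminorm_mloc n 0 = 0"
    using seminorm_mloc_least[of n 0 0] seminorm_mloc_nonneg[of n 0] by (simp add: zero_mloc.rep_eq)
  show "seminorm_mloc n (- \<nu>) = seminorm_mloc n \<nu>"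
    by (simp add: seminorm_mloc_def total_variation_def uminus_mloc.rep_eq)
  show "seminorm_mloc n (\<nu> + \<kappa>) \<le> seminorm_mloc n \<nu> + seminorm_mloc n \<kappa>"
  proof (rule seminorm_mloc_least)
    fix P
    assume P: "P \<in> partitions {0..<real n}"
    have "(\<Sum>B\<in>P. cmod (mloc_fun (\<nu> + \<kappa>) B)) \<le> (\<Sum>B\<in>P. cmod (mloc_fun \<nu> B) + cmod (mloc_fun \<kappa> B))"
      by (intro sum_mono) (simp add: plus_mloc.rep_eq norm_triangle_ineq)
    then show "(\<Sum>B\<in>P. cmod (mloc_fun (\<nu> + \<kappa>) B)) \<le> seminorm_mloc n \<nu> + seminorm_mloc n \<kappa>"
      using seminorm_mloc_upper[OF P, of \<nu>] seminorm_mloc_upper[OF P, of \<kappa>] by (simp add: sum.distrib)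
  qed
  show "seminorm_mloc m \<nu> \<le> seminorm_mloc n \<nu>" if "m \<le> n"
    using that by (rule seminorm_mloc_mono)
  show "\<nu> = 0" if *: "\<And>n. seminorm_mloc n \<nu> = 0"
  proof -
    show ?thesis
    proof (rule mloc_fun_eqI)
      fix A
      assume A: "A \<in> bounded_borel"
      then obtain n where "A \<subseteq> {0..<real n}"
        by (rule bounded_borel_bound_nat)
      then show "mloc_fun \<nu> A = mloc_fun 0 A"
        using cmod_mloc_fun_le_seminorm[OF A, of n \<nu>] * by (simp add: zero_mloc.rep_eq)
    qed
  qed
qed

lemma seminorm_mloc_scale: "seminorm_mloc n (scale_mloc c \<nu>) \<le> cmod c * seminorm_mloc n \<nu>"
proof (rule seminorm_mloc_least)
  fix P
  assume "P \<in> partitions {0..<real n}"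
  then have "cmod c * (\<Sum>B\<in>P. cmod (mloc_fun \<nu> B)) \<le> cmod c * seminorm_mloc n \<nu>"
    by (intro mult_left_mono seminorm_mloc_upper) auto
  then show "(\<Sum>B\<in>P. cmod (mloc_fun (scale_mloc c \<nu>) B)) \<le> cmod c * seminorm_mloc n \<nu>"
    by (simp add: scale_mloc.rep_eq norm_mult sum_distrib_left)
qed

lemma seminorm_mloc_sum: "seminorm_mloc n (\<Sum>i\<in>I. \<nu> i) \<le> (\<Sum>i\<in>I. seminorm_mloc n (\<nu> i))"
proof (induction I rule: infinite_finite_induct)
  case (insert i I)
  then show ?case
    using mloc.triangle[of n "\<nu> i" "\<Sum>i\<in>I. \<nu> i"] by simp
qed (simp_all add: mloc.zero)

text \<open>Multiplication by the coordinate enlarges a test integrand on [0,n) at most by the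
  factor \<open>n\<close>; the 4 comes from \<open>rint_le_seminorm\<close>.\<close>

lemma seminorm_mloc_X: "seminorm_mloc n (X_mloc \<nu>) \<le> 4 * real n * seminorm_mloc n \<nu>"
proof (rule seminorm_mloc_dual)
  fix h
  assume h: "integrand h" "\<And>t. 0 \<le> t \<Longrightarrow> cmod (h t) \<le> 1" "\<And>t. real n \<le> t \<Longrightarrow> h t = 0"
  have "cmod (rint \<nu> (\<lambda>t. of_real t * h t)) \<le> 4 * real n * seminorm_mloc n \<nu>"
  proof (rule rint_le_seminorm)
    show "cmod (of_real t * h t) \<le> real n" if "0 \<le> t" for t
      using h that mult_mono[of t "real n" "cmod (h t)" 1] by (cases "t \<le> real n") (auto simp: norm_mult)
  qed (use h in \<open>auto simp: integrand_X\<close>)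
  then show "cmod (rint (X_mloc \<nu>) h) \<le> 4 * real n * seminorm_mloc n \<nu>"
    using h by (simp add: rint_X)
qed

lemma norm_diff_triangle4:
  "norm (p - q) \<le> norm (a - b) + norm (a - p) + norm (b - q)" for a b p q :: "'a::real_normed_vector"
  using norm_triangle_ineq[of "(a - b) - (a - p)" "b - q"] norm_triangle_ineq4[of "a - b" "a - p"] by simp

text \<open>The limit is built setwise, and the second conclusion keeps this convergence because it
  transports the vanishing on null sets. Countable additivity survives since the seminorms make the
  convergence uniform over all Borel subsets of [0,n).\<close>

lemma mloc_complete:
  fixes x :: "nat \<Rightarrow> mloc"
  assumes Cauchy: "\<And>n e. 0 < e \<Longrightarrow> \<exists>M. \<forall>k\<ge>M. \<forall>l\<ge>M. seminorm_mloc n (x k - x l) < e"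
  obtains \<nu> where "\<And>n. (\<lambda>k. seminorm_mloc n (x k - \<nu>)) \<longlonglongrightarrow> 0"
    and "\<And>A. (\<lambda>k. mloc_fun (x k) A) \<longlonglongrightarrow> mloc_fun \<nu> A"
proof -
  have close: "cmod (mloc_fun (x k) A - mloc_fun (x l) A) \<le> seminorm_mloc n (x k - x l)"
    if "A \<in> bounded_borel" "A \<subseteq> {0..<real n}" for A n k l
    using cmod_mloc_fun_le_seminorm[OF that, of "x k - x l"] by (simp add: minus_mloc.rep_eq)
  have "convergent (\<lambda>k. mloc_fun (x k) A)" for A
  proof (cases "A \<in> bounded_borel")
    case True
    then obtain n where n: "A \<subseteq> {0..<real n}"
      by (rule bounded_borel_bound_nat)
    have "Cauchy (\<lambda>k. mloc_fun (x k) A)"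
      unfolding Cauchy_def dist_norm
    proof (intro allI impI)
      fix e :: real
      assume "0 < e"
      then obtain M where "\<And>k l. M \<le> k \<Longrightarrow> M \<le> l \<Longrightarrow> seminorm_mloc n (x k - x l) < e"
        using Cauchy by blast
      then show "\<exists>M. \<forall>k\<ge>M. \<forall>l\<ge>M. norm (mloc_fun (x k) A - mloc_fun (x l) A) < e"
        using close[OF True n] order.strict_trans1 by blast
    qed
    then show ?thesis
      by (simp add: Cauchy_convergent_iff)
  qed (simp add: mloc_fun_eq_0 convergent_const)
  then obtain \<phi> where \<phi>: "\<And>A. (\<lambda>k. mloc_fun (x k) A) \<longlonglongrightarrow> \<phi> A"
    unfolding convergent_def by metis
  have lim: "cmod (mloc_fun (x k) A - \<phi> A) \<le> e"
    if "A \<in> bounded_borel" "A \<subseteq> {0..<real n}" "\<And>l. M \<le> l \<Longrightarrow> seminorm_mloc n (x k - x l) < e" for A n k M e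
  proof (rule LIMSEQ_le_const2)
    show "(\<lambda>l. cmod (mloc_fun (x k) A - mloc_fun (x l) A)) \<longlonglongrightarrow> cmod (mloc_fun (x k) A - \<phi> A)"
      by (intro tendsto_intros \<phi>)
    show "\<exists>N. \<forall>l\<ge>N. cmod (mloc_fun (x k) A - mloc_fun (x l) A) \<le> e"
      using close[OF that(1,2)] that(3) by (meson less_imp_le order.trans)
  qed
  have "locally_additive \<phi>"
    unfolding locally_additive_def
  proof (intro allI impI)
    fix F :: "nat \<Rightarrow> real set"
    assume F: "range F \<subseteq> bounded_borel" "disjoint_family F" "\<Union>(range F) \<in> bounded_borel"
    let ?U = "\<Union>(range F)"
    obtain n where n: "?U \<subseteq> {0..<real n}"
      using F(3) by (rule bounded_borel_bound_nat)
    have V: "(\<Union>i<N. F i) \<in> bounded_borel" for N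
      by (rule bounded_borel_subset[OF F(3)]) (use F(1) in \<open>auto simp: bounded_borel_def\<close>)
    \<comment> \<open>Finite additivity passes to the setwise limit and reduces the series to sets
      increasing to \<open>?U\<close>.\<close>
    have fin: "(\<Sum>i<N. mloc_fun \<nu> (F i)) = mloc_fun \<nu> (\<Union>i<N. F i)" for N \<nu>
    proof -
      have "(\<Sum>i<N. mloc_fun \<nu> (F i)) = rint \<nu> (\<lambda>t. \<Sum>i<N. indicator (F i) t)"
        using F(1) by (subst rint_sum) (auto simp: rint_indicator range_subsetD)
      also have "\<dots> = rint \<nu> (indicator (\<Union>i<N. F i))"
        using F(2) by (intro rint_cong) (subst indicator_UN_disjoint, auto simp: disjoint_family_on_def)
      finally show ?thesis
        by (simp add: rint_indicator V)
    qed
    have fin_\<phi>: "(\<Sum>i<N. \<phi> (F i)) = \<phi> (\<Union>i<N. F i)" for N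
    proof (rule LIMSEQ_unique)
      show "(\<lambda>k. \<Sum>i<N. mloc_fun (x k) (F i)) \<longlonglongrightarrow> (\<Sum>i<N. \<phi> (F i))"
        by (intro tendsto_sum \<phi>)
      show "(\<lambda>k. \<Sum>i<N. mloc_fun (x k) (F i)) \<longlonglongrightarrow> \<phi> (\<Union>i<N. F i)"
        unfolding fin by (rule \<phi>)
    qed
    show "(\<lambda>i. \<phi> (F i)) sums \<phi> ?U"
      unfolding sums_def fin_\<phi>
    proof (rule LIMSEQ_I)
      fix e :: real
      assume "0 < e"
      then obtain M where M: "\<And>k l. M \<le> k \<Longrightarrow> M \<le> l \<Longrightarrow> seminorm_mloc n (x k - x l) < e / 4"
        using Cauchy[of "e / 4" n] by auto
      \<comment> \<open>One fixed member \<open>x M\<close>, uniformly e/4-close to \<phi>, lends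
        its own continuity along the increasing unions.\<close>
      have "(\<lambda>N. mloc_fun (x M) (\<Union>i<N. F i)) \<longlonglongrightarrow> mloc_fun (x M) ?U"
        using locally_additive_mloc_fun[of "x M", unfolded locally_additive_def, rule_format, OF F]
        unfolding sums_def fin .
      then obtain N where N: "\<And>j. N \<le> j \<Longrightarrow> cmod (mloc_fun (x M) (\<Union>i<j. F i) - mloc_fun (x M) ?U) < e / 4"
        using \<open>0 < e\<close> LIMSEQ_D[of _ _ "e / 4"] by fastforce
      show "\<exists>N. \<forall>j\<ge>N. norm (\<phi> (\<Union>i<j. F i) - \<phi> ?U) < e"
      proof (intro exI allI impI)
        fix j
        assume j: "N \<le> j"
        have "(\<Union>i<j. F i) \<subseteq> {0..<real n}"
          using n by blast
        then have "cmod (mloc_fun (x M) (\<Union>i<j. F i) - \<phi> (\<Union>i<j. F i)) \<le> e / 4"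
          "cmod (mloc_fun (x M) ?U - \<phi> ?U) \<le> e / 4"
          using lim[OF V _ M[OF order_refl]] lim[OF F(3) n M[OF order_refl]] by auto
        moreover have "cmod (\<phi> (\<Union>i<j. F i) - \<phi> ?U) \<le> cmod (mloc_fun (x M) (\<Union>i<j. F i) - mloc_fun (x M) ?U) +
            cmod (mloc_fun (x M) (\<Union>i<j. F i) - \<phi> (\<Union>i<j. F i)) + cmod (mloc_fun (x M) ?U - \<phi> ?U)"
          by (rule norm_diff_triangle4)
        ultimately show "norm (\<phi> (\<Union>i<j. F i) - \<phi> ?U) < e"
          using N[OF j] \<open>0 < e\<close> by linarith
      qed
    qed
  qed
  moreover have "\<phi> A = 0" if "A \<notin> bounded_borel" for A
    using LIMSEQ_unique[OF \<phi>[of A], of 0] that by (simp add: mloc_fun_eq_0)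
  ultimately have \<nu>: "mloc_fun (Abs_mloc \<phi>) = \<phi>"
    by (intro Abs_mloc_inverse) simp
  show ?thesis
  proof (rule that[of "Abs_mloc \<phi>"])
    show "(\<lambda>k. mloc_fun (x k) A) \<longlonglongrightarrow> mloc_fun (Abs_mloc \<phi>) A" for A
      unfolding \<nu> by (rule \<phi>)
    show "(\<lambda>k. seminorm_mloc n (x k - Abs_mloc \<phi>)) \<longlonglongrightarrow> 0" for n
    proof (rule LIMSEQ_I)
      fix e :: real
      assume e: "0 < e"
      then obtain M where M: "\<And>k l. M \<le> k \<Longrightarrow> M \<le> l \<Longrightarrow> seminorm_mloc n (x k - x l) < e / 2"
        using Cauchy[of "e / 2" n] by auto
      \<comment> \<open>For a fixed partition the passage to the limit in \<open>l\<close> concerns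
        a finite sum; the bound is the same for all partitions, so the supremum keeps it.\<close>
      have "seminorm_mloc n (x k - Abs_mloc \<phi>) \<le> e / 2" if k: "M \<le> k" for k
      proof (rule seminorm_mloc_least)
        fix P
        assume P: "P \<in> partitions {0..<real n}"
        show "(\<Sum>B\<in>P. cmod (mloc_fun (x k - Abs_mloc \<phi>) B)) \<le> e / 2"
        proof (rule LIMSEQ_le_const2)
          show "(\<lambda>l. \<Sum>B\<in>P. cmod (mloc_fun (x k - x l) B)) \<longlonglongrightarrow>
              (\<Sum>B\<in>P. cmod (mloc_fun (x k - Abs_mloc \<phi>) B))"
            unfolding minus_mloc.rep_eq \<nu> by (intro tendsto_intros \<phi>)
          show "\<exists>N. \<forall>l\<ge>N. (\<Sum>B\<in>P. cmod (mloc_fun (x k - x l) B)) \<le> e / 2"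
            using seminorm_mloc_upper[OF P] M[OF k] by (meson less_imp_le order.trans)
        qed
      qed
      then show "\<exists>N. \<forall>k\<ge>N. norm (seminorm_mloc n (x k - Abs_mloc \<phi>) - 0) < e"
        using e by (intro exI[of _ M]) (force simp: mloc.nonneg)
    qed
  qed
qed

section \<open>Comparison with the seminorms on functions\<close>

lemma seminorm_l1loc_abs:
  "locally_integrable f \<Longrightarrow> seminorm_l1loc n (abs_l1loc f) = (LINT t:{0..<real n}|lborel. cmod (f t))"
  by (simp add: seminorm_l1loc.abs_eq l1loc_eq_refl)

lemma set_integrable_Ico: "locally_integrable f \<Longrightarrow> set_integrable lborel {0..<T} f"
  by (rule set_integrable_bounded_borel) auto

lemma set_integrable_cmod: "locally_integrable f \<Longrightarrow> set_integrable lborel {0..<T} (\<lambda>t. cmod (f t))"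
  using set_integrable_norm[OF set_integrable_Ico] .

lemma seminorm_embed_le: "seminorm_mloc n (embed F) \<le> seminorm_l1loc n F"
proof (rule seminorm_mloc_dual)
  fix h
  assume h: "integrand h" "\<And>t. 0 \<le> t \<Longrightarrow> cmod (h t) \<le> 1" "\<And>t. real n \<le> t \<Longrightarrow> h t = 0"
  obtain f where f: "locally_integrable f" "F = abs_l1loc f"
    by (rule l1loc_cases)
  have "cmod (rint (embed F) h) \<le> (LINT t|lborel. cmod (indicator {0..} t *\<^sub>R (f t * h t)))"
    unfolding f(2) rint_embed[OF f(1) h(1)] set_lebesgue_integral_def by (rule integral_norm_bound)
  also have "\<dots> \<le> (LINT t|lborel. indicator {0..<real n} t *\<^sub>R cmod (f t))"
  proof (rule integral_mono)
    show "integrable lborel (\<lambda>t. cmod (indicator {0..} t *\<^sub>R (f t * h t)))"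
      by (intro integrable_norm integrable_embed f h)
    show "integrable lborel (\<lambda>t. indicator {0..<real n} t *\<^sub>R cmod (f t))"
      using set_integrable_cmod[OF f(1)] by (simp add: set_integrable_def)
    show "cmod (indicator {0..} t *\<^sub>R (f t * h t)) \<le> indicator {0..<real n} t *\<^sub>R cmod (f t)" for t
      using h(2,3)[of t] by (cases "t < real n") (auto simp: indicator_def norm_mult mult_left_le)
  qed
  also have "\<dots> = seminorm_l1loc n F"
    using f by (simp add: seminorm_l1loc_abs set_lebesgue_integral_def)
  finally show "cmod (rint (embed F) h) \<le> seminorm_l1loc n F" .
qed

text \<open>Testing with the conjugate phase of the density, cut to [0,n), recovers the integral of
  |f|. Together with \<open>seminorm_embed_le\<close> this makes the two families of seminorms
  equivalent, so finite nets and Cauchy sequences can be transferred.\<close>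

lemma seminorm_l1loc_le: "seminorm_l1loc n F \<le> 4 * seminorm_mloc n (embed F)"
proof -
  obtain f where f: "locally_integrable f" "F = abs_l1loc f"
    by (rule l1loc_cases)
  define h where "h t = indicator {0..<real n} t *\<^sub>R cnj (sgn (f t))" for t
  have "(\<lambda>t. indicator {0..<real n} t *\<^sub>R f t) \<in> borel_measurable lborel"
    using set_integrable_Ico[OF f(1)] unfolding set_integrable_def by (rule borel_measurable_integrable)
  then have [measurable]: "(\<lambda>t. indicator {0..<real n} t *\<^sub>R f t) \<in> borel_measurable borel"
    by simp
  have [measurable]: "cnj \<in> borel_measurable borel"
    by (intro borel_measurable_continuous_onI continuous_intros)
  have "(\<lambda>t. cnj (sgn (indicator {0..<real n} t *\<^sub>R f t))) \<in> borel_measurable borel"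
    unfolding sgn_div_norm by measurable
  also have "(\<lambda>t. cnj (sgn (indicator {0..<real n} t *\<^sub>R f t))) = (\<lambda>t. indicator {0..} t *\<^sub>R h t)"
    by (auto simp: h_def indicator_def)
  finally have h: "integrand h"
    by (rule integrandI[of _ 1 "real n"]) (auto simp: h_def indicator_def norm_sgn)
  have eq: "indicator {0..} t *\<^sub>R (f t * h t) = complex_of_real (indicator {0..<real n} t *\<^sub>R cmod (f t))" for t
    using cnj_sgn_mult[of "f t"] by (simp add: h_def indicator_def mult.commute)
  have "rint (embed F) h = complex_of_real (seminorm_l1loc n F)"
    unfolding f(2) rint_embed[OF f(1) h] seminorm_l1loc_abs[OF f(1)] set_lebesgue_integral_def eq
    by (rule integral_complex_of_real)
  moreover have "cmod (rint (embed F) h) \<le> 4 * 1 * seminorm_mloc n (embed F)"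
    by (rule rint_le_seminorm) (auto simp: h h_def indicator_def norm_sgn)
  ultimately show ?thesis
    by simp
qed

text \<open>The comparison of seminorms forces |f| to vanish almost everywhere on each [0,n), and
  countably many of these intervals cover the half-line.\<close>

lemma embed_inject: "embed F = embed G \<longleftrightarrow> F = G"
proof
  assume "embed F = embed G"
  then have *: "embed (F - G) = 0"
    by (simp add: embed_diff)
  obtain f where f: "locally_integrable f" "F - G = abs_l1loc f"
    by (rule l1loc_cases)
  have "AE t in lborel. indicator {0..<real n} t *\<^sub>R cmod (f t) = 0" for n
  proof -
    have "seminorm_l1loc n (F - G) \<le> 0"
      using seminorm_l1loc_le[of n "F - G"] * by (simp add: mloc.zero)
    moreover have "0 \<le> seminorm_l1loc n (F - G)"
      unfolding f(2) seminorm_l1loc_abs[OF f(1)] set_lebesgue_integral_def by (rule Bochner_Integration.integral_nonneg) simp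
    ultimately have "(LINT t|lborel. indicator {0..<real n} t *\<^sub>R cmod (f t)) = 0"
      unfolding f(2) seminorm_l1loc_abs[OF f(1)] set_lebesgue_integral_def by (rule order.antisym)
    then show ?thesis
      using set_integrable_cmod[OF f(1), of "real n"]
      by (subst (asm) integral_nonneg_eq_0_iff_AE) (auto simp: set_integrable_def)
  qed
  then have "AE t in lborel. \<forall>n. indicator {0..<real n} t *\<^sub>R cmod (f t) = 0"
    by (intro AE_all_countable[THEN iffD2] allI)
  then have "AE t in lborel. 0 \<le> t \<longrightarrow> f t = 0"
  proof (rule eventually_mono, intro impI)
    fix t :: real
    assume "\<forall>n. indicator {0..<real n} t *\<^sub>R cmod (f t) = 0" "0 \<le> t"
    moreover obtain n where "t < real n"
      using reals_Archimedean2 by blast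
    ultimately show "f t = 0"
      by (auto dest: spec[of _ n])
  qed
  then have "l1loc_eq f (\<lambda>_. 0)"
    using f(1) by (simp add: l1loc_eq_def locally_integrable_def set_integrable_def)
  then have "F - G = 0"
    unfolding f(2) zero_l1loc_def by (simp add: Quotient3_rel_abs[OF Quotient3_l1loc])
  then show "F = G"
    by simp
qed simp

interpretation l1loc: seminorm_system seminorm_l1loc
proof
  fix n m :: nat and F G :: l1loc
  obtain f g where f: "locally_integrable f" "F = abs_l1loc f" and g: "locally_integrable g" "G = abs_l1loc g"
    using l1loc_cases[of F] l1loc_cases[of G] by metis
  show nonneg: "0 \<le> seminorm_l1loc n F"
    by (rule order.trans[OF seminorm_mloc_nonneg seminorm_embed_le])
  show "seminorm_l1loc n 0 = 0"
    using seminorm_l1loc_le[of n 0] order.trans[OF seminorm_mloc_nonneg seminorm_embed_le, of n 0]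
    by (simp add: mloc.zero)
  show "seminorm_l1loc n (- F) = seminorm_l1loc n F"
    using f by (simp add: uminus_l1loc.abs_eq l1loc_eq_refl seminorm_l1loc.abs_eq l1loc_eq_def
        locally_integrable_def set_integrable_def)
  show "seminorm_l1loc n (F + G) \<le> seminorm_l1loc n F + seminorm_l1loc n G"
  proof -
    have fg: "locally_integrable (\<lambda>t. f t + g t)"
      using locally_integrable_lin[OF f(1) g(1), of 1] by simp
    have "(LINT t:{0..<real n}|lborel. cmod (f t + g t)) \<le> (LINT t:{0..<real n}|lborel. cmod (f t) + cmod (g t))"
      by (intro set_integral_mono set_integral_add set_integrable_cmod f g fg norm_triangle_ineq)
    also have "\<dots> = (LINT t:{0..<real n}|lborel. cmod (f t)) + (LINT t:{0..<real n}|lborel. cmod (g t))"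
      by (intro set_integral_add set_integrable_cmod f g)
    finally show ?thesis
      using f g fg by (simp add: plus_l1loc.abs_eq l1loc_eq_refl seminorm_l1loc_abs)
  qed
  show "seminorm_l1loc m F \<le> seminorm_l1loc n F" if "m \<le> n"
    unfolding f(2) seminorm_l1loc_abs[OF f(1)] set_lebesgue_integral_def
  proof (rule integral_mono)
    show "integrable lborel (\<lambda>t. indicator {0..<real m} t *\<^sub>R cmod (f t))"
      "integrable lborel (\<lambda>t. indicator {0..<real n} t *\<^sub>R cmod (f t))"
      using set_integrable_cmod[OF f(1)] by (simp_all add: set_integrable_def)
    show "indicator {0..<real m} t *\<^sub>R cmod (f t) \<le> indicator {0..<real n} t *\<^sub>R cmod (f t)" for t
      using that by (auto simp: indicator_def)
  qed
  show "F = 0" if "\<And>n. seminorm_l1loc n F = 0"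
  proof -
    have "embed F = 0"
      using that seminorm_embed_le seminorm_mloc_nonneg by (intro mloc.separating) (metis order.antisym)
    then show ?thesis
      using embed_inject[of F 0] by simp
  qed
qed

text \<open>Functions form a closed subspace of the complete space of measures: the setwise limit
  still vanishes on null sets, and Radon--Nikodym returns a density.\<close>

lemma l1loc_complete:
  fixes x :: "nat \<Rightarrow> l1loc"
  assumes Cauchy: "\<And>n e. 0 < e \<Longrightarrow> \<exists>M. \<forall>k\<ge>M. \<forall>l\<ge>M. seminorm_l1loc n (x k - x l) < e"
  shows "\<exists>F. \<forall>n. (\<lambda>k. seminorm_l1loc n (x k - F)) \<longlonglongrightarrow> 0"
proof -
  have "\<exists>M. \<forall>k\<ge>M. \<forall>l\<ge>M. seminorm_mloc n (embed (x k) - embed (x l)) < e" if "0 < e" for n e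
    using Cauchy[OF that] seminorm_embed_le unfolding embed_diff[symmetric] by (meson order.strict_trans1)
  then obtain \<nu> where \<nu>: "\<And>n. (\<lambda>k. seminorm_mloc n (embed (x k) - \<nu>)) \<longlonglongrightarrow> 0"
    "\<And>A. (\<lambda>k. mloc_fun (embed (x k)) A) \<longlonglongrightarrow> mloc_fun \<nu> A"
    using mloc_complete[of "\<lambda>k. embed (x k)"] by blast
  have "absolutely_continuous_mloc \<nu>"
    unfolding absolutely_continuous_mloc_def
  proof (intro ballI impI)
    fix A
    assume "A \<in> bounded_borel" "A \<in> null_sets lborel"
    then have "mloc_fun (embed (x k)) A = 0" for k
      using absolutely_continuous_embed by (auto simp: absolutely_continuous_mloc_def)
    then show "mloc_fun \<nu> A = 0"
      using LIMSEQ_unique[OF \<nu>(2)[of A], of 0] by simp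
  qed
  then obtain F where F: "embed F = \<nu>"
    by (rule Radon_Nikodym_mloc)
  have "(\<lambda>k. seminorm_l1loc n (x k - F)) \<longlonglongrightarrow> 0" for n
  proof (rule tendsto_sandwich[of "\<lambda>_. 0"])
    show "(\<lambda>k. 4 * seminorm_mloc n (embed (x k) - \<nu>)) \<longlonglongrightarrow> 0"
      using tendsto_mult_left[OF \<nu>(1), of 4] by simp
    show "\<forall>\<^sub>F k in sequentially. seminorm_l1loc n (x k - F) \<le> 4 * seminorm_mloc n (embed (x k) - \<nu>)"
      using seminorm_l1loc_le[of n "x k - F" for k] by (simp add: embed_diff F)
  qed (auto simp: l1loc.nonneg)
  then show ?thesis
    by blast
qed

section \<open>Convolution with a locally integrable function is Montel\<close>

lemma integrable_translate:
  fixes f :: "real \<Rightarrow> 'a::{banach, second_countable_topology}"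
  shows "integrable lborel f \<Longrightarrow> integrable lborel (\<lambda>u. f (u - s))"
  using lborel_integrable_real_affine[of f 1 "- s"] by simp

lemma integral_translate:
  fixes f :: "real \<Rightarrow> 'a::{banach, second_countable_topology}"
  shows "(LINT u|lborel. f (u - s)) = (LINT u|lborel. f u)"
  using lborel_integral_real_affine[of 1 f "- s"] by simp

text \<open>Inner regularity is applied to a finite measure, so Lebesgue measure is first restricted
  to \<open>A\<close>; outer regularity is taken from Lebesgue measure directly.\<close>

lemma approx_between_compact_open:
  fixes A :: "real set"
  assumes A: "A \<in> sets borel" "emeasure lborel A < \<infinity>" and e: "0 < e"
  obtains K U where "compact K" "open U" "K \<subseteq> A" "A \<subseteq> U" "emeasure lborel (U - K) < ennreal e"
proof -
  define M where "M = density lborel (indicator A :: real \<Rightarrow> ennreal)"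
  have M: "emeasure M B = emeasure lborel (A \<inter> B)" if "B \<in> sets borel" for B
    unfolding M_def using A that by (subst emeasure_density) (auto simp: nn_integral_indicator indicator_inter_arith[symmetric])
  have "emeasure M A = (SUP K \<in> {K. K \<subseteq> A \<and> compact K}. emeasure M K)"
    by (rule inner_regular) (use A M[of UNIV] in \<open>auto simp: M_def\<close>)
  moreover have "{K. K \<subseteq> A \<and> compact K} \<noteq> {}" "emeasure M A \<noteq> \<infinity>"
    using A M[of A] by auto
  moreover have "0 < e / 2"
    using e by simp
  ultimately have "\<exists>K\<in>{K. K \<subseteq> A \<and> compact K}. emeasure M A < emeasure M K + ennreal (e / 2)"
    by (intro SUP_approx_ennreal)
  then obtain K where K: "K \<subseteq> A" "compact K" "emeasure M A < emeasure M K + ennreal (e / 2)"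
    by blast
  have Kb: "K \<in> sets borel"
    using K(2) by (rule borel_compact)
  have fin: "emeasure lborel K < \<infinity>"
    using emeasure_mono[OF K(1), of lborel] A by auto
  have "emeasure lborel A < emeasure lborel K + ennreal (e / 2)"
    using K M[OF Kb] M[OF A(1)] by (simp add: Int_absorb1)
  then have AK: "emeasure lborel (A - K) < ennreal (e / 2)"
  proof -
    have "emeasure lborel A = emeasure lborel K + emeasure lborel (A - K)"
      using plus_emeasure[of K lborel "A - K"] A(1) Kb K(1) by (simp add: Un_absorb1)
    then show ?thesis
      using \<open>emeasure lborel A < emeasure lborel K + ennreal (e / 2)\<close>
      by (simp add: ennreal_add_left_cancel_less)
  qed
  obtain U where U: "open U" "A \<subseteq> U" "emeasure lborel (U - A) < ennreal (e / 2)"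
    using outer_regular_lborel[OF A(1), of "e / 2"] e by auto
  have "U - K = (U - A) \<union> (A - K)"
    using U K by auto
  then have "emeasure lborel (U - K) \<le> emeasure lborel (U - A) + emeasure lborel (A - K)"
    using U(1) A(1) Kb by (simp add: emeasure_subadditive)
  also have "\<dots> < ennreal (e / 2) + ennreal (e / 2)"
    by (rule add_strict_mono[OF U(3) AK])
  also have "\<dots> = ennreal e"
    using e by (simp flip: ennreal_plus)
  finally show ?thesis
    using that K U by blast
qed

text \<open>The property passes from indicators to sums and dominated limits. For an indicator, the
  distance from the compact core to the complement of the open hull is the permitted shift: under a
  shorter one, membership in \<open>A\<close> can change only if the point or its translate lies in
  the layer U - K.\<close>

lemma L1_translation_continuous:
  fixes g :: "real \<Rightarrow> complex"
  assumes "integrable lborel g" "0 < e"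
  shows "\<exists>d>0. \<forall>s. \<bar>s\<bar> < d \<longrightarrow> (LINT u|lborel. cmod (g (u - s) - g u)) < e"
  using assms
proof (induction g arbitrary: e rule: integrable_induct)
  case (base A c)
  \<comment> \<open>\<open>a\<close> exceeds |c| and is positive even for \<open>c = 0\<close>. The
    error is at most |c| times twice the measure of U - K, hence below 2 a r = e.\<close>
  define a where "a = cmod c + 1"
  define r where "r = e / (2 * a)"
  have a: "0 < a" "cmod c < a"
    by (simp_all add: a_def add_nonneg_pos)
  have r: "0 < r" "a * (2 * r) = e"
    using base(3) a by (auto simp: r_def)
  obtain K U where KU: "compact K" "open U" "K \<subseteq> A" "A \<subseteq> U" "emeasure lborel (U - K) < ennreal r"
    using approx_between_compact_open[of A r] base r by auto
  have "closed (- U)" "K \<inter> - U = {}"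
    using KU by auto
  then obtain d where d: "0 < d" "\<And>x y. x \<in> K \<Longrightarrow> y \<in> - U \<Longrightarrow> d \<le> dist x y"
    using separate_compact_closed[OF KU(1)] by metis
  let ?D = "U - K"
  have Db: "?D \<in> sets borel"
    using KU by (auto intro: borel_compact)
  have intD: "integrable lborel (indicator ?D :: real \<Rightarrow> real)"
    using KU(5) Db by (intro integrable_real_indicator) (auto intro: less_trans)
  have A: "A \<in> sets borel"
    using base by simp
  have intA: "integrable lborel (\<lambda>u. indicator A u *\<^sub>R c)"
    using base by (intro integrable_scaleR_left integrable_real_indicator) auto
  have mD: "measure lborel ?D < r"
  proof -
    have "emeasure lborel ?D = ennreal (measure lborel ?D)"
      using KU(5) by (intro emeasure_eq_ennreal_measure) auto
    then show ?thesis
      using KU(5) by (simp add: ennreal_less_iff)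
  qed
  have "(LINT u|lborel. cmod (indicator A (u - s) *\<^sub>R c - indicator A u *\<^sub>R c)) < e" if s: "\<bar>s\<bar> < d" for s
  proof -
    have "(LINT u|lborel. cmod (indicator A (u - s) *\<^sub>R c - indicator A u *\<^sub>R c)) \<le>
        (LINT u|lborel. cmod c * (indicator ?D (u - s) + indicator ?D u))"
    proof (rule integral_mono)
      show "integrable lborel (\<lambda>u. cmod (indicator A (u - s) *\<^sub>R c - indicator A u *\<^sub>R c))"
        using integrable_translate[OF intA, of s] intA by (intro integrable_norm Bochner_Integration.integrable_diff)
      show "integrable lborel (\<lambda>u. cmod c * (indicator ?D (u - s) + indicator ?D u))"
        using integrable_translate[OF intD, of s] intD
        by (intro integrable_mult_right Bochner_Integration.integrable_add)
      show "cmod (indicator A (u - s) *\<^sub>R c - indicator A u *\<^sub>R c) \<le> cmod c * (indicator ?D (u - s) + indicator ?D u)" for u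
      proof -
        have near: "dist (u - s) u < d" "dist u (u - s) < d"
          using s by (auto simp: dist_real_def)
        consider "u - s \<in> A \<longleftrightarrow> u \<in> A" | "u - s \<in> A" "u \<notin> A" | "u - s \<notin> A" "u \<in> A"
          by blast
        then show ?thesis
        proof cases
          case 1
          then show ?thesis
            by (auto simp: indicator_def)
        next
          case 2
          \<comment> \<open>Either the translate lies in A - K, or it lies in K, and then
            \<open>u\<close>, at distance less than \<open>d\<close> from it, is still in U but
            outside A.\<close>
          have "u \<in> U" if "u - s \<in> K"
            by (rule ccontr) (use d(2)[OF that, of u] near(1) in simp)
          then have "u - s \<in> ?D \<or> u \<in> ?D"
            using 2 KU(3,4) by blast
          then show ?thesis
            using 2 by (auto simp: indicator_def)
        next
          case 3
          have "u - s \<in> U" if "u \<in> K"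
            by (rule ccontr) (use d(2)[OF that, of "u - s"] near(2) in simp)
          then have "u - s \<in> ?D \<or> u \<in> ?D"
            using 3 KU(3,4) by blast
          then show ?thesis
            using 3 by (auto simp: indicator_def)
        qed
      qed
    qed
    also have "\<dots> = cmod c * (measure lborel ?D + measure lborel ?D)"
    proof -
      have "(LINT u|lborel. indicator ?D (u - s) + indicator ?D u) =
          (LINT u|lborel. indicator ?D (u - s)) + (LINT u|lborel. indicator ?D u :: real)"
        using integrable_translate[OF intD, of s] intD by (rule Bochner_Integration.integral_add)
      then show ?thesis
        using integral_translate[of "indicator ?D :: real \<Rightarrow> real" s] Db by simp
    qed
    also have "\<dots> \<le> cmod c * (2 * r)"
      using mD by (intro mult_left_mono) auto
    also have "\<dots> < a * (2 * r)"
      using r(1) a by (intro mult_strict_right_mono) auto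
    finally show ?thesis
      using r(2) by simp
  qed
  then show ?case
    using d(1) by blast
next
  case (add f g)
  have "0 < e / 2"
    using add.prems by simp
  obtain d1 where d1: "0 < d1" "\<And>s. \<bar>s\<bar> < d1 \<Longrightarrow> (LINT u|lborel. cmod (f (u - s) - f u)) < e / 2"
    using add.IH(1)[OF \<open>0 < e / 2\<close>] by blast
  obtain d2 where d2: "0 < d2" "\<And>s. \<bar>s\<bar> < d2 \<Longrightarrow> (LINT u|lborel. cmod (g (u - s) - g u)) < e / 2"
    using add.IH(2)[OF \<open>0 < e / 2\<close>] by blast
  have "(LINT u|lborel. cmod (f (u - s) + g (u - s) - (f u + g u))) < e" if "\<bar>s\<bar> < min d1 d2" for s
  proof -
    have int: "integrable lborel (\<lambda>u. f (u - s) - f u)" "integrable lborel (\<lambda>u. g (u - s) - g u)"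
      using add.hyps by (auto intro: integrable_translate)
    have "(LINT u|lborel. cmod (f (u - s) + g (u - s) - (f u + g u))) \<le>
        (LINT u|lborel. cmod (f (u - s) - f u) + cmod (g (u - s) - g u))"
    proof (rule integral_mono)
      show "integrable lborel (\<lambda>u. cmod (f (u - s) + g (u - s) - (f u + g u)))"
        using integrable_norm[OF Bochner_Integration.integrable_add[OF int]] by (simp add: algebra_simps)
      show "cmod (f (u - s) + g (u - s) - (f u + g u)) \<le> cmod (f (u - s) - f u) + cmod (g (u - s) - g u)" for u
        using norm_triangle_ineq[of "f (u - s) - f u" "g (u - s) - g u"] by (simp add: algebra_simps)
    qed (use int in \<open>auto intro: integrable_norm\<close>)
    also have "\<dots> = (LINT u|lborel. cmod (f (u - s) - f u)) + (LINT u|lborel. cmod (g (u - s) - g u))"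
      using int by (intro Bochner_Integration.integral_add integrable_norm)
    also have "\<dots> < e"
      using d1(2)[of s] d2(2)[of s] that by simp
    finally show ?thesis .
  qed
  then show ?case
    using d1(1) d2(1) by (intro exI[of _ "min d1 d2"]) auto
next
  case (lim f F)
  \<comment> \<open>The induction principle provides |F i| \<le> 2|f|, whence the dominating
    function 3|f|.\<close>
  have "(\<lambda>i. LINT u|lborel. cmod (F i u - f u)) \<longlonglongrightarrow> (LINT u::real|lborel. 0)"
  proof (rule integral_dominated_convergence)
    show "integrable lborel (\<lambda>u. 3 * cmod (f u))"
      using lim by (intro integrable_mult_right integrable_norm)
    show "(\<lambda>u. cmod (F i u - f u)) \<in> borel_measurable lborel" for i
      using lim by (intro borel_measurable_integrable integrable_norm Bochner_Integration.integrable_diff)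
    show "AE u in lborel. (\<lambda>i. cmod (F i u - f u)) \<longlonglongrightarrow> 0"
      using lim.hyps(2) by (intro AE_I2 tendsto_norm_zero LIM_zero) auto
    show "AE u in lborel. norm (cmod (F i u - f u)) \<le> 3 * cmod (f u)" for i
    proof (rule AE_I2)
      show "norm (cmod (F i u - f u)) \<le> 3 * cmod (f u)" for u
        using lim.hyps(3)[of u i] norm_triangle_ineq4[of "F i u" "f u"] by simp
    qed
  qed simp
  then have "\<forall>\<^sub>F i in sequentially. (LINT u|lborel. cmod (F i u - f u)) < e / 3"
    using lim.prems by (intro order_tendstoD) auto
  then obtain i where i: "(LINT u|lborel. cmod (F i u - f u)) < e / 3"
    using eventually_sequentially by auto
  obtain d where d: "0 < d" "\<And>s. \<bar>s\<bar> < d \<Longrightarrow> (LINT u|lborel. cmod (F i (u - s) - F i u)) < e / 3"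
    using lim.IH[of "e / 3" i] lim.prems by auto
  \<comment> \<open>By translation invariance the approximation error of the translate equals that
    of the function itself, so each of the three terms is below e/3.\<close>
  have "(LINT u|lborel. cmod (f (u - s) - f u)) < e" if s: "\<bar>s\<bar> < d" for s
  proof -
    have int0: "integrable lborel (\<lambda>u. F i u - f u)"
      using lim by auto
    note int = int0 integrable_translate[OF int0, of s]
    have int3: "integrable lborel (\<lambda>u. F i (u - s) - F i u)"
      by (intro Bochner_Integration.integrable_diff integrable_translate lim.hyps)
    have "(LINT u|lborel. cmod (f (u - s) - f u)) \<le>
        (LINT u|lborel. (cmod (F i u - f u) + cmod (F i (u - s) - f (u - s))) + cmod (F i (u - s) - F i u))"
    proof (rule integral_mono)
      show "integrable lborel (\<lambda>u. cmod (f (u - s) - f u))"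
        using lim by (intro integrable_norm Bochner_Integration.integrable_diff integrable_translate)
      show "cmod (f (u - s) - f u) \<le> cmod (F i u - f u) + cmod (F i (u - s) - f (u - s)) + cmod (F i (u - s) - F i u)" for u
        using norm_diff_triangle4[of "f (u - s)" "f u" "F i (u - s)" "F i u"] by simp
    qed (use int int3 in \<open>auto intro!: integrable_norm Bochner_Integration.integrable_add\<close>)
    also have "\<dots> = ((LINT u|lborel. cmod (F i u - f u)) + (LINT u|lborel. cmod (F i (u - s) - f (u - s)))) +
        (LINT u|lborel. cmod (F i (u - s) - F i u))"
      using int int3 by (subst Bochner_Integration.integral_add, auto)
    also have "(LINT u|lborel. cmod (F i (u - s) - f (u - s))) = (LINT u|lborel. cmod (F i u - f u))"
      by (rule integral_translate)
    finally show ?thesis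
      using i d(2)[OF s] by linarith
  qed
  then show ?case
    using d(1) by blast
qed

section \<open>Approximation of convolutions by finitely many translates\<close>

definition shift_mloc :: "real \<Rightarrow> mloc \<Rightarrow> mloc" where
  "shift_mloc t \<nu> = (SOME \<kappa>. \<forall>h. integrand h \<longrightarrow> rint \<kappa> h = rint \<nu> (\<lambda>s. h (t + s)))"

text \<open>This is convolution with the unit mass at \<open>t\<close>; representing the translated
  pairing justifies the choice made in \<open>shift_mloc\<close>.\<close>

lemma rint_shift:
  assumes "0 \<le> t" "integrand h"
  shows "rint (shift_mloc t \<nu>) h = rint \<nu> (\<lambda>s. h (t + s))"
proof -
  have "sigma_functional (\<lambda>h. rint \<nu> (\<lambda>s. h (t + s)))"
    unfolding sigma_functional_def
    using assms(1) by (auto intro!: rint_tendsto bounded_limit_shift simp: rint_lin integrand_shift)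
  then obtain \<kappa> where "\<And>h. integrand h \<Longrightarrow> rint \<kappa> h = rint \<nu> (\<lambda>s. h (t + s))"
    by (rule sigma_functional_represented) blast
  then have "\<exists>\<kappa>. \<forall>h. integrand h \<longrightarrow> rint \<kappa> h = rint \<nu> (\<lambda>s. h (t + s))"
    by blast
  from someI_ex[OF this] show ?thesis
    using assms(2) unfolding shift_mloc_def by blast
qed

text \<open>The shift is moved from the merely Borel function \<open>h\<close> to the density
  \<open>g\<close>, for which translation is continuous in the mean. The bound no longer contains
  \<open>h\<close>, so it is uniform over all test integrands; as these vanish from \<open>n\<close>
  on, only \<open>g\<close> on [0,n) enters.\<close>

lemma rint_embed_shift_close:
  assumes g: "locally_integrable g" and h: "integrand h" "\<And>t. 0 \<le> t \<Longrightarrow> cmod (h t) \<le> 1"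
    "\<And>t. real n \<le> t \<Longrightarrow> h t = 0" and st: "0 \<le> s" "s \<le> t"
  shows "cmod (rint (embed (abs_l1loc g)) (\<lambda>u. h (t + u)) - rint (embed (abs_l1loc g)) (\<lambda>u. h (s + u))) \<le>
    (LINT u|lborel. cmod (indicator {0..<real n} (u - (t - s)) *\<^sub>R g (u - (t - s)) - indicator {0..<real n} u *\<^sub>R g u))"
proof -
  define g' where "g' u = indicator {0..<real n} u *\<^sub>R g u" for u
  define h' where "h' u = indicator {0..} u *\<^sub>R h u" for u
  have g': "integrable lborel g'"
    using set_integrable_Ico[OF g] by (simp add: set_integrable_def g'_def[abs_def])
  have [measurable]: "g' \<in> borel_measurable borel" "h' \<in> borel_measurable borel"
    using borel_measurable_integrable[OF g'] integrand_measurable[OF h(1)] by (simp_all add: h'_def[abs_def])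
  have h'1: "cmod (h' u) \<le> 1" for u
    using h(2) by (auto simp: h'_def indicator_def)
  have eq: "rint (embed (abs_l1loc g)) (\<lambda>u. h (x + u)) = (LINT v|lborel. g' (v - x) * h' v)" if x: "0 \<le> x" for x
  proof -
    have "rint (embed (abs_l1loc g)) (\<lambda>u. h (x + u)) = (LINT u|lborel. g' u * h' (x + u))"
      unfolding rint_embed[OF g integrand_shift[OF h(1) x]] set_lebesgue_integral_def
      using x h(3) by (intro Bochner_Integration.integral_cong) (auto simp: g'_def h'_def indicator_def)
    also have "\<dots> = (LINT v|lborel. g' (v - x) * h' v)"
      using lborel_integral_real_affine[of 1 "\<lambda>v. g' (v - x) * h' v" x] by simp
    finally show ?thesis .
  qed
  have int: "integrable lborel (\<lambda>v. g' (v - x) * h' v)" for x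
  proof (rule Bochner_Integration.integrable_bound[OF integrable_translate[OF g', of x]])
    show "AE v in lborel. norm (g' (v - x) * h' v) \<le> norm (g' (v - x))"
      using h'1 by (intro AE_I2) (simp add: norm_mult mult_left_le)
  qed measurable
  have "rint (embed (abs_l1loc g)) (\<lambda>u. h (t + u)) - rint (embed (abs_l1loc g)) (\<lambda>u. h (s + u)) =
      (LINT v|lborel. g' (v - t) * h' v - g' (v - s) * h' v)"
    using st by (simp add: eq Bochner_Integration.integral_diff[OF int int])
  also have "cmod \<dots> \<le> (LINT v|lborel. cmod (g' (v - t) * h' v - g' (v - s) * h' v))"
    by (rule integral_norm_bound)
  also have "\<dots> \<le> (LINT v|lborel. cmod (g' (v - t) - g' (v - s)))"
  proof (rule integral_mono)
    show "integrable lborel (\<lambda>v. cmod (g' (v - t) * h' v - g' (v - s) * h' v))"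
      by (intro integrable_norm Bochner_Integration.integrable_diff int)
    show "integrable lborel (\<lambda>v. cmod (g' (v - t) - g' (v - s)))"
      by (intro integrable_norm Bochner_Integration.integrable_diff integrable_translate g')
    show "cmod (g' (v - t) * h' v - g' (v - s) * h' v) \<le> cmod (g' (v - t) - g' (v - s))" for v
      using h'1[of v] by (simp add: left_diff_distrib[symmetric] norm_mult mult_left_le)
  qed
  also have "\<dots> = (LINT u|lborel. cmod (g' (u - (t - s)) - g' u))"
    using integral_translate[of "\<lambda>u. cmod (g' (u - (t - s)) - g' u)" s] by (simp add: algebra_simps)
  finally show ?thesis
    by (simp add: g'_def)
qed

text \<open>Discretisation leaves a combination of finitely many fixed measures \<open>E j\<close>.
  Its coefficients \<nu>(I j) stay in a disc of radius \<open>C'\<close>, so a finite net of that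
  disc yields a finite net for the images.\<close>

lemma conv_embed_totally_bounded:
  assumes bound: "\<And>\<nu>. \<nu> \<in> B \<Longrightarrow> seminorm_mloc n \<nu> \<le> C" and e: "0 < e"
  shows "\<exists>K. finite K \<and> (\<forall>\<nu>\<in>B. \<exists>k\<in>K. seminorm_mloc n (conv_mloc \<nu> (embed G) - k) < e)"
proof -
  \<comment> \<open>At least 1, so that it can serve as a divisor.\<close>
  define C' where "C' = max C 1"
  have C': "0 < C'" "\<And>\<nu>. \<nu> \<in> B \<Longrightarrow> seminorm_mloc n \<nu> \<le> C'"
    using bound by (auto simp: C'_def le_max_iff_disj)
  obtain g where g: "locally_integrable g" "G = abs_l1loc g"
    by (rule l1loc_cases)
  \<comment> \<open>The 16 leaves 4 e1 C' = e/4 after the factor 4 of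
    \<open>rint_le_seminorm\<close>.\<close>
  define e1 where "e1 = e / (16 * C')"
  have e1: "0 < e1" "4 * e1 * C' = e / 4"
    using e C' by (auto simp: e1_def)
  obtain d where d: "0 < d" "\<And>s. \<bar>s\<bar> < d \<Longrightarrow> (LINT u|lborel. cmod (indicator {0..<real n} (u - s) *\<^sub>R g (u - s)
      - indicator {0..<real n} u *\<^sub>R g u)) < e1"
    using L1_translation_continuous[of "\<lambda>u. indicator {0..<real n} u *\<^sub>R g u" e1] set_integrable_Ico[OF g(1), of "real n"] e1
    by (auto simp: set_integrable_def)
  obtain M where M: "1 / real (Suc M) < d"
    using d(1) reals_Archimedean[of d] by (auto simp: inverse_eq_divide)
  \<comment> \<open>The mesh 1/N is below the translation modulus \<open>d\<close>. As
    \<open>N\<close> is an integer, \<open>J\<close> = n N cells fill [0,n) exactly.\<close>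
  define N where "N = real (Suc M)"
  have N: "0 < N" "1 / N < d"
    using M by (auto simp: N_def)
  define J where "J = n * Suc M"
  have J: "real J = real n * N"
    unfolding J_def N_def by (rule of_nat_mult)
  \<comment> \<open>The part in [0,n) of the cell from j/N to (j+1)/N, written through the floor so
    that the index of the cell containing \<open>t\<close> is explicit. \<open>nat\<close> sends
    negative floors to 0, so cell 0 must exclude negative \<open>t\<close>.\<close>
  define I where "I j = {t. 0 \<le> t \<and> nat \<lfloor>t * N\<rfloor> = j} \<inter> {0..<real n}" for j
  have "(\<lambda>t. nat \<lfloor>t * N\<rfloor>) -` {j} \<in> sets borel" for j
    by (rule measurable_sets_borel[of _ "count_space UNIV"]) measurable
  then have "(\<lambda>t. nat \<lfloor>t * N\<rfloor>) -` {j} \<inter> {0..<real n} \<in> sets borel" for j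
    by (intro sets.Int) auto
  moreover have "(\<lambda>t. nat \<lfloor>t * N\<rfloor>) -` {j} \<inter> {0..<real n} = I j" for j
    by (auto simp: I_def)
  ultimately have "I j \<in> sets borel" for j
    by simp
  then have I: "I j \<in> bounded_borel" "I j \<subseteq> {0..<real n}" for j
    by (auto intro!: bounded_borel_subset[OF bounded_borel_Ico[of "real n"]] simp: I_def)
  define E where "E j = shift_mloc (real j / N) (embed G)" for j
  have approx: "seminorm_mloc n (conv_mloc \<nu> (embed G) - (\<Sum>j<J. scale_mloc (mloc_fun \<nu> (I j)) (E j))) \<le> e / 4"
    if \<nu>: "\<nu> \<in> B" for \<nu>
  proof (rule seminorm_mloc_dual)
    fix h
    assume h: "integrand h" "\<And>t. 0 \<le> t \<Longrightarrow> cmod (h t) \<le> 1" "\<And>t. real n \<le> t \<Longrightarrow> h t = 0"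
    define \<Phi> where "\<Phi> t = rint (embed G) (\<lambda>u. h (t + u))" for t
    \<comment> \<open>The error as a function: \<Phi> minus its step interpolation at the left end
      points j/N. Pairing \<nu> with it gives the error of the approximation tested against
      \<open>h\<close>.\<close>
    define \<psi> where "\<psi> t = \<Phi> t - (\<Sum>j<J. \<Phi> (real j / N) * indicator (I j) t)" for t
    have \<Phi>: "integrand \<Phi>"
      unfolding \<Phi>_def[abs_def] by (intro integrand_rint integrand2_shift h)
    have sum: "integrand (\<lambda>t. \<Sum>j<J. \<Phi> (real j / N) * indicator (I j) t)"
      using I by (intro integrand_sum integrand_scale integrand_indicator) auto
    have "rint (conv_mloc \<nu> (embed G) - (\<Sum>j<J. scale_mloc (mloc_fun \<nu> (I j)) (E j))) h =
        rint \<nu> \<Phi> - (\<Sum>j<J. mloc_fun \<nu> (I j) * \<Phi> (real j / N))"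
      using h N by (simp add: rint_minus rint_conv rint_sum_mloc rint_scale_mloc E_def rint_shift \<Phi>_def[abs_def])
    also have "(\<Sum>j<J. mloc_fun \<nu> (I j) * \<Phi> (real j / N)) = rint \<nu> (\<lambda>t. \<Sum>j<J. \<Phi> (real j / N) * indicator (I j) t)"
      using I by (subst rint_sum) (simp_all add: rint_scale rint_indicator integrand_scale mult.commute[of "mloc_fun \<nu> _"])
    also have "rint \<nu> \<Phi> - \<dots> = rint \<nu> \<psi>"
      unfolding \<psi>_def[abs_def] by (rule rint_diff[symmetric, OF \<Phi> sum])
    also have "cmod \<dots> \<le> 4 * e1 * seminorm_mloc n \<nu>"
    proof (rule rint_le_seminorm)
      show "integrand \<psi>"
        unfolding \<psi>_def[abs_def] by (rule integrand_diff[OF \<Phi> sum])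
      show z: "\<psi> t = 0" if "real n \<le> t" for t
      proof -
        have "\<Phi> t = 0"
          unfolding \<Phi>_def using that h(3) rint_cong[of "\<lambda>u. h (t + u)" "\<lambda>_. 0"] by simp
        then show ?thesis
          using that by (auto simp: \<psi>_def I_def intro!: sum.neutral)
      qed
      show "cmod (\<psi> t) \<le> e1" if t: "0 \<le> t" for t
      proof (cases "t < real n")
        case True
        define j where "j = nat \<lfloor>t * N\<rfloor>"
        have "0 \<le> t * N"
          using t N by simp
        then have j: "real j \<le> t * N" "t * N < real j + 1"
          by (auto simp: j_def)
        have "t * N < real J"
          unfolding J using True N by simp
        then have "j < J"
          using j by linarith
        have "(\<Sum>i<J. \<Phi> (real i / N) * indicator (I i) t) = (\<Sum>i<J. if i = j then \<Phi> (real i / N) else 0)"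
          using t True by (intro sum.cong) (auto simp: I_def j_def)
        then have "\<psi> t = \<Phi> t - \<Phi> (real j / N)"
          using \<open>j < J\<close> by (simp add: \<psi>_def)
        moreover have "real j / N \<le> t" "t - real j / N < d"
        proof -
          show "real j / N \<le> t"
            using j N by (simp add: field_simps)
          have "t < (real j + 1) / N"
            using j N by (simp add: pos_less_divide_eq)
          then have "t - real j / N < 1 / N"
            by (simp add: add_divide_distrib)
          then show "t - real j / N < d"
            using N by simp
        qed
        moreover have "cmod (\<Phi> t - \<Phi> (real j / N)) \<le> (LINT u|lborel. cmod (indicator {0..<real n} (u - (t - real j / N)) *\<^sub>R g (u - (t - real j / N))
            - indicator {0..<real n} u *\<^sub>R g u))"
          unfolding \<Phi>_def g(2) using N \<open>real j / N \<le> t\<close> by (intro rint_embed_shift_close g h) auto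
        moreover have "\<dots> < e1"
          using calculation by (intro d(2)) auto
        ultimately show ?thesis
          by simp
      qed (use z e1 in auto)
    qed (use e1 in auto)
    also have "\<dots> \<le> 4 * e1 * C'"
      using C'(2)[OF \<nu>] e1 by (intro mult_left_mono) auto
    finally show "cmod (rint (conv_mloc \<nu> (embed G) - (\<Sum>j<J. scale_mloc (mloc_fun \<nu> (I j)) (E j))) h) \<le> e / 4"
      using e1 by simp
  qed
  \<comment> \<open>The summand 1 keeps \<open>W\<close> positive even if all \<open>E j\<close>
    vanish. Coefficients correct to e/(2 W) cost at most e/2, which together with the earlier e/4
    stays below e.\<close>
  define W where "W = (\<Sum>j<J. seminorm_mloc n (E j)) + 1"
  have W: "0 < W" "(\<Sum>j<J. seminorm_mloc n (E j)) < W"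
    using sum_nonneg[of "{..<J}" "\<lambda>j. seminorm_mloc n (E j)"] by (auto simp: W_def mloc.nonneg)
  obtain Z where Z: "finite Z" "cball (0::complex) C' \<subseteq> (\<Union>z\<in>Z. ball z (e / (2 * W)))"
  proof -
    have "seq_compact (cball (0::complex) C')"
      by (intro compact_imp_seq_compact compact_cball)
    moreover have "0 < e / (2 * W)"
      using e W by simp
    ultimately have "\<exists>Z. finite Z \<and> Z \<subseteq> cball 0 C' \<and> cball (0::complex) C' \<subseteq> (\<Union>z\<in>Z. ball z (e / (2 * W)))"
      using seq_compact_imp_totally_bounded[of "cball (0::complex) C'"] by simp
    then show ?thesis
      using that by (elim exE conjE)
  qed
  \<comment> \<open>Extensional functions on \<open>{..<J}\<close> are taken because only finitely
    many of them map into the finite set \<open>Z\<close>.\<close>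
  define K where "K = (\<lambda>c. \<Sum>j<J. scale_mloc (c j) (E j)) ` ({..<J} \<rightarrow>\<^sub>E Z)"
  have "finite K"
    unfolding K_def using Z(1) by (intro finite_imageI finite_PiE) auto
  moreover have "\<exists>k\<in>K. seminorm_mloc n (conv_mloc \<nu> (embed G) - k) < e" if \<nu>: "\<nu> \<in> B" for \<nu>
  proof -
    have "\<exists>z\<in>Z. cmod (mloc_fun \<nu> (I j) - z) < e / (2 * W)" for j
    proof -
      have "mloc_fun \<nu> (I j) \<in> cball 0 C'"
        using order.trans[OF cmod_mloc_fun_le_seminorm[OF I(1) I(2)] C'(2)[OF \<nu>]] by simp
      then show ?thesis
      proof -
        obtain z where "z \<in> Z" "mloc_fun \<nu> (I j) \<in> ball z (e / (2 * W))"
          using Z(2) \<open>mloc_fun \<nu> (I j) \<in> cball 0 C'\<close> by blast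
        then show ?thesis
          by (intro bexI[of _ z]) (simp_all add: dist_norm norm_minus_commute)
      qed
    qed
    then obtain c where c: "\<And>j. c j \<in> Z" "\<And>j. cmod (mloc_fun \<nu> (I j) - c j) < e / (2 * W)"
      by metis
    let ?k = "\<Sum>j<J. scale_mloc (restrict c {..<J} j) (E j)"
    have "?k \<in> K"
      unfolding K_def using c(1)
      by (intro image_eqI[of _ _ "restrict c {..<J}"] refl) (simp only: restrict_PiE_iff, blast)
    moreover have "seminorm_mloc n (conv_mloc \<nu> (embed G) - ?k) < e"
    proof -
      interpret vector_space scale_mloc
        by (rule vector_space_mloc)
      have "(\<Sum>j<J. scale_mloc (mloc_fun \<nu> (I j)) (E j)) - ?k = (\<Sum>j<J. scale_mloc (mloc_fun \<nu> (I j) - c j) (E j))"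
        by (simp add: sum_subtractf[symmetric] scale_left_diff_distrib)
      also have "seminorm_mloc n \<dots> \<le> (\<Sum>j<J. cmod (mloc_fun \<nu> (I j) - c j) * seminorm_mloc n (E j))"
        by (rule order.trans[OF seminorm_mloc_sum]) (intro sum_mono seminorm_mloc_scale)
      also have "\<dots> \<le> (\<Sum>j<J. e / (2 * W) * seminorm_mloc n (E j))"
        using c(2) by (intro sum_mono mult_right_mono mloc.nonneg less_imp_le)
      also have "\<dots> = e / (2 * W) * (\<Sum>j<J. seminorm_mloc n (E j))"
        by (simp add: sum_distrib_left)
      also have "\<dots> \<le> e / (2 * W) * W"
        using W e by (intro mult_left_mono) auto
      also have "\<dots> = e / 2"
        using W by simp
      finally show ?thesis
        using approx[OF \<nu>] e
          mloc.triangle3[of n "conv_mloc \<nu> (embed G)" ?k "\<Sum>j<J. scale_mloc (mloc_fun \<nu> (I j)) (E j)"]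
        by linarith
    qed
    ultimately show ?thesis
      by blast
  qed
  ultimately show ?thesis
    by blast
qed

section \<open>The derivations\<close>

text \<open>The definite description in \<open>D_l1loc\<close> is legitimate: existence is the ideal
  property with Radon--Nikodym, uniqueness the injectivity of \<open>embed\<close>. This equation is
  the access to \<open>D_l1loc\<close> from here on.\<close>

lemma embed_D_l1loc: "embed (D_l1loc \<mu> F) = D_mloc \<mu> (embed F)"
proof -
  have "absolutely_continuous_mloc (conv_mloc (embed (X_l1loc F)) \<mu>)"
    by (intro absolutely_continuous_conv absolutely_continuous_embed)
  then obtain G where "embed G = conv_mloc (embed (X_l1loc F)) \<mu>"
    by (rule Radon_Nikodym_mloc)
  then have "\<exists>!G. embed G = conv_mloc (embed (X_l1loc F)) \<mu>"
    by (metis embed_inject)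
  from theI'[OF this] show ?thesis
    unfolding D_l1loc_def D_mloc_def embed_X .
qed

lemma linear_D_mloc: "Vector_Spaces.linear scale_mloc scale_mloc (D_mloc \<mu>)"
  using derivation_D_mloc by (simp add: derivation_def)

text \<open>\<open>embed\<close> is an injective homomorphism intertwining the two maps, so the
  product rule is inherited.\<close>

lemma derivation_D_l1loc: "derivation scale_l1loc conv_l1loc (D_l1loc \<mu>)"
  unfolding derivation_def
proof (intro conjI allI)
  interpret D: Vector_Spaces.linear scale_mloc scale_mloc "D_mloc \<mu>"
    by (rule linear_D_mloc)
  interpret vector_space scale_l1loc
    by (rule vector_space_l1loc)
  show "Vector_Spaces.linear scale_l1loc scale_l1loc (D_l1loc \<mu>)"
    by unfold_locales
      (simp_all add: embed_inject[symmetric] embed_D_l1loc embed_add embed_scale D.add D.scale)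
  fix F G
  show "D_l1loc \<mu> (conv_l1loc F G) = conv_l1loc (D_l1loc \<mu> F) G + conv_l1loc F (D_l1loc \<mu> G)"
    using derivation_D_mloc[of \<mu>]
    by (simp add: embed_inject[symmetric] embed_D_l1loc embed_add embed_conv derivation_def)
qed

section \<open>Continuous functionals given by integrands\<close>

lemma rint_seminorm_bound:
  assumes h: "integrand h"
  obtains C n where "0 \<le> C" "\<And>\<nu>. cmod (rint \<nu> h) \<le> C * seminorm_mloc n \<nu>"
proof -
  obtain K T where K: "0 \<le> K" "\<And>t. 0 \<le> t \<Longrightarrow> cmod (h t) \<le> K" and T: "0 \<le> T" "\<And>t. 0 \<le> t \<Longrightarrow> T < t \<Longrightarrow> h t = 0"
    using h by (rule integrandE) blast
  obtain n where "T < real n"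
    using reals_Archimedean2 by blast
  then have "cmod (rint \<nu> h) \<le> 4 * K * seminorm_mloc n \<nu>" for \<nu>
    using K T by (intro rint_le_seminorm h) auto
  then show ?thesis
    using K(1) by (intro that[of "4 * K" n]) auto
qed

text \<open>These functionals serve twice: they separate points, which makes the weak topology
  Hausdorff, and with indicators as integrands they detect null sets.\<close>

lemma continuous_functional_rint:
  assumes h: "integrand h"
  shows "continuous_functional scale_mloc seminorm_mloc (\<lambda>\<nu>. rint \<nu> h)"
proof -
  obtain C n where "\<And>\<nu>. cmod (rint \<nu> h) \<le> C * seminorm_mloc n \<nu>"
    using h by (rule rint_seminorm_bound) blast
  then show ?thesis
    by (intro mloc.continuous_functionalI linear_functionalI vector_space_mloc rint_plus rint_scale_mloc h)
qed

lemma continuous_functional_rint_embed: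
  assumes h: "integrand h"
  shows "continuous_functional scale_l1loc seminorm_l1loc (\<lambda>F. rint (embed F) h)"
proof -
  obtain C n where C: "0 \<le> C" "\<And>\<nu>. cmod (rint \<nu> h) \<le> C * seminorm_mloc n \<nu>"
    using h by (rule rint_seminorm_bound) blast
  have "cmod (rint (embed F) h) \<le> C * seminorm_l1loc n F" for F
    using C(2)[of "embed F"] mult_left_mono[OF seminorm_embed_le C(1), of n F] by linarith
  then show ?thesis
    by (intro l1loc.continuous_functionalI linear_functionalI vector_space_l1loc)
      (simp_all add: embed_add embed_scale rint_plus rint_scale_mloc h)
qed

lemma separating_rint:
  assumes "\<nu> \<noteq> 0"
  shows "\<exists>h. integrand h \<and> rint \<nu> h \<noteq> 0"
  using mloc_eqI[of \<nu> 0] assms by (auto simp: rint_0_mloc)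

section \<open>Absolutely continuous \<mu> gives Montel derivations\<close>

lemma D_mloc_totally_bounded:
  assumes B: "seminorm_bounded seminorm_mloc B" and e: "0 < e"
  shows "\<exists>K. finite K \<and> (\<forall>x\<in>D_mloc (embed G) ` B. \<exists>k\<in>K. seminorm_mloc n (x - k) < e)"
proof -
  obtain C where C: "\<And>\<nu>. \<nu> \<in> B \<Longrightarrow> seminorm_mloc n \<nu> \<le> C"
    using B unfolding seminorm_bounded_def bdd_above_def by blast
  have "seminorm_mloc n \<nu> \<le> 4 * real n * C" if \<nu>: "\<nu> \<in> X_mloc ` B" for \<nu>
  proof -
    obtain \<kappa> where \<kappa>: "\<kappa> \<in> B" "\<nu> = X_mloc \<kappa>"
      using \<nu> by blast
    have "seminorm_mloc n \<nu> \<le> 4 * real n * seminorm_mloc n \<kappa>"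
      unfolding \<kappa>(2) by (rule seminorm_mloc_X)
    also have "\<dots> \<le> 4 * real n * C"
      by (intro mult_left_mono C \<kappa>(1)) simp
    finally show ?thesis .
  qed
  from conv_embed_totally_bounded[where B = "X_mloc ` B", OF this e] show ?thesis
    by (simp add: D_mloc_def)
qed

lemma montel_D_mloc: "montel_operator scale_mloc seminorm_mloc scale_mloc seminorm_mloc (D_mloc (embed G))"
  unfolding montel_operator_def
proof (intro conjI allI impI linear_D_mloc)
  fix B
  assume B: "seminorm_bounded seminorm_mloc B"
  show "relatively_compactin (seminorm_topology seminorm_mloc) (D_mloc (embed G) ` B)"
  proof (rule mloc.relatively_compactin_seminorm_topology)
    show "\<exists>y. \<forall>n. (\<lambda>k. seminorm_mloc n (x k - y)) \<longlonglongrightarrow> 0"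
      if "\<And>n e. 0 < e \<Longrightarrow> \<exists>M. \<forall>k\<ge>M. \<forall>l\<ge>M. seminorm_mloc n (x k - x l) < e" for x
      using mloc_complete[of x] that by metis
  qed (rule D_mloc_totally_bounded[OF B])
qed

lemma montel_D_l1loc: "montel_operator scale_l1loc seminorm_l1loc scale_l1loc seminorm_l1loc (D_l1loc (embed G))"
  unfolding montel_operator_def
proof (intro conjI allI impI)
  show "Vector_Spaces.linear scale_l1loc scale_l1loc (D_l1loc (embed G))"
    using derivation_D_l1loc by (simp add: derivation_def)
  fix B
  assume B: "seminorm_bounded seminorm_l1loc B"
  have B': "seminorm_bounded seminorm_mloc (embed ` B)"
    unfolding seminorm_bounded_def
  proof
    fix n
    obtain C where "\<And>F. F \<in> B \<Longrightarrow> seminorm_l1loc n F \<le> C"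
      using B unfolding seminorm_bounded_def bdd_above_def by blast
    then show "bdd_above (seminorm_mloc n ` embed ` B)"
      using order.trans[OF seminorm_embed_le] by (intro bdd_aboveI[of _ C]) blast
  qed
  show "relatively_compactin (seminorm_topology seminorm_l1loc) (D_l1loc (embed G) ` B)"
  proof (rule l1loc.relatively_compactin_seminorm_topology[OF l1loc_complete])
    fix n and e :: real
    assume e: "0 < e"
    obtain K where K: "finite K"
      "\<And>F. F \<in> B \<Longrightarrow> \<exists>k\<in>K. seminorm_mloc n (embed (D_l1loc (embed G) F) - k) < e / 8"
      using D_mloc_totally_bounded[OF B', of "e / 8" G n] e by (auto simp: embed_D_l1loc)
    \<comment> \<open>The centres \<open>k\<close> are arbitrary measures and may have no density,
      so each useful one is replaced by an image \<open>D_l1loc (embed G) F\<close> near it. The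
      radius e/8 doubles to e/4, and the comparison of seminorms multiplies it by 4.\<close>
    define c where "c k = D_l1loc (embed G) (SOME F. F \<in> B \<and> seminorm_mloc n (embed (D_l1loc (embed G) F) - k) < e / 8)" for k
    have "\<exists>k\<in>c ` K. seminorm_l1loc n (D_l1loc (embed G) F - k) < e" if F: "F \<in> B" for F
    proof -
      obtain k where k: "k \<in> K" "seminorm_mloc n (embed (D_l1loc (embed G) F) - k) < e / 8"
        using K(2)[OF F] by blast
      have "\<exists>F. F \<in> B \<and> seminorm_mloc n (embed (D_l1loc (embed G) F) - k) < e / 8"
        using F k by blast
      from someI_ex[OF this] have "seminorm_mloc n (embed (c k) - k) < e / 8"
        by (simp add: c_def)
      then have "seminorm_mloc n (embed (D_l1loc (embed G) F) - embed (c k)) < e / 4"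
        using k(2) mloc.triangle3[of n "embed (D_l1loc (embed G) F)" "embed (c k)" k] mloc.minus_commute[of n k "embed (c k)"]
        by linarith
      then have "seminorm_l1loc n (D_l1loc (embed G) F - c k) < e"
        using seminorm_l1loc_le[of n "D_l1loc (embed G) F - c k"] by (simp add: embed_diff)
      then show ?thesis
        using k(1) by blast
    qed
    then show "\<exists>K. finite K \<and> (\<forall>x\<in>D_l1loc (embed G) ` B. \<exists>k\<in>K. seminorm_l1loc n (x - k) < e)"
      using K(1) by (intro exI[of _ "c ` K"]) auto
  qed
qed

section \<open>Spikes at 1 and the converse implications\<close>

definition spike :: "nat \<Rightarrow> real \<Rightarrow> complex" where
  "spike n t = of_nat (Suc n) * indicator {1..<1 + 1 / real (Suc n)} t"

lemma integrable_spike: "integrable lborel (spike n)" and integral_spike: "(LINT t|lborel. spike n t) = 1"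
  and integral_cmod_spike: "(LINT t|lborel. cmod (spike n t)) = 1"
proof -
  have fin: "emeasure lborel {1..<1 + 1 / real (Suc n)} < \<infinity>"
    by simp
  have m: "measure lborel {1..<1 + 1 / real (Suc n)} = 1 / real (Suc n)"
    by simp
  have eq: "spike n t = complex_of_real (real (Suc n) * indicator {1..<1 + 1 / real (Suc n)} t)" for t
    by (simp add: spike_def indicator_def)
  have int: "integrable lborel (\<lambda>t. real (Suc n) * indicator {1..<1 + 1 / real (Suc n)} t)"
    using fin by (intro integrable_mult_right integrable_real_indicator) auto
  show "integrable lborel (spike n)"
    unfolding eq[abs_def] using int by (rule integrable_of_real)
  have "(LINT t|lborel. real (Suc n) * indicator {1..<1 + 1 / real (Suc n)} t) = real (Suc n) * measure lborel {1..<1 + 1 / real (Suc n)}"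
    by (simp only: integral_mult_right_zero) simp
  then have I: "(LINT t|lborel. real (Suc n) * indicator {1..<1 + 1 / real (Suc n)} t) = 1"
    by (simp only: m) simp
  show "(LINT t|lborel. spike n t) = 1"
    unfolding eq integral_complex_of_real I by simp
  have "cmod (spike n t) = real (Suc n) * indicator {1..<1 + 1 / real (Suc n)} t" for t
    by (simp add: spike_def indicator_def norm_of_nat del: of_nat_Suc)
  then show "(LINT t|lborel. cmod (spike n t)) = 1"
    using I by simp
qed

lemma locally_integrable_spike: "locally_integrable (spike n)"
  unfolding locally_integrable_def set_integrable_def
  using integrable_spike by (intro allI integrable_mult_indicator) auto

definition spike_l1loc :: "nat \<Rightarrow> l1loc" where
  "spike_l1loc n = abs_l1loc (spike n)"

lemma seminorm_spike: "seminorm_l1loc m (spike_l1loc n) \<le> 1"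
  unfolding spike_l1loc_def seminorm_l1loc_abs[OF locally_integrable_spike] set_lebesgue_integral_def
    integral_cmod_spike[of n, symmetric]
proof (rule integral_mono)
  show "integrable lborel (\<lambda>t. cmod (spike n t))"
    using integrable_spike by (rule integrable_norm)
  then show "integrable lborel (\<lambda>t. indicator {0..<real m} t *\<^sub>R cmod (spike n t))"
    by (intro integrable_mult_indicator) auto
qed (auto simp: indicator_def)

text \<open>The spikes are probability densities whose supports shrink to 1 from the right, so in
  the limit they evaluate an integrand that is right-continuous there.\<close>

lemma rint_spike_tendsto:
  assumes k: "integrand k" and cont: "(k \<longlongrightarrow> k 1) (at_right 1)"
  shows "(\<lambda>n. rint (embed (spike_l1loc n)) k) \<longlonglongrightarrow> k 1"
proof (rule LIMSEQ_I)
  fix e :: real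
  assume e: "0 < e"
  then have "\<forall>\<^sub>F t in at_right 1. dist (k t) (k 1) < e / 2"
    using cont by (intro tendstoD) auto
  then obtain b where b: "1 < b" "\<And>t. 1 < t \<Longrightarrow> t < b \<Longrightarrow> dist (k t) (k 1) < e / 2"
    by (auto simp: eventually_at_right[of 1 2])
  then have close: "cmod (k t - k 1) \<le> e / 2" if "1 \<le> t" "t < b" for t
    using that e by (cases "t = 1") (force simp: dist_norm)+
  obtain N where N: "1 / real (Suc N) < b - 1"
    using b(1) reals_Archimedean[of "b - 1"] by (auto simp: inverse_eq_divide)
  have "cmod (rint (embed (spike_l1loc n)) k - k 1) \<le> e / 2" if n: "N \<le> n" for n
  proof -
    \<comment> \<open>A nonzero constant is not an integrand, as its support is unbounded. The
      cut-off at 2 keeps it equal to \<open>k 1\<close> on every spike, since 1 + 1/(n+1) \<le>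
      2.\<close>
    define \<psi> where "\<psi> t = k t - k 1 * indicator {0..2} t" for t
    have \<psi>: "integrand \<psi>"
      unfolding \<psi>_def[abs_def] by (intro integrand_diff integrand_scale k) simp
    have "1 / real (Suc n) \<le> 1 / real (Suc N)"
      using n by (simp add: field_simps)
    then have nb: "1 + 1 / real (Suc n) \<le> b"
      using N by linarith
    have n2: "1 + 1 / real (Suc n) \<le> 2"
      by (simp add: field_simps)
    have "rint (embed (spike_l1loc n)) (indicator {0..2}) = (LINT t|lborel. spike n t)"
      unfolding spike_l1loc_def rint_embed[OF locally_integrable_spike integrand_indicator[OF bounded_borel_Icc]]
        set_lebesgue_integral_def
    proof (intro Bochner_Integration.integral_cong refl)
      fix t :: real
      have "t \<in> {0..2}" if "t \<in> {1..<1 + 1 / real (Suc n)}"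
        using that n2 unfolding atLeastAtMost_iff atLeastLessThan_iff by linarith
      then show "indicator {0..} t *\<^sub>R (spike n t * indicator {0..2} t) = spike n t"
        by (cases "t \<in> {1..<1 + 1 / real (Suc n)}") (simp_all add: spike_def del: of_nat_Suc)
    qed
    then have "rint (embed (spike_l1loc n)) k - k 1 = rint (embed (spike_l1loc n)) \<psi>"
      unfolding \<psi>_def[abs_def] by (subst rint_diff) (auto simp: k integrand_scale rint_scale integral_spike)
    also have "cmod \<dots> \<le> (LINT t|lborel. cmod (indicator {0..} t *\<^sub>R (spike n t * \<psi> t)))"
      unfolding spike_l1loc_def rint_embed[OF locally_integrable_spike \<psi>] set_lebesgue_integral_def
      by (rule integral_norm_bound)
    also have "\<dots> \<le> (LINT t|lborel. e / 2 * cmod (spike n t))"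
    proof (rule integral_mono)
      show "integrable lborel (\<lambda>t. cmod (indicator {0..} t *\<^sub>R (spike n t * \<psi> t)))"
        by (intro integrable_norm integrable_embed locally_integrable_spike \<psi>)
      show "integrable lborel (\<lambda>t. e / 2 * cmod (spike n t))"
        by (intro integrable_mult_right integrable_norm integrable_spike)
      show "cmod (indicator {0..} t *\<^sub>R (spike n t * \<psi> t)) \<le> e / 2 * cmod (spike n t)" for t
      proof (cases "t \<in> {1..<1 + 1 / real (Suc n)}")
        case True
        then have "1 \<le> t" "t < b" "t \<in> {0..2}"
          using nb n2 unfolding atLeastAtMost_iff atLeastLessThan_iff by linarith+
        then have "cmod (\<psi> t) \<le> e / 2"
          using close[of t] by (simp add: \<psi>_def)
        then show ?thesis
          using mult_right_mono[of "cmod (\<psi> t)" "e / 2" "cmod (spike n t)"] True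
          by (simp add: norm_mult mult.commute)
      qed (simp add: spike_def)
    qed
    also have "\<dots> = e / 2"
      by (simp add: integral_cmod_spike)
    finally show ?thesis .
  qed
  then show "\<exists>N. \<forall>n\<ge>N. norm (rint (embed (spike_l1loc n)) k - k 1) < e"
    using e by (intro exI[of _ N]) force
qed

text \<open>The left side tests the spike against t G(t), where G(t) is the pairing of \<mu> with
  the translate of \<open>h\<close> by t. Continuity of \<open>h\<close> and dominated convergence
  make \<open>G\<close> right-continuous at 1, where the factor t equals 1.\<close>

lemma rint_D_spike_tendsto:
  assumes h: "test_function h"
  shows "(\<lambda>n. rint (D_mloc \<mu> (embed (spike_l1loc n))) h) \<longlonglongrightarrow> rint \<mu> (\<lambda>s. h (1 + s))"
proof -
  note hi = test_function_integrand[OF h]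
  define G where "G t = rint \<mu> (\<lambda>s. h (t + s))" for t
  have G: "integrand G"
    unfolding G_def[abs_def] by (intro integrand_rint integrand2_shift hi)
  obtain K T where K: "0 \<le> K" "\<And>t. 0 \<le> t \<Longrightarrow> cmod (h t) \<le> K" and T: "\<And>t. 0 \<le> t \<Longrightarrow> T < t \<Longrightarrow> h t = 0"
    using hi by (rule integrandE) blast
  have "(G \<longlongrightarrow> G 1) (at_right 1)"
    unfolding tendsto_at_iff_sequentially
  proof (intro allI impI)
    fix x :: "nat \<Rightarrow> real"
    assume x: "\<forall>i. x i \<in> {1<..} - {1}" "x \<longlonglongrightarrow> 1"
    then have x0: "0 \<le> x i" for i
      by (auto intro: less_imp_le order.strict_trans[OF zero_less_one])
    have "bounded_limit (\<lambda>i s. h (x i + s)) (\<lambda>s. h (1 + s))"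
    proof (rule bounded_limitI[of _ K T])
      show "integrand (\<lambda>s. h (x i + s))" for i
        by (rule integrand_shift[OF hi x0])
      show "cmod (h (x i + s)) \<le> K" if "0 \<le> s" for i s
        using K(2) x0[of i] that by simp
      show "h (x i + s) = 0" if "0 \<le> s" "T < s" for i s
        using T[of "x i + s"] x0[of i] that by simp
      show "(\<lambda>i. h (x i + s)) \<longlonglongrightarrow> h (1 + s)" if "0 \<le> s" for s
      proof (rule continuous_on_tendsto_compose[of "{0..}" h])
        show "continuous_on {0..} h"
          using h by (simp add: test_function_def)
        show "(\<lambda>i. x i + s) \<longlonglongrightarrow> 1 + s"
          by (intro tendsto_intros x)
      qed (use that x0 in auto)
    qed
    then show "((G \<circ> x) \<longlongrightarrow> G 1) sequentially"
      unfolding G_def comp_def by (rule rint_tendsto)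
  qed
  then have "((\<lambda>t. of_real t * G t) \<longlongrightarrow> of_real 1 * G 1) (at_right 1)"
    by (intro tendsto_intros)
  then have "(\<lambda>n. rint (embed (spike_l1loc n)) (\<lambda>t. of_real t * G t)) \<longlonglongrightarrow> of_real 1 * G 1"
    by (intro rint_spike_tendsto integrand_X G)
  then show ?thesis
    using G by (simp add: D_mloc_def rint_conv[OF hi] rint_X G_def[abs_def])
qed

text \<open>Test functions identify \<nu> as the translate of \<mu> by 1. A bounded null set moved
  to the right by 1 is again a bounded null set of the half-line, and \<nu> takes there the value of
  \<mu> on the original set.\<close>

lemma absolutely_continuous_if_shift:
  assumes \<nu>: "absolutely_continuous_mloc \<nu>"
    and eq: "\<And>h. test_function h \<Longrightarrow> rint \<nu> h = rint \<mu> (\<lambda>s. h (1 + s))"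
  shows "absolutely_continuous_mloc \<mu>"
  unfolding absolutely_continuous_mloc_def
proof (intro ballI impI)
  fix A
  assume A: "A \<in> bounded_borel" "A \<in> null_sets lborel"
  have "\<nu> = shift_mloc 1 \<mu>"
    by (rule mloc_eqI_test) (simp add: eq rint_shift test_function_integrand)
  \<comment> \<open>This is \<open>A\<close> moved to the right by 1, so that its indicator at 1 + s
    is that of \<open>A\<close> at s.\<close>
  let ?B = "(\<lambda>s. - 1 + s) -` A"
  have null: "?B \<in> null_sets lborel"
    by (rule null_sets_lborel_shift[OF A(2)])
  obtain T where T: "A \<subseteq> {0..T}"
    using A(1) by (rule bounded_borel_bound)
  have B: "?B \<in> bounded_borel"
  proof (rule bounded_borel_subset[OF bounded_borel_Icc[of "T + 1"]])
    show "?B \<subseteq> {0..T + 1}"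
      using T by force
    show "?B \<in> sets borel"
      using null by (simp add: null_sets_def)
  qed
  have "mloc_fun \<mu> A = rint \<mu> (\<lambda>s. indicator ?B (1 + s))"
    using A(1) by (simp add: rint_indicator[symmetric] indicator_def[abs_def])
  also have "\<dots> = mloc_fun \<nu> ?B"
    using B \<open>\<nu> = shift_mloc 1 \<mu>\<close> by (simp add: rint_shift flip: rint_indicator)
  also have "\<dots> = 0"
    using \<nu> B null by (simp add: absolutely_continuous_mloc_def)
  finally show "mloc_fun \<mu> A = 0" .
qed

lemma weakly_montel_mloc_imp_absolutely_continuous:
  assumes "weakly_montel_operator scale_mloc seminorm_mloc scale_mloc seminorm_mloc (D_mloc \<mu>)"
  shows "absolutely_continuous_mloc \<mu>"
proof -
  let ?x = "\<lambda>n. D_mloc \<mu> (embed (spike_l1loc n))"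
  have "seminorm_bounded seminorm_mloc (range (\<lambda>n. embed (spike_l1loc n)))"
    unfolding seminorm_bounded_def
    using order.trans[OF seminorm_embed_le seminorm_spike] by (intro allI bdd_aboveI[of _ 1]) blast
  then have "relatively_compactin (weak_topology scale_mloc seminorm_mloc) (D_mloc \<mu> ` range (\<lambda>n. embed (spike_l1loc n)))"
    using assms by (simp add: weakly_montel_operator_def)
  then obtain \<nu> where \<nu>: "\<And>\<phi> c. continuous_functional scale_mloc seminorm_mloc \<phi> \<Longrightarrow>
      (\<lambda>n. \<phi> (?x n)) \<longlonglongrightarrow> c \<Longrightarrow> \<phi> \<nu> = c"
    using weak_cluster_point[OF vector_space_mloc, where x = ?x] by blast
  show ?thesis
  proof (rule absolutely_continuous_if_shift)
    show "rint \<nu> h = rint \<mu> (\<lambda>s. h (1 + s))" if h: "test_function h" for h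
      by (rule \<nu>[OF continuous_functional_rint[OF test_function_integrand[OF h]] rint_D_spike_tendsto[OF h]])
    show "absolutely_continuous_mloc \<nu>"
      unfolding absolutely_continuous_mloc_def
    proof (intro ballI impI)
      fix A
      assume A: "A \<in> bounded_borel" "A \<in> null_sets lborel"
      \<comment> \<open>The spikes have densities, and \<open>D_mloc \<mu>\<close> preserves this
        for every \<mu> by the ideal property.\<close>
      have "absolutely_continuous_mloc (?x n)" for n
        unfolding embed_D_l1loc[symmetric] by (rule absolutely_continuous_embed)
      then have "rint (?x n) (indicator A) = 0" for n
        using A by (simp add: rint_indicator absolutely_continuous_mloc_def)
      then have "rint \<nu> (indicator A) = 0"
        using \<nu>[OF continuous_functional_rint[OF integrand_indicator[OF A(1)]], of 0] by simp
      then show "mloc_fun \<nu> A = 0"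
        using A(1) by (simp add: rint_indicator)
    qed
  qed
qed

lemma weakly_montel_l1loc_imp_absolutely_continuous:
  assumes "weakly_montel_operator scale_l1loc seminorm_l1loc scale_l1loc seminorm_l1loc (D_l1loc \<mu>)"
  shows "absolutely_continuous_mloc \<mu>"
proof -
  let ?x = "\<lambda>n. D_l1loc \<mu> (spike_l1loc n)"
  have "seminorm_bounded seminorm_l1loc (range spike_l1loc)"
    unfolding seminorm_bounded_def using seminorm_spike by (intro allI bdd_aboveI[of _ 1]) blast
  then have "relatively_compactin (weak_topology scale_l1loc seminorm_l1loc) (D_l1loc \<mu> ` range spike_l1loc)"
    using assms by (simp add: weakly_montel_operator_def)
  then obtain F where F: "\<And>\<phi> c. continuous_functional scale_l1loc seminorm_l1loc \<phi> \<Longrightarrow>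
      (\<lambda>n. \<phi> (?x n)) \<longlonglongrightarrow> c \<Longrightarrow> \<phi> F = c"
    using weak_cluster_point[OF vector_space_l1loc, where x = ?x] by blast
  show ?thesis
  \<comment> \<open>Here the cluster point is itself a function, so its absolute continuity is
    automatic.\<close>
  proof (rule absolutely_continuous_if_shift[OF absolutely_continuous_embed[of F]])
    show "rint (embed F) h = rint \<mu> (\<lambda>s. h (1 + s))" if h: "test_function h" for h
      by (rule F[OF continuous_functional_rint_embed[OF test_function_integrand[OF h]]])
        (unfold embed_D_l1loc, rule rint_D_spike_tendsto[OF h])
  qed
qed

theorem theorem3p7:
  fixes \<mu> :: mloc
  shows "(montel_derivation scale_l1loc seminorm_l1loc conv_l1loc (D_l1loc \<mu>) \<longleftrightarrow>
            weakly_montel_derivation scale_l1loc seminorm_l1loc conv_l1loc (D_l1loc \<mu>)) \<and>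
         (weakly_montel_derivation scale_l1loc seminorm_l1loc conv_l1loc (D_l1loc \<mu>) \<longleftrightarrow>
            absolutely_continuous_mloc \<mu>) \<and>
         (absolutely_continuous_mloc \<mu> \<longleftrightarrow>
            montel_derivation scale_mloc seminorm_mloc conv_mloc (D_mloc \<mu>)) \<and>
         (montel_derivation scale_mloc seminorm_mloc conv_mloc (D_mloc \<mu>) \<longleftrightarrow>
            weakly_montel_derivation scale_mloc seminorm_mloc conv_mloc (D_mloc \<mu>))"
proof -
  let ?M1 = "montel_operator scale_l1loc seminorm_l1loc scale_l1loc seminorm_l1loc (D_l1loc \<mu>)"
  let ?W1 = "weakly_montel_operator scale_l1loc seminorm_l1loc scale_l1loc seminorm_l1loc (D_l1loc \<mu>)"
  let ?M = "montel_operator scale_mloc seminorm_mloc scale_mloc seminorm_mloc (D_mloc \<mu>)"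
  let ?W = "weakly_montel_operator scale_mloc seminorm_mloc scale_mloc seminorm_mloc (D_mloc \<mu>)"
  have "?M1 \<and> ?M" if "absolutely_continuous_mloc \<mu>"
    using that montel_D_l1loc montel_D_mloc by (metis Radon_Nikodym_mloc)
  moreover have "?M1 \<Longrightarrow> ?W1"
  proof (erule montel_imp_weakly_montel[where p' = seminorm_l1loc, OF _ l1loc.zero])
    fix F :: l1loc
    assume "F \<noteq> 0"
    then have "embed F \<noteq> 0"
      using embed_inject[of F 0] by simp
    then show "\<exists>\<phi>. continuous_functional scale_l1loc seminorm_l1loc \<phi> \<and> \<phi> F \<noteq> 0"
      using separating_rint continuous_functional_rint_embed by blast
  qed
  moreover have "?M \<Longrightarrow> ?W"
    by (erule montel_imp_weakly_montel[where p' = seminorm_mloc, OF _ mloc.zero]) (use separating_rint continuous_functional_rint in blast)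
  \<comment> \<open>Both maps are derivations for every \<mu>, so only the operator properties are
    at stake; in each space they close the cycle absolutely continuous, Montel, weakly
    Montel.\<close>
  ultimately show ?thesis
    unfolding montel_derivation_def weakly_montel_derivation_def
    using derivation_D_l1loc[of \<mu>] derivation_D_mloc[of \<mu>]
      weakly_montel_l1loc_imp_absolutely_continuous[of \<mu>] weakly_montel_mloc_imp_absolutely_continuous[of \<mu>]
    by blast
qed

end
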